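(* Let $T \in \overline{\mathcal{AN}(H)}$ be hyponormal. Then there exist subspaces $H_0, H_1, H_2$ such that $H = H_0 \oplus H_1 \oplus H_2$ and, with respect to this decomposition, $$T = \begin{pmatrix} V_0 & 0 & 0 \\ 0 & \alpha V_1 & A \\ 0 & 0 & B \end{pmatrix},$$ where $\sigma_{ess}(|T|) = \{\alpha\}$, $\alpha \geq 0$, and (i) $V_0 = \bigoplus_{i=1}^{n} \alpha_i U_i$, where $U_i$ is unitary on $N(|T| - \alpha_i I)$ and $(\alpha, \|T\|] \cap \sigma(|T|) = \{\alpha_i\}_{i=1}^{n}$ for some $n \in \mathbb{N} \cup \{\infty\}$; if $\alpha = \|T\|$, then $H_0 = \{0\}$; (ii) $V_1$ is an isometry on $H_1$ if $H_1 \neq \{0\}$, otherwise $V_1 = 0$; (iii) $A \in \mathcal{B}(H_2, H_1)$ and $B \in \mathcal{B}(H_2)$ satisfy $V_1^* A = 0$, $A^*A + B^*B = \bigoplus_{j=1}^{m} \beta_j^2 I_{N(|T| - \beta_j I)}$ and $BB^* \leq \bigoplus_{j=1}^{m} \beta_j^2 I_{N(|T| - \beta_j I)}$, where $[m(T), \alpha) \cap \sigma(|T|) = \{\beta_j\}_{j=1}^{m}$ for some $m \in \mathbb{N} \cup \{\infty\}$; if $\alpha = m(T)$, then $H_2 = \{0\}$; and $T = \|T\| V_1$ if $\|T\| = \alpha = m(T)$.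
   Context: $H$ is an infinite-dimensional complex Hilbert space; $\mathcal{B}(H_1,H_2)$ denotes the bounded linear operators from $H_1$ to $H_2$, $\mathcal{B}(H) = \mathcal{B}(H,H)$. $N(\cdot)$ denotes the null space, $\sigma(\cdot)$ the spectrum, $|T| = (T^*T)^{1/2}$, $m(T) = \inf\{\|Tx\| : \|x\| = 1\}$, $I_E$ the identity on $E$. For self-adjoint $X, Y$, $X \le Y$ means $Y - X$ is positive. An operator $T$ is norm attaining if $\|Tx\| = \|T\|$ for some unit vector $x$; $\mathcal{AN}(H)$ is the set of $T \in \mathcal{B}(H)$ such that $T|_M : M \to H$ is norm attaining for every nonzero closed subspace $M$ of $H$; $\overline{\mathcal{AN}(H)}$ is its closure in the operator norm. $T$ is hyponormal if $T^*T - TT^* \geq 0$. $T$ is Fredholm if $R(T)$ is closed and $N(T)$, $N(T^* )$ are finite dimensional; $\sigma_{ess}(T) = \{\lambda \in \mathbb{C} : T - \lambda I \text{ is not Fredholm}\}$. Subspaces are closed and $\oplus$ is the orthogonal direct sum. The direct sum operators $\bigoplus_i \alpha_i U_i$ and $\bigoplus_j \beta_j^2 I_{N(|T|-\beta_j I)}$ act on $H_0 = \bigoplus_i N(|T|-\alpha_i I)$ and $H_2 = \bigoplus_j N(|T|-\beta_j I)$ respectively. The $\alpha_i$ are distinct and the $\beta_j$ are distinct; either family may be empty ($n=0$ or $m=0$), in which case the corresponding subspace is $\{0\}$ and the corresponding blocks are absent. *)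

theory Defs
  imports "HOL-Analysis.Analysis"
begin

section \<open>Complex Hilbert spaces\<close>

text \<open>The inner product is linear in its first argument. Both the metric structure and the
  real scalar multiplication are those of \<^class>\<open>real_normed_vector\<close>; the axioms tie the complex
  structure to them.\<close>

class complex_inner = real_normed_vector +
  fixes scaleC :: "complex \<Rightarrow> 'a \<Rightarrow> 'a" (infixr \<open>*\<^sub>C\<close> 75)
    and cinner :: "'a \<Rightarrow> 'a \<Rightarrow> complex"
  assumes scaleC_add_right: "c *\<^sub>C (x + y) = c *\<^sub>C x + c *\<^sub>C y"
    and scaleC_add_left: "(c + d) *\<^sub>C x = c *\<^sub>C x + d *\<^sub>C x"
    and scaleC_scaleC: "c *\<^sub>C d *\<^sub>C x = (c * d) *\<^sub>C x"
    and scaleC_of_real: "complex_of_real r *\<^sub>C x = r *\<^sub>R x"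
    and cinner_commute: "cinner x y = cnj (cinner y x)"
    and cinner_add_left: "cinner (x + y) z = cinner x z + cinner y z"
    and cinner_scaleC_left: "cinner (c *\<^sub>C x) y = c * cinner x y"
    and cinner_self: "cinner x x = complex_of_real ((norm x)\<^sup>2)"

class chilbert_space = complex_inner + complete_space

global_interpretation complex_vector:
  vector_space "scaleC :: complex \<Rightarrow> 'a \<Rightarrow> 'a::complex_inner"
proof
  fix x :: 'a
  show "1 *\<^sub>C x = x"
    using scaleC_of_real[of 1 x] by simp
qed (simp_all add: scaleC_add_right scaleC_add_left scaleC_scaleC)

definition closed_csubspace :: "'a::complex_inner set \<Rightarrow> bool" where
  "closed_csubspace M \<longleftrightarrow> complex_vector.subspace M \<and> closed M"

definition finite_cdim :: "'a::complex_inner set \<Rightarrow> bool" where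
  "finite_cdim M \<longleftrightarrow> (\<exists>S. finite S \<and> complex_vector.span S = M)"

definition orthogonal_sets :: "'a::complex_inner set \<Rightarrow> 'a set \<Rightarrow> bool" where
  "orthogonal_sets M N \<longleftrightarrow> (\<forall>x\<in>M. \<forall>y\<in>N. cinner x y = 0)"


section \<open>Bounded operators between closed subspaces\<close>

text \<open>An operator from \<open>M\<close> to \<open>N\<close> is a function on the ambient space of which only the values on
  \<open>M\<close> matter; equations between such operators are therefore stated pointwise on \<open>M\<close>. Operators on
  the whole space are the case \<open>M = N = UNIV\<close>, and their norm is \<^const>\<open>onorm\<close>.\<close>

definition bounded_ops :: "'a::complex_inner set \<Rightarrow> 'a set \<Rightarrow> ('a \<Rightarrow> 'a) set" where
  "bounded_ops M N = {A.
     (\<forall>x\<in>M. A x \<in> N) \<and>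
     (\<forall>x\<in>M. \<forall>y\<in>M. A (x + y) = A x + A y) \<and>
     (\<forall>c. \<forall>x\<in>M. A (c *\<^sub>C x) = c *\<^sub>C A x) \<and>
     (\<exists>K. \<forall>x\<in>M. norm (A x) \<le> K * norm x)}"

text \<open>The restriction to \<open>M\<close> of the library's \<^const>\<open>onorm\<close>: \<open>onorm_on UNIV = onorm\<close>.\<close>

definition onorm_on :: "'a::complex_inner set \<Rightarrow> ('a \<Rightarrow> 'a) \<Rightarrow> real" where
  "onorm_on M A = (SUP x\<in>M. norm (A x) / norm x)"

text \<open>The adjoint of \<open>A : M \<rightarrow> N\<close>, meaningful at arguments in \<open>N\<close>. The value lies in \<open>M\<close> and, for a
  closed subspace \<open>M\<close> of a Hilbert space, exists uniquely by Riesz representation.\<close>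

definition adj_on :: "'a::complex_inner set \<Rightarrow> ('a \<Rightarrow> 'a) \<Rightarrow> 'a \<Rightarrow> 'a" where
  "adj_on M A y = (THE x. x \<in> M \<and> (\<forall>u\<in>M. cinner (A u) y = cinner u x))"

abbreviation adj :: "('a::complex_inner \<Rightarrow> 'a) \<Rightarrow> 'a \<Rightarrow> 'a" where
  "adj \<equiv> adj_on UNIV"

definition positive_on :: "'a::complex_inner set \<Rightarrow> ('a \<Rightarrow> 'a) \<Rightarrow> bool" where
  "positive_on M X \<longleftrightarrow> (\<forall>x\<in>M. cinner (X x) x \<in> \<real>\<^sub>\<ge>\<^sub>0)"

definition op_le_on :: "'a::complex_inner set \<Rightarrow> ('a \<Rightarrow> 'a) \<Rightarrow> ('a \<Rightarrow> 'a) \<Rightarrow> bool" where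
  "op_le_on M X Y \<longleftrightarrow> positive_on M (\<lambda>x. Y x - X x)"

definition isometry_on :: "'a::complex_inner set \<Rightarrow> ('a \<Rightarrow> 'a) \<Rightarrow> bool" where
  "isometry_on M V \<longleftrightarrow> V \<in> bounded_ops M M \<and> (\<forall>x\<in>M. norm (V x) = norm x)"

definition unitary_on :: "'a::complex_inner set \<Rightarrow> ('a \<Rightarrow> 'a) \<Rightarrow> bool" where
  "unitary_on M U \<longleftrightarrow> U \<in> bounded_ops M M \<and>
     (\<forall>x\<in>M. adj_on M U (U x) = x \<and> U (adj_on M U x) = x)"


section \<open>Operators on the whole space\<close>

abbreviation bounded_op :: "('a::complex_inner \<Rightarrow> 'a) \<Rightarrow> bool" where
  "bounded_op T \<equiv> T \<in> bounded_ops UNIV UNIV"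

definition null_space :: "('a::complex_inner \<Rightarrow> 'a) \<Rightarrow> 'a set" where
  "null_space T = {x. T x = 0}"

definition shift_op :: "('a::complex_inner \<Rightarrow> 'a) \<Rightarrow> complex \<Rightarrow> 'a \<Rightarrow> 'a" where
  "shift_op T c = (\<lambda>x. T x - c *\<^sub>C x)"

definition spectrum :: "('a::complex_inner \<Rightarrow> 'a) \<Rightarrow> complex set" where
  "spectrum T = {c. \<not> (\<exists>S. bounded_op S \<and> S \<circ> shift_op T c = id \<and> shift_op T c \<circ> S = id)}"

definition fredholm :: "('a::complex_inner \<Rightarrow> 'a) \<Rightarrow> bool" where
  "fredholm T \<longleftrightarrow>
     closed (range T) \<and> finite_cdim (null_space T) \<and> finite_cdim (null_space (adj T))"

definition ess_spectrum :: "('a::complex_inner \<Rightarrow> 'a) \<Rightarrow> complex set" where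
  "ess_spectrum T = {c. \<not> fredholm (shift_op T c)}"

text \<open>The square root of a positive operator, by its characterization as the unique positive
  bounded operator with the given square.\<close>

definition op_sqrt :: "('a::complex_inner \<Rightarrow> 'a) \<Rightarrow> 'a \<Rightarrow> 'a" where
  "op_sqrt P = (THE S. bounded_op S \<and> positive_on UNIV S \<and> S \<circ> S = P)"

definition abs_op :: "('a::complex_inner \<Rightarrow> 'a) \<Rightarrow> 'a \<Rightarrow> 'a" where
  "abs_op T = op_sqrt (adj T \<circ> T)"

definition min_modulus :: "('a::complex_inner \<Rightarrow> 'a) \<Rightarrow> real" where
  "min_modulus T = (INF x\<in>{x. norm x = 1}. norm (T x))"

definition hyponormal :: "('a::complex_inner \<Rightarrow> 'a) \<Rightarrow> bool" where
  "hyponormal T \<longleftrightarrow> positive_on UNIV (\<lambda>x. adj T (T x) - T (adj T x))"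

definition norm_attaining_on :: "'a::complex_inner set \<Rightarrow> ('a \<Rightarrow> 'a) \<Rightarrow> bool" where
  "norm_attaining_on M T \<longleftrightarrow> (\<exists>x\<in>M. norm x = 1 \<and> norm (T x) = onorm_on M T)"

definition AN :: "('a::complex_inner \<Rightarrow> 'a) set" where
  "AN = {T. bounded_op T \<and>
     (\<forall>M. closed_csubspace M \<and> M \<noteq> {0} \<longrightarrow> norm_attaining_on M T)}"

definition norm_closure :: "('a::complex_inner \<Rightarrow> 'a) set \<Rightarrow> ('a \<Rightarrow> 'a) set" where
  "norm_closure \<A> = {T. bounded_op T \<and> (\<forall>e>0. \<exists>S\<in>\<A>. onorm (\<lambda>x. T x - S x) < e)}"


section \<open>Orthogonal direct sums\<close>

text \<open>\<open>K\<close> is the Hilbert space direct sum of the pairwise orthogonal closed subspaces \<open>M i\<close>,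
  \<open>i \<in> I\<close>; for \<open>I = {}\<close> this means \<open>K = {0}\<close>.\<close>

definition orthogonal_dsum ::
    "'i set \<Rightarrow> ('i \<Rightarrow> 'a::complex_inner set) \<Rightarrow> 'a set \<Rightarrow> bool" where
  "orthogonal_dsum I M K \<longleftrightarrow>
     (\<forall>i\<in>I. closed_csubspace (M i)) \<and>
     (\<forall>i\<in>I. \<forall>j\<in>I. i \<noteq> j \<longrightarrow> orthogonal_sets (M i) (M j)) \<and>
     K = closure (complex_vector.span (\<Union>i\<in>I. M i))"

definition orthogonal_dsum3 ::
    "'a::complex_inner set \<Rightarrow> 'a set \<Rightarrow> 'a set \<Rightarrow> bool" where
  "orthogonal_dsum3 H0 H1 H2 \<longleftrightarrow>
     closed_csubspace H0 \<and> closed_csubspace H1 \<and> closed_csubspace H2 \<and>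
     orthogonal_sets H0 H1 \<and> orthogonal_sets H0 H2 \<and> orthogonal_sets H1 H2 \<and>
     (\<forall>x. \<exists>x0\<in>H0. \<exists>x1\<in>H1. \<exists>x2\<in>H2. x = x0 + x1 + x2)"

text \<open>\<open>D\<close> is the direct sum of the operators \<open>X i\<close> on \<open>M i\<close>. By linearity and boundedness, \<open>D\<close> is
  determined on the direct sum \<open>K\<close> by its values on the summands.\<close>

definition is_dsum_op ::
    "'i set \<Rightarrow> ('i \<Rightarrow> 'a::complex_inner set) \<Rightarrow> 'a set \<Rightarrow> ('i \<Rightarrow> 'a \<Rightarrow> 'a) \<Rightarrow> ('a \<Rightarrow> 'a) \<Rightarrow> bool" where
  "is_dsum_op I M K X D \<longleftrightarrow>
     orthogonal_dsum I M K \<and> D \<in> bounded_ops K K \<and> (\<forall>i\<in>I. \<forall>x\<in>M i. D x = X i x)"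

end

theory Submission
  imports Defs
begin

text \<open>If \<open>T\<close> is a norm limit of absolutely norm attaining operators, then the essential upper and
  lower moduli of \<open>T\<close>, taken over complements of finite sets, coincide: otherwise every
  operator \<open>S\<close> near \<open>T\<close> has an orthonormal sequence \<open>g\<^sub>n\<close> with \<open>S g\<^sub>n\<close> orthogonal and of strictly
  increasing norm, and does not attain its norm on the closed span. With \<open>\<alpha>\<close> the common value,
  \<open>|T| - \<alpha>\<close> is compact, so away from \<open>\<alpha>\<close> the spectrum of \<open>|T|\<close> consists of eigenvalues of finite multiplicity
  accumulating only at \<open>\<alpha>\<close>. Take for \<open>H\<^sub>0\<close>, \<open>H\<^sub>1\<close>, \<open>H\<^sub>2\<close> the spectral subspaces of \<open>|T|\<close> for
  values above, equal to and below \<open>\<alpha>\<close>. Descending through the eigenvalues \<open>a > \<alpha>\<close>, the estimate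
  \<open>\<parallel>T T x\<parallel> \<ge> \<parallel>T\<^sup>* T x\<parallel> = a \<parallel>T x\<parallel>\<close> shows that \<open>T\<close> maps the eigenspace of \<open>a\<close> to itself, and by
  finite dimension the eigenspace reduces \<open>T\<close>; for \<open>a = \<alpha>\<close> the same estimate gives only
  invariance, hence an isometry.\<close>

text \<open>The descent stops at \<open>\<alpha>\<close> for a structural reason, and this is why
  the block form is triangular from there on. Passing from one eigenvalue to the next requires the
  larger eigenspaces to reduce \<open>T\<close>, so that their common complement is invariant under
  \<open>T\<close>. Above \<open>\<alpha>\<close> every eigenvalue has only finitely many larger
  ones and finite multiplicity, so there is an induction to run, and a scaled isometry of an
  eigenspace is onto. The eigenspace of \<open>\<alpha>\<close> may be infinite dimensional:
  \<open>T\<close> may act there as a multiple of a proper isometry, \<open>adj T\<close> may leave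
  it, and the argument breaks for smaller eigenvalues. On \<open>H2\<close> one is left with the
  compressions \<open>A\<close> and \<open>B\<close> of \<open>T\<close>. Their relations cost no
  further spectral work: \<open>T\<close> maps \<open>H1\<close> and \<open>H2\<close> to orthogonal
  sets because the square of |T| preserves both, and the bound on \<open>B\<close> times its adjoint
  is \<open>norm (adj T x) \<le> norm (T x)\<close> compressed to \<open>H2\<close>. That inequality
  is the only form in which hyponormality is used. Compactness is tested on complements of finite
  sets because the comparison of essential moduli yields estimates of exactly that shape.\<close>

abbreviation csubspace :: "'a::complex_inner set \<Rightarrow> bool" where
  "csubspace \<equiv> complex_vector.subspace"

abbreviation cspan :: "'a::complex_inner set \<Rightarrow> 'a set" where
  "cspan \<equiv> complex_vector.span"

section \<open>Inner products and symmetric operators\<close>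

lemma cinner_add_right: "cinner x (y + z) = cinner x y + cinner x z"
  by (metis cinner_commute cinner_add_left complex_cnj_add)

lemma cinner_scaleC_right: "cinner x (c *\<^sub>C y) = cnj c * cinner x y"
  by (metis cinner_commute cinner_scaleC_left complex_cnj_mult)

lemma cinner_scaleR_left: "cinner (r *\<^sub>R x) y = complex_of_real r * cinner x y"
  by (metis cinner_scaleC_left scaleC_of_real)

lemma cinner_scaleR_right: "cinner x (r *\<^sub>R y) = complex_of_real r * cinner x y"
  by (metis cinner_scaleC_right scaleC_of_real complex_cnj_complex_of_real)

lemma cinner_zero_left [simp]: "cinner 0 y = 0"
  using cinner_add_left[of 0 0 y] by simp

lemma cinner_zero_right [simp]: "cinner x 0 = 0"
  using cinner_add_right[of x 0 0] by simp

lemma cinner_minus_left: "cinner (- x) y = - cinner x y"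
  using cinner_add_left[of x "- x" y] by (simp add: eq_neg_iff_add_eq_0 add.commute)

lemma cinner_minus_right: "cinner x (- y) = - cinner x y"
  using cinner_add_right[of x y "- y"] by (simp add: eq_neg_iff_add_eq_0 add.commute)

lemma cinner_diff_left: "cinner (x - y) z = cinner x z - cinner y z"
  using cinner_add_left[of x "- y" z] by (simp add: cinner_minus_left)

lemma cinner_diff_right: "cinner x (y - z) = cinner x y - cinner x z"
  using cinner_add_right[of x y "- z"] by (simp add: cinner_minus_right)

lemma cinner_sum_right: "cinner y (sum f A) = (\<Sum>i\<in>A. cinner y (f i))"
  by (induction A rule: infinite_finite_induct) (auto simp: cinner_add_right)

lemmas cinner_simps = cinner_add_left cinner_add_right cinner_diff_left cinner_diff_right
  cinner_scaleC_left cinner_scaleC_right cinner_scaleR_left cinner_scaleR_right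
  cinner_minus_left cinner_minus_right

lemma Re_cinner_commute: "Re (cinner x y) = Re (cinner y x)"
  by (metis cinner_commute complex_cnj(1) complex.sel(1) complex_surj)

lemma norm_cinner_commute: "cmod (cinner x y) = cmod (cinner y x)"
  by (metis cinner_commute complex_mod_cnj)

lemma cinner_eq_0_commute: "cinner x y = 0 \<longleftrightarrow> cinner y x = 0"
  by (metis norm_cinner_commute norm_eq_zero)

lemma norm_scaleC: "norm (c *\<^sub>C x) = cmod c * norm x"
proof -
  have "complex_of_real ((norm (c *\<^sub>C x))\<^sup>2) = cinner (c *\<^sub>C x) (c *\<^sub>C x)"
    by (simp only: cinner_self)
  also have "\<dots> = c * cnj c * cinner x x" by (simp add: cinner_simps)
  also have "\<dots> = complex_of_real ((cmod c)\<^sup>2 * (norm x)\<^sup>2)"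
    by (simp add: cinner_self complex_mult_cnj cmod_def)
  finally have "(norm (c *\<^sub>C x))\<^sup>2 = (cmod c * norm x)\<^sup>2"
    by (simp only: of_real_eq_iff power_mult_distrib)
  then show ?thesis by simp
qed

lemma Re_cinner_self: "Re (cinner x x) = (norm x)\<^sup>2"
  by (simp add: cinner_self)

lemma norm_add_sq: "(norm (x + y))\<^sup>2 = (norm x)\<^sup>2 + 2 * Re (cinner x y) + (norm (y::'a::complex_inner))\<^sup>2"
  using Re_cinner_commute[of x y] by (simp flip: Re_cinner_self add: cinner_simps)

lemma norm_diff_sq: "(norm (x - y))\<^sup>2 = (norm x)\<^sup>2 - 2 * Re (cinner x y) + (norm (y::'a::complex_inner))\<^sup>2"
  using Re_cinner_commute[of x y] by (simp flip: Re_cinner_self add: cinner_simps)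

lemma parallelogram: "(norm (x + y))\<^sup>2 + (norm (x - y))\<^sup>2 = 2 * (norm x)\<^sup>2 + 2 * (norm (y::'a::complex_inner))\<^sup>2"
  by (simp add: norm_add_sq norm_diff_sq)

lemma norm_add_sq_orth: "cinner x y = 0 \<Longrightarrow> (norm (x + y))\<^sup>2 = (norm x)\<^sup>2 + (norm y)\<^sup>2"
  by (simp add: norm_add_sq)

lemma csubspace_scaleR: "csubspace M \<Longrightarrow> x \<in> M \<Longrightarrow> r *\<^sub>R x \<in> M"
  by (metis complex_vector.subspace_scale scaleC_of_real)

lemma csubspace_imp_subspace: "csubspace M \<Longrightarrow> subspace M"
  by (simp add: complex_vector.subspace_def csubspace_scaleR subspace_def)

text \<open>The identity alone forces complex linearity, since inner products separate points; so
  this one condition carries both linearity and self-adjointness.\<close>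

definition symmetric_op :: "('a::complex_inner \<Rightarrow> 'a) \<Rightarrow> bool" where
  "symmetric_op Q \<longleftrightarrow> (\<forall>x y. cinner (Q x) y = cinner x (Q y))"

lemma symmetric_opD: "symmetric_op Q \<Longrightarrow> cinner (Q x) y = cinner x (Q y)"
  by (simp add: symmetric_op_def)

lemma cinner_eqI: "(\<And>u. cinner u x = cinner u y) \<Longrightarrow> x = y"
proof -
  assume "\<And>u. cinner u x = cinner u y"
  then have "cinner (x - y) (x - y) = 0" by (simp add: cinner_diff_right)
  then show "x = y" by (simp add: cinner_self)
qed

lemma symmetric_op_add: "symmetric_op Q \<Longrightarrow> Q (x + y) = Q x + Q y"
  by (rule cinner_eqI) (simp add: cinner_add_right cinner_add_left flip: symmetric_opD)

lemma symmetric_op_scaleC: "symmetric_op Q \<Longrightarrow> Q (c *\<^sub>C x) = c *\<^sub>C Q x"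
  by (rule cinner_eqI) (simp add: cinner_simps flip: symmetric_opD)

lemma symmetric_op_scaleR: "symmetric_op Q \<Longrightarrow> Q (r *\<^sub>R x) = r *\<^sub>R Q x"
  by (metis scaleC_of_real symmetric_op_scaleC)

lemma symmetric_op_diff: "symmetric_op Q \<Longrightarrow> Q (x - y) = Q x - Q y"
  using symmetric_op_add[of Q x "- y"] symmetric_op_scaleR[of Q "-1" y] by simp

lemma symmetric_op_Im: "symmetric_op Q \<Longrightarrow> cinner (Q x) x = complex_of_real (Re (cinner (Q x) x))"
  by (metis Reals_cnj_iff cinner_commute of_real_Re symmetric_opD)

text \<open>Minimising \<open>t \<mapsto> \<langle>Q (x + t c y), x + t c y\<rangle>\<close> with \<open>c = \<langle>Q x, y\<rangle>\<close>.\<close>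

lemma semidefinite_Cauchy_Schwarz:
  assumes Q: "symmetric_op Q" and M: "csubspace M"
    and pos: "\<And>x. x \<in> M \<Longrightarrow> 0 \<le> Re (cinner (Q x) x)"
    and x: "x \<in> M" and y: "y \<in> M"
  shows "(cmod (cinner (Q x) y))\<^sup>2 \<le> Re (cinner (Q x) x) * Re (cinner (Q y) y)"
proof -
  define c where "c = cinner (Q x) y"
  define p q where "p = Re (cinner (Q x) x)" and "q = Re (cinner (Q y) y)"
  define k where "k = (cmod c)\<^sup>2"
  have ineq: "0 \<le> p + 2 * t * k + t\<^sup>2 * k * q" for t :: real
  proof -
    define d where "d = complex_of_real t * c"
    have "x + d *\<^sub>C y \<in> M"
      using M x y by (simp add: complex_vector.subspace_add complex_vector.subspace_scale)
    from pos[OF this] have "0 \<le> Re (cinner (Q (x + d *\<^sub>C y)) (x + d *\<^sub>C y))" .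
    also have "cinner (Q (x + d *\<^sub>C y)) (x + d *\<^sub>C y)
       = cinner (Q x) x + cnj d * c + d * cinner (Q y) x + d * cnj d * cinner (Q y) y"
      using Q by (simp add: symmetric_op_add symmetric_op_scaleC cinner_simps c_def algebra_simps)
    also have "cinner (Q y) x = cnj c"
      using Q by (metis c_def cinner_commute symmetric_opD)
    also have "cinner (Q x) x + cnj d * c + d * cnj c + d * cnj d * cinner (Q y) y
        = complex_of_real (p + 2 * t * k + t\<^sup>2 * k * q)"
      using symmetric_op_Im[OF Q, of x] symmetric_op_Im[OF Q, of y] complex_norm_square[of c]
      by (simp add: d_def p_def q_def k_def power2_eq_square algebra_simps)
    finally show ?thesis by simp
  qed
  have "k \<le> p * q"
  proof (cases "k = 0")
    case True
    then show ?thesis using pos[OF x] pos[OF y] by (simp add: p_def q_def)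
  next
    case False
    then have k: "k > 0" by (simp add: k_def)
    have q0: "q \<ge> 0" using pos[OF y] by (simp add: q_def)
    show ?thesis
    proof (cases "q = 0")
      case True
      \<comment> \<open>With \<open>q = 0\<close> the quadratic is affine in \<open>t\<close> with
        slope \<open>2 * k > 0\<close>; this \<open>t\<close> gives it the value
        \<open>- 1\<close>.\<close>
      have "0 \<le> p + 2 * (- (p + 1) / (2 * k)) * k" using ineq[of "- (p + 1) / (2 * k)"] True by simp
      also have "\<dots> = - 1" using k by (simp add: field_simps)
      finally show ?thesis by simp
    next
      case False
      then have q: "q > 0" using q0 by simp
      \<comment> \<open>For \<open>q > 0\<close> the quadratic has its minimum at
        \<open>t = - 1 / q\<close>.\<close>
      have "0 \<le> p + 2 * (- 1 / q) * k + (- 1 / q)\<^sup>2 * k * q" by (rule ineq)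
      also have "\<dots> = p - k / q" using q by (simp add: power2_eq_square field_simps)
      finally show ?thesis using q by (simp add: field_simps)
    qed
  qed
  then show ?thesis by (simp add: k_def p_def q_def c_def)
qed

lemma Cauchy_Schwarz: "cmod (cinner x y) \<le> norm x * norm (y::'a::complex_inner)"
proof -
  have "(cmod (cinner x y))\<^sup>2 \<le> (norm x * norm y)\<^sup>2"
    using semidefinite_Cauchy_Schwarz[of "\<lambda>x. x" UNIV x y]
    by (simp add: symmetric_op_def Re_cinner_self power_mult_distrib)
  then show ?thesis by (simp add: power2_le_iff_abs_le)
qed

lemma Re_Cauchy_Schwarz: "\<bar>Re (cinner x y)\<bar> \<le> norm x * norm (y::'a::complex_inner)"
  using Cauchy_Schwarz[of x y] abs_Re_le_cmod order_trans by blast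

lemma bounded_linear_cinner_left: "bounded_linear (\<lambda>x. cinner x y)"
  by (rule bounded_linear_intro[of _ "norm y"])
    (auto simp: cinner_simps scaleR_conv_of_real Cauchy_Schwarz)

text \<open>Polarize at \<open>x\<close> and at \<open>Q x\<close> rescaled to the length of
  \<open>x\<close>; the parallelogram law then balances the two quadratic values. Invariance is
  asked only of the single vector, as \<open>Q x \<in> M\<close>, because \<open>M\<close> will also
  be the complement of a finite set, which \<open>Q\<close> need not preserve.\<close>

lemma symmetric_op_numerical_bound:
  assumes Q: "symmetric_op Q" and M: "csubspace M"
    and bd: "\<And>x. x \<in> M \<Longrightarrow> \<bar>Re (cinner (Q x) x)\<bar> \<le> e * (norm x)\<^sup>2"
    and x: "x \<in> M" and Qx: "Q x \<in> M"
  shows "norm (Q x) \<le> e * norm x"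
proof (cases "Q x = 0 \<or> x = 0")
  case True
  have "0 \<le> e * (norm x)\<^sup>2" using bd[OF x] by linarith
  then show ?thesis using True by (cases "x = 0") (auto simp: zero_le_mult_iff symmetric_op_scaleR[OF Q, of 0 0, simplified])
next
  case False
  define y where "y = (norm x / norm (Q x)) *\<^sub>R Q x"
  have y: "y \<in> M" unfolding y_def using M Qx by (rule csubspace_scaleR)
  have ny: "norm y = norm x" using False by (simp add: y_def)
  have "4 * Re (cinner (Q x) y) = Re (cinner (Q (x + y)) (x + y)) - Re (cinner (Q (x - y)) (x - y))"
    using Re_cinner_commute[of "Q y" x] symmetric_opD[OF Q, of x y]
    by (simp add: symmetric_op_add[OF Q] symmetric_op_diff[OF Q] cinner_simps)
  also have "\<dots> \<le> e * (norm (x + y))\<^sup>2 + e * (norm (x - y))\<^sup>2"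
    using bd[of "x + y"] bd[of "x - y"] M x y
    by (simp add: complex_vector.subspace_add complex_vector.subspace_diff abs_le_iff)
  also have "\<dots> = 4 * (e * (norm x)\<^sup>2)"
    using parallelogram[of x y] by (simp add: ny flip: distrib_left)
  finally have "Re (cinner (Q x) y) \<le> e * (norm x)\<^sup>2" by simp
  moreover have "Re (cinner (Q x) y) = norm x * norm (Q x)"
    using False by (simp add: y_def cinner_simps cinner_self power2_eq_square)
  ultimately have "norm x * norm (Q x) \<le> norm x * (e * norm x)"
    by (simp add: power2_eq_square algebra_simps)
  then show ?thesis using False by simp
qed

section \<open>Orthogonal projections and adjoints\<close>

text \<open>Defined for arbitrary sets, so that \<open>orth F\<close> with \<open>F\<close> finite
  serves as the general closed subspace of finite codimension.\<close>

definition orth :: "'a::complex_inner set \<Rightarrow> 'a set" where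
  "orth S = {x. \<forall>y\<in>S. cinner x y = 0}"

lemma orthI: "(\<And>y. y \<in> S \<Longrightarrow> cinner x y = 0) \<Longrightarrow> x \<in> orth S"
  by (simp add: orth_def)

lemma orthD: "x \<in> orth S \<Longrightarrow> y \<in> S \<Longrightarrow> cinner x y = 0"
  by (simp add: orth_def)

lemma orthD2: "x \<in> orth S \<Longrightarrow> y \<in> S \<Longrightarrow> cinner y x = 0"
  by (simp add: orth_def cinner_eq_0_commute[of y])

lemma orth_Un: "orth (S \<union> S') = orth S \<inter> orth S'"
  by (auto simp: orth_def)

lemma orth_anti: "S \<subseteq> S' \<Longrightarrow> orth S' \<subseteq> orth S"
  by (auto simp: orth_def)

lemma closed_csubspace_orth: "closed_csubspace (orth S)"
  unfolding closed_csubspace_def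
proof
  show "csubspace (orth S)"
    by (rule complex_vector.subspaceI) (auto simp: orth_def cinner_simps)
  have "orth S = (\<Inter>y\<in>S. (\<lambda>x. cinner x y) -` {0})"
    by (auto simp: orth_def)
  moreover have "closed ((\<lambda>x. cinner x y) -` {0})" for y :: 'a
    by (rule continuous_closed_vimage)
      (simp_all add: linear_continuous_at bounded_linear_cinner_left)
  ultimately show "closed (orth S)" by auto
qed

lemma csubspace_orth: "csubspace (orth S)"
  using closed_csubspace_orth closed_csubspace_def by blast

lemma orth_cspan: "orth (cspan S) = orth S"
proof
  show "orth (cspan S) \<subseteq> orth S" by (simp add: complex_vector.span_superset orth_anti)
  show "orth S \<subseteq> orth (cspan S)"
  proof
    fix x assume x: "x \<in> orth S"
    have "csubspace {y. cinner x y = 0}"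
      by (rule complex_vector.subspaceI) (auto simp: cinner_simps)
    moreover have "S \<subseteq> {y. cinner x y = 0}" using x by (auto simp: orth_def)
    ultimately have "cspan S \<subseteq> {y. cinner x y = 0}" by (rule complex_vector.span_minimal[rotated])
    then show "x \<in> orth (cspan S)" by (auto simp: orth_def)
  qed
qed

lemma orth_closure: "orth (closure S) = orth S"
proof
  show "orth (closure S) \<subseteq> orth S" by (simp add: closure_subset orth_anti)
  show "orth S \<subseteq> orth (closure S)"
  proof
    fix x assume x: "x \<in> orth S"
    have "S \<subseteq> orth {x}" using x by (auto simp: orth_def cinner_eq_0_commute[of x])
    then have "closure S \<subseteq> orth {x}"
      using closed_csubspace_orth closed_csubspace_def closure_minimal by blast
    then show "x \<in> orth (closure S)" by (auto simp: orth_def cinner_eq_0_commute[of x])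
  qed
qed

lemma csubspace_closure: 
  assumes "csubspace (M::'a::complex_inner set)" 
  shows "csubspace (closure M)"
proof (rule complex_vector.subspaceI)
  show "0 \<in> closure M" using assms closure_subset complex_vector.subspace_0 by blast
  show "x + y \<in> closure M" if x: "x \<in> closure M" and y: "y \<in> closure M" for x y
  proof -
    obtain f g where "\<And>n. f n \<in> M" "f \<longlonglongrightarrow> x" "\<And>n. g n \<in> M" "g \<longlonglongrightarrow> y"
      using x y unfolding closure_sequential by blast
    then have "\<And>n. f n + g n \<in> M" "(\<lambda>n. f n + g n) \<longlonglongrightarrow> x + y"
      using assms by (auto intro: complex_vector.subspace_add tendsto_add)
    then show ?thesis unfolding closure_sequential by fast
  qed
  fix c and x :: 'a assume "x \<in> closure M"
  have bl: "bounded_linear (\<lambda>x::'a. c *\<^sub>C x)"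
  proof (rule bounded_linear_intro[of _ "cmod c"])
    show "c *\<^sub>C r *\<^sub>R x = r *\<^sub>R c *\<^sub>C x" for r and x :: 'a
      by (simp add: scaleC_scaleC mult.commute flip: scaleC_of_real)
  qed (auto simp: scaleC_add_right norm_scaleC)
  have "(\<lambda>x. c *\<^sub>C x) ` closure M \<subseteq> closure ((\<lambda>x. c *\<^sub>C x) ` M)"
    by (rule closure_bounded_linear_image_subset[OF bl])
  also have "\<dots> \<subseteq> closure M"
    using assms by (intro closure_mono) (auto intro: complex_vector.subspace_scale)
  finally show "c *\<^sub>C x \<in> closure M" using \<open>x \<in> closure M\<close> by blast
qed

lemma closed_csubspace_closure_span: "closed_csubspace (closure (cspan S))"
  by (simp add: closed_csubspace_def csubspace_closure)

lemma orth_closure_span: "orth (closure (cspan S)) = orth S"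
  by (simp add: orth_closure orth_cspan)

lemma closed_csubspaceD: "closed_csubspace M \<Longrightarrow> csubspace M" "closed_csubspace M \<Longrightarrow> closed M"
  by (auto simp: closed_csubspace_def)

text \<open>A minimizing sequence is Cauchy by the parallelogram law, because midpoints stay in
  \<open>M\<close>. If the residual at its limit had a component along some \<open>w\<close> in
  \<open>M\<close>, removing that component would beat the minimum.\<close>

lemma projection_exists:
  fixes M :: "'a::chilbert_space set"
  assumes M: "closed_csubspace M"
  shows "\<exists>y\<in>M. x - y \<in> orth M"
proof -
  have sub: "csubspace M" and cl: "closed M" using M by (auto simp: closed_csubspace_def)
  have ne: "M \<noteq> {}" using complex_vector.subspace_0[OF sub] by auto
  define d where "d = (INF y\<in>M. (norm (x - y))\<^sup>2)"
  have bdd: "bdd_below ((\<lambda>y. (norm (x - y))\<^sup>2) ` M)" by (rule bdd_belowI[of _ 0]) auto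
  have d_le: "d \<le> (norm (x - y))\<^sup>2" if "y \<in> M" for y
    unfolding d_def by (rule cINF_lower[OF bdd that])
  have "\<exists>y\<in>M. (norm (x - y))\<^sup>2 < d + 1 / real (Suc n)" for n
    using cINF_less_iff[OF ne bdd, of "d + 1 / real (Suc n)"] by (simp add: d_def)
  then obtain y where yM: "\<And>n. y n \<in> M" and y: "\<And>n. (norm (x - y n))\<^sup>2 < d + 1 / real (Suc n)"
    by metis
  have close: "(norm (y m - y n))\<^sup>2 \<le> 2 / real (Suc m) + 2 / real (Suc n)" for m n
  proof -
    have "(1/2) *\<^sub>R (y m + y n) \<in> M"
      using sub yM by (simp add: csubspace_scaleR complex_vector.subspace_add)
    from d_le[OF this] have "4 * d \<le> (2 * norm (x - (1/2) *\<^sub>R (y m + y n)))\<^sup>2" by (simp add: power_mult_distrib)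
    also have "2 * norm (x - (1/2) *\<^sub>R (y m + y n)) = norm (2 *\<^sub>R (x - (1/2) *\<^sub>R (y m + y n)))" by simp
    also have "2 *\<^sub>R (x - (1/2) *\<^sub>R (y m + y n)) = (x - y m) + (x - y n)"
      by (simp add: scaleR_diff_right scaleR_2 algebra_simps)
    finally have "4 * d \<le> (norm ((x - y m) + (x - y n)))\<^sup>2" .
    with parallelogram[of "x - y m" "x - y n"] y[of m] y[of n]
    have "(norm ((x - y m) - (x - y n)))\<^sup>2 \<le> 2 / real (Suc m) + 2 / real (Suc n)" by simp
    then show ?thesis by (simp add: norm_minus_commute)
  qed
  have "Cauchy y"
  proof (rule metric_CauchyI)
    fix e :: real assume e: "0 < e"
    obtain N where N: "4 / real (Suc N) < e\<^sup>2"
    proof -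
      obtain N where "inverse (real (Suc N)) < e\<^sup>2 / 4" using reals_Archimedean[of "e\<^sup>2/4"] e by auto
      then show ?thesis using that[of N] by (simp add: field_simps)
    qed
    show "\<exists>M. \<forall>m\<ge>M. \<forall>n\<ge>M. dist (y m) (y n) < e"
    proof (intro exI allI impI)
      fix m n assume "N \<le> m" "N \<le> n"
      then have "2 / real (Suc m) \<le> 2 / real (Suc N)" "2 / real (Suc n) \<le> 2 / real (Suc N)"
        by (auto intro!: divide_left_mono)
      then have "(norm (y m - y n))\<^sup>2 < e\<^sup>2" using close[of m n] N by linarith
      then show "dist (y m) (y n) < e" using e by (simp add: dist_norm power_less_imp_less_base)
    qed
  qed
  then obtain z where z: "y \<longlonglongrightarrow> z" using Cauchy_convergent convergent_def by blast
  have zM: "z \<in> M" using closed_sequentially[OF cl _ z] yM by blast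
  have "(\<lambda>n. (norm (x - y n))\<^sup>2) \<longlonglongrightarrow> (norm (x - z))\<^sup>2" by (intro tendsto_intros z)
  moreover have "(\<lambda>n. d + 1 / real (Suc n)) \<longlonglongrightarrow> d + 0"
    by (intro tendsto_intros LIMSEQ_Suc lim_1_over_n)
  ultimately have "(norm (x - z))\<^sup>2 \<le> d + 0"
    by (rule LIMSEQ_le) (use y less_imp_le in blast)
  then have zd: "(norm (x - z))\<^sup>2 \<le> d" by simp
  have "cinner (x - z) w = 0" if w: "w \<in> M" for w
  proof (cases "w = 0")
    case False
    \<comment> \<open>\<open>c *\<^sub>C w\<close> is the component of the residual
      \<open>x - z\<close> along \<open>w\<close>; minimality of \<open>z\<close> forces it to
      vanish.\<close>
    define c where "c = cinner (x - z) w / complex_of_real ((norm w)\<^sup>2)"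
    have nz: "complex_of_real ((norm w)\<^sup>2) \<noteq> 0" using False by simp
    have "z + c *\<^sub>C w \<in> M"
      using sub zM w by (simp add: complex_vector.subspace_add complex_vector.subspace_scale)
    from order_trans[OF zd d_le[OF this]]
    have "(norm (x - z))\<^sup>2 \<le> (norm ((x - z) - c *\<^sub>C w))\<^sup>2" by (simp only: diff_diff_eq)
    moreover have "cinner ((x - z) - c *\<^sub>C w) (c *\<^sub>C w) = 0"
      using nz by (simp add: cinner_diff_left cinner_scaleC_left cinner_scaleC_right cinner_self c_def)
    then have "(norm (((x - z) - c *\<^sub>C w) + c *\<^sub>C w))\<^sup>2 = (norm ((x - z) - c *\<^sub>C w))\<^sup>2 + (norm (c *\<^sub>C w))\<^sup>2"
      by (rule norm_add_sq_orth)
    ultimately have "(norm (c *\<^sub>C w))\<^sup>2 \<le> 0" by (simp only: diff_add_cancel)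
    then have "c = 0" using False by (simp add: norm_scaleC)
    then show ?thesis using nz by (simp add: c_def False)
  qed simp
  then show ?thesis using zM by (auto simp: orth_def)
qed

definition proj :: "'a::complex_inner set \<Rightarrow> 'a \<Rightarrow> 'a" where
  "proj M x = (SOME y. y \<in> M \<and> x - y \<in> orth M)"

lemma proj:
  fixes M :: "'a::chilbert_space set"
  assumes "closed_csubspace M"
  shows proj_in: "proj M x \<in> M" and proj_orth: "x - proj M x \<in> orth M"
proof -
  have "\<exists>y. y \<in> M \<and> x - y \<in> orth M" using projection_exists[OF assms] by blast
  then have "proj M x \<in> M \<and> x - proj M x \<in> orth M" unfolding proj_def by (rule someI_ex)
  then show "proj M x \<in> M" "x - proj M x \<in> orth M" by auto
qed

lemma in_orth_self: "x \<in> M \<Longrightarrow> x \<in> orth M \<Longrightarrow> x = 0"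
  using orthD[of x M x] by (simp add: cinner_self)

lemma proj_eqI:
  fixes M :: "'a::chilbert_space set"
  assumes M: "closed_csubspace M" and "y \<in> M" "x - y \<in> orth M"
  shows "proj M x = y"
proof -
  have "(x - y) - (x - proj M x) \<in> orth M"
    by (rule complex_vector.subspace_diff[OF csubspace_orth assms(3) proj_orth[OF M]])
  moreover have "proj M x - y \<in> M"
    using assms proj_in[OF M] by (intro complex_vector.subspace_diff closed_csubspaceD)
  ultimately have "proj M x - y = 0" by (intro in_orth_self) auto
  then show ?thesis by simp
qed

lemma proj_id: "closed_csubspace M \<Longrightarrow> x \<in> M \<Longrightarrow> proj M x = (x::'a::chilbert_space)"
  by (rule proj_eqI) (auto simp: orth_def)

lemma proj_zero: "closed_csubspace M \<Longrightarrow> x \<in> orth M \<Longrightarrow> proj M x = (0::'a::chilbert_space)"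
  by (rule proj_eqI) (auto simp: complex_vector.subspace_0 closed_csubspaceD)

lemma symmetric_proj:
  fixes M :: "'a::chilbert_space set"
  assumes M: "closed_csubspace M"
  shows "symmetric_op (proj M)"
  unfolding symmetric_op_def
proof (intro allI)
  fix x y :: 'a
  have "cinner (proj M x) (y - proj M y) = 0" "cinner (x - proj M x) (proj M y) = 0"
    using proj[OF M] orthD orthD2 by blast+
  then show "cinner (proj M x) y = cinner x (proj M y)" by (simp add: cinner_simps)
qed

lemma proj_norm_sq:
  fixes M :: "'a::chilbert_space set"
  assumes M: "closed_csubspace M"
  shows "(norm x)\<^sup>2 = (norm (proj M x))\<^sup>2 + (norm (x - proj M x))\<^sup>2"
  using norm_add_sq_orth[of "proj M x" "x - proj M x"] orthD2[OF proj_orth[OF M] proj_in[OF M]] by simp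

lemma norm_proj_le:
  fixes M :: "'a::chilbert_space set"
  assumes M: "closed_csubspace M"
  shows "norm (proj M x) \<le> norm x"
  using proj_norm_sq[OF M, of x] by (metis le_add_same_cancel1 norm_ge_zero power2_le_imp_le zero_le_power2)

lemma orth_orth:
  fixes M :: "'a::chilbert_space set"
  assumes M: "closed_csubspace M"
  shows "orth (orth M) = M"
proof
  show "M \<subseteq> orth (orth M)" by (auto simp: orth_def cinner_eq_0_commute)
  show "orth (orth M) \<subseteq> M"
  proof
    fix x assume x: "x \<in> orth (orth M)"
    have "cinner x (x - proj M x) = 0" "cinner (proj M x) (x - proj M x) = 0"
      using orthD[OF x proj_orth[OF M]] orthD2[OF proj_orth[OF M] proj_in[OF M]] by auto
    then have "cinner (x - proj M x) (x - proj M x) = 0" by (simp add: cinner_diff_left)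
    then have "x = proj M x" by (simp add: cinner_self)
    then show "x \<in> M" using proj_in[OF M] by metis
  qed
qed

section \<open>Bounded operators, Riesz representation and adjoints\<close>

lemma bounded_opI: "bounded_linear T \<Longrightarrow> (\<And>c x. T (c *\<^sub>C x) = c *\<^sub>C T x) \<Longrightarrow> bounded_op T"
  unfolding bounded_ops_def
  using bounded_linear.bounded[of T] by (auto simp: linear_simps mult.commute)

lemma bounded_op_add: "bounded_op T \<Longrightarrow> T (x + y) = T x + T y"
  and bounded_op_scaleC: "bounded_op T \<Longrightarrow> T (c *\<^sub>C x) = c *\<^sub>C T x"
  by (auto simp: bounded_ops_def)

lemma bounded_op_scaleR: "bounded_op T \<Longrightarrow> T (r *\<^sub>R x) = r *\<^sub>R T x"
  by (metis bounded_op_scaleC scaleC_of_real)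

lemma bounded_op_bounded_linear:
  assumes "bounded_op T"
  shows "bounded_linear T"
proof -
  obtain K where "\<And>x. norm (T x) \<le> K * norm x" using assms by (auto simp: bounded_ops_def)
  then show ?thesis
    using assms by (intro bounded_linear_intro[of _ K])
      (auto simp: bounded_op_add bounded_op_scaleR mult.commute)
qed

lemma bounded_op_zero: "bounded_op T \<Longrightarrow> T 0 = 0"
  using bounded_op_scaleR[of T 0 0] by simp

lemma bounded_op_diff: "bounded_op T \<Longrightarrow> T (x - y) = T x - T y"
  by (simp add: bounded_op_bounded_linear linear_simps)

lemma bounded_op_le: "bounded_op T \<Longrightarrow> norm (T x) \<le> onorm T * norm x"
  by (simp add: bounded_op_bounded_linear onorm)

lemma symmetric_bounded_op:
  assumes "symmetric_op Q" "\<And>x. norm (Q x) \<le> K * norm x"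
  shows "bounded_op Q"
  using assms
  by (intro bounded_opI bounded_linear_intro[of _ K])
    (auto simp: symmetric_op_add symmetric_op_scaleC symmetric_op_scaleR mult.commute)

lemma bounded_op_proj: "closed_csubspace M \<Longrightarrow> bounded_op (proj (M::'a::chilbert_space set))"
  by (rule symmetric_bounded_op[of _ 1]) (auto simp: symmetric_proj norm_proj_le)

lemma bounded_op_comp:
  assumes "bounded_op S" "bounded_op T"
  shows "bounded_op (\<lambda>x. S (T x))"
  using bounded_linear_compose[OF assms[THEN bounded_op_bounded_linear]] assms
  by (intro bounded_opI) (auto simp: bounded_op_scaleC)

lemma bounded_op_minus_scaleC:
  assumes "bounded_op T"
  shows "bounded_op (\<lambda>x. T x - c *\<^sub>C x)"
proof (rule bounded_opI)
  have "norm (T x - c *\<^sub>C x) \<le> norm x * (onorm T + cmod c)" for x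
    using norm_triangle_ineq4[of "T x" "c *\<^sub>C x"] bounded_op_le[OF assms, of x]
    by (simp add: norm_scaleC algebra_simps)
  moreover have "T (r *\<^sub>R x) - c *\<^sub>C r *\<^sub>R x = r *\<^sub>R (T x - c *\<^sub>C x)" for r x
    by (simp add: bounded_op_scaleC[OF assms] complex_vector.scale_right_diff_distrib scaleC_scaleC
         mult.commute flip: scaleC_of_real)
  ultimately show "bounded_linear (\<lambda>x. T x - c *\<^sub>C x)"
    by (intro bounded_linear_intro[of _ "onorm T + cmod c"])
      (auto simp: bounded_op_add[OF assms] scaleC_add_right)
  show "T (d *\<^sub>C x) - c *\<^sub>C d *\<^sub>C x = d *\<^sub>C (T x - c *\<^sub>C x)" for d x
    by (simp add: bounded_op_scaleC[OF assms] complex_vector.scale_right_diff_distrib scaleC_scaleC mult.commute)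
qed

lemma null_closed_csubspace:
  assumes "bounded_op T"
  shows "closed_csubspace {x. T x = 0}"
  unfolding closed_csubspace_def
proof
  show "csubspace {x. T x = 0}"
    using assms by (intro complex_vector.subspaceI) (auto simp: bounded_op_add bounded_op_scaleC bounded_op_zero)
  have "closed (T -` {0})"
    by (rule continuous_closed_vimage)
      (simp_all add: linear_continuous_at bounded_op_bounded_linear[OF assms])
  then show "closed {x. T x = 0}" by (simp add: vimage_def)
qed

text \<open>Modulo the kernel \<open>N\<close> every vector is a multiple of one \<open>v\<close>
  orthogonal to \<open>N\<close>, so pairing with a multiple of \<open>v\<close> reproduces
  \<open>f\<close>. The scalar is conjugated since \<open>cinner\<close> is conjugate linear in its
  second argument.\<close>

lemma Riesz_representation:
  fixes f :: "'a::chilbert_space \<Rightarrow> complex"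
  assumes bl: "bounded_linear f" and sc: "\<And>c x. f (c *\<^sub>C x) = c * f x"
  shows "\<exists>p. \<forall>u. f u = cinner u p"
proof -
  define N where "N = {x. f x = 0}"
  have "closed (f -` {0})"
    by (rule continuous_closed_vimage) (simp_all add: linear_continuous_at bl)
  then have N: "closed_csubspace N"
    using bl unfolding closed_csubspace_def N_def vimage_def
    by (auto intro!: complex_vector.subspaceI simp: linear_simps sc)
  show ?thesis
  proof (cases "N = UNIV")
    case True
    then show ?thesis by (intro exI[of _ 0]) (auto simp: N_def)
  next
    case False
    then obtain x where x: "f x \<noteq> 0" by (auto simp: N_def)
    define v where "v = x - proj N x"
    have fv: "f v \<noteq> 0" using x proj_in[OF N, of x] bl by (simp add: v_def linear_simps N_def)
    have v: "v \<in> orth N" unfolding v_def by (rule proj_orth[OF N])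
    have nv: "complex_of_real ((norm v)\<^sup>2) \<noteq> 0" using fv bl by (auto simp: linear_simps)
    show ?thesis
    proof (intro exI allI)
      fix u
      have "u - (f u / f v) *\<^sub>C v \<in> N" using bl fv by (simp add: N_def linear_simps sc)
      then have "cinner (u - (f u / f v) *\<^sub>C v) v = 0" using orthD2[OF v] by blast
      then have "cinner u v = f u / f v * complex_of_real ((norm v)\<^sup>2)" by (simp add: cinner_simps cinner_self)
      then show "f u = cinner u (cnj (f v / complex_of_real ((norm v)\<^sup>2)) *\<^sub>C v)"
        using fv nv by (simp add: cinner_scaleC_right)
    qed
  qed
qed

lemma adj_on_eqI:
  assumes "csubspace M" "x \<in> M" "\<And>u. u \<in> M \<Longrightarrow> cinner (A u) y = cinner u x"
  shows "adj_on M A y = x"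
  unfolding adj_on_def
proof (rule the_equality)
  show "x \<in> M \<and> (\<forall>u\<in>M. cinner (A u) y = cinner u x)" using assms by blast
next
  fix z assume z: "z \<in> M \<and> (\<forall>u\<in>M. cinner (A u) y = cinner u z)"
  then have "z - x \<in> M" using assms complex_vector.subspace_diff by blast
  then have "cinner (z - x) (z - x) = 0" using z assms(3) by (simp add: cinner_diff_right)
  then show "z = x" by (simp add: cinner_self)
qed

lemma cinner_adj:
  fixes T :: "'a::chilbert_space \<Rightarrow> 'a"
  assumes T: "bounded_op T"
  shows "cinner (T u) y = cinner u (adj T y)"
proof -
  have "bounded_linear (\<lambda>u. cinner (T u) y)"
    by (rule bounded_linear_compose[OF bounded_linear_cinner_left bounded_op_bounded_linear[OF T]])
  then obtain p where p: "\<And>u. cinner (T u) y = cinner u p"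
    using Riesz_representation[of "\<lambda>u. cinner (T u) y"] T
    by (auto simp: bounded_op_scaleC cinner_scaleC_left)
  then have "adj T y = p" by (intro adj_on_eqI) auto
  then show ?thesis using p by simp
qed

lemma cinner_adj_left:
  fixes T :: "'a::chilbert_space \<Rightarrow> 'a"
  shows "bounded_op T \<Longrightarrow> cinner (adj T y) u = cinner y (T u)"
  by (metis cinner_adj cinner_commute)

lemma norm_adj_le:
  fixes T :: "'a::chilbert_space \<Rightarrow> 'a"
  assumes T: "bounded_op T"
  shows "norm (adj T y) \<le> onorm T * norm y"
proof (cases "adj T y = 0")
  case True
  then show ?thesis using onorm_pos_le[OF bounded_op_bounded_linear[OF T]] by simp
next
  case False
  have "(norm (adj T y))\<^sup>2 = Re (cinner (T (adj T y)) y)"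
    by (simp add: cinner_adj[OF T] cinner_self)
  also have "\<dots> \<le> norm (T (adj T y)) * norm y" using Re_Cauchy_Schwarz abs_le_D1 by blast
  also have "\<dots> \<le> onorm T * norm (adj T y) * norm y"
    by (intro mult_right_mono bounded_op_le T) auto
  finally show ?thesis using False by (simp add: power2_eq_square algebra_simps)
qed

lemma bounded_op_adj:
  fixes T :: "'a::chilbert_space \<Rightarrow> 'a"
  assumes T: "bounded_op T"
  shows "bounded_op (adj T)"
proof -
  have add: "adj T (x + y) = adj T x + adj T y" for x y
    by (rule cinner_eqI) (simp add: cinner_add_right flip: cinner_adj[OF T])
  have sc: "adj T (c *\<^sub>C x) = c *\<^sub>C adj T x" for c x
    by (rule cinner_eqI) (simp add: cinner_scaleC_right flip: cinner_adj[OF T])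
  have "bounded_linear (adj T)"
    by (rule bounded_linear_intro[of _ "onorm T"])
      (use add sc norm_adj_le[OF T] in \<open>auto simp: mult.commute simp flip: scaleC_of_real\<close>)
  then show ?thesis using sc by (rule bounded_opI)
qed

lemma symmetric_adj_comp:
  fixes T :: "'a::chilbert_space \<Rightarrow> 'a"
  assumes T: "bounded_op T"
  shows "symmetric_op (\<lambda>x. adj T (T x))"
  by (simp add: symmetric_op_def cinner_adj_left[OF T] cinner_adj[OF T, symmetric])

section \<open>Finite-dimensional perturbations of closed subspaces\<close>

text \<open>Replacing \<open>v\<close> by its component \<open>w\<close> orthogonal to
  \<open>L\<close> makes the coefficient of \<open>w\<close> a continuous function of the vector.
  Membership in the span then says that \<open>g\<close>, which strips off the \<open>w\<close>
  component, lands in the closed set \<open>L\<close>.\<close>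

lemma closed_csubspace_span_insert:
  fixes L :: "'a::chilbert_space set"
  assumes L: "closed_csubspace L"
  shows "closed_csubspace (cspan (insert v L))"
proof -
  have subL: "csubspace L" using L closed_csubspaceD by blast
  define w where "w = v - proj L v"
  have spanL: "cspan L = L" using subL complex_vector.span_eq_iff by blast
  have w: "w \<in> orth L" unfolding w_def by (rule proj_orth[OF L])
  show ?thesis
  proof (cases "w = 0")
    case True
    then have "v \<in> L" using proj_in[OF L, of v] by (simp add: w_def)
    then show ?thesis using L by (simp only: insert_absorb spanL)
  next
    case False
    then have nz: "complex_of_real ((norm w)\<^sup>2) \<noteq> 0" by simp
    define g where "g x = x - (cinner x w / complex_of_real ((norm w)\<^sup>2)) *\<^sub>C w" for x
    have eq: "cspan (insert v L) = g -` L"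
    proof (intro set_eqI iffI)
      fix x assume "x \<in> cspan (insert v L)"
      then obtain k where k: "x - k *\<^sub>C v \<in> L" by (auto simp: complex_vector.span_insert spanL)
      have "(x - k *\<^sub>C v) + k *\<^sub>C proj L v \<in> L"
        using k subL proj_in[OF L] complex_vector.subspace_add complex_vector.subspace_scale by blast
      then have l: "x - k *\<^sub>C w \<in> L"
        by (simp add: w_def complex_vector.scale_right_diff_distrib diff_diff_eq2 add_diff_eq add.commute)
      then have "cinner (x - k *\<^sub>C w) w = 0" using orthD2[OF w] by blast
      then have "cinner x w = k * complex_of_real ((norm w)\<^sup>2)" by (simp add: cinner_simps cinner_self)
      then have "g x = x - k *\<^sub>C w" using nz by (simp add: g_def)
      then show "x \<in> g -` L" using l by simp
    next
      fix x assume "x \<in> g -` L"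
      then have l: "g x \<in> L" by simp
      define k where "k = cinner x w / complex_of_real ((norm w)\<^sup>2)"
      have "g x - k *\<^sub>C proj L v \<in> L"
        using l subL proj_in[OF L] complex_vector.subspace_diff complex_vector.subspace_scale by blast
      moreover have "g x - k *\<^sub>C proj L v = x - k *\<^sub>C v"
        by (simp add: g_def k_def w_def complex_vector.scale_right_diff_distrib)
      ultimately show "x \<in> cspan (insert v L)" by (auto simp: complex_vector.span_insert spanL)
    qed
    have blc: "bounded_linear (\<lambda>c. c *\<^sub>C w)"
      by (rule bounded_linear_intro[of _ "norm w"])
        (auto simp: scaleC_add_left norm_scaleC scaleC_scaleC scaleR_conv_of_real simp flip: scaleC_of_real)
    have blq: "bounded_linear (\<lambda>x. cinner x w / complex_of_real ((norm w)\<^sup>2))"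
      by (rule bounded_linear_compose[OF bounded_linear_divide bounded_linear_cinner_left])
    have "bounded_linear g" unfolding g_def
      by (rule bounded_linear_sub[OF bounded_linear_ident bounded_linear_compose[OF blc blq]])
    then have "closed (g -` L)"
      using L by (intro continuous_closed_vimage) (auto simp: linear_continuous_at closed_csubspaceD)
    then show ?thesis using eq complex_vector.subspace_span by (metis closed_csubspace_def)
  qed
qed

lemma cspan_insert_span: "cspan (insert v (cspan S)) = cspan (insert v S)"
  unfolding complex_vector.span_insert by (simp only: complex_vector.span_span)

lemma closed_csubspace_span_Un:
  fixes L :: "'a::chilbert_space set"
  assumes L: "closed_csubspace L" and F: "finite F"
  shows "closed_csubspace (cspan (F \<union> L))"
  using F
proof (induction F rule: finite_induct)
  case empty
  have "cspan L = L" using L closed_csubspaceD complex_vector.span_eq_iff by blast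
  then show ?case using L by (simp only: Un_empty_left)
next
  case (insert v F)
  have "cspan (insert v F \<union> L) = cspan (insert v (cspan (F \<union> L)))"
    by (simp add: cspan_insert_span)
  then show ?case using closed_csubspace_span_insert[OF insert.IH] by simp
qed

lemma closed_csubspace_zero: "closed_csubspace {0}"
  by (simp add: closed_csubspace_def complex_vector.subspace_single_0)

lemma closed_csubspace_UNIV: "closed_csubspace UNIV"
  by (simp add: closed_csubspace_def complex_vector.subspace_UNIV)

lemma closed_csubspace_Int: "closed_csubspace L \<Longrightarrow> closed_csubspace M \<Longrightarrow> closed_csubspace (L \<inter> M)"
  by (auto simp: closed_csubspace_def complex_vector.subspace_inter)

lemma closed_csubspace_span_finite:
  "finite F \<Longrightarrow> closed_csubspace (cspan (F :: 'a::chilbert_space set))"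
proof -
  assume F: "finite F"
  have "cspan (F \<union> {0}) = cspan F" by (simp add: complex_vector.span_insert_0)
  then show ?thesis using closed_csubspace_span_Un[OF closed_csubspace_zero F] by simp
qed

lemma linear_image_csubspace:
  assumes "csubspace M" "bounded_op D"
  shows "csubspace (D ` M)"
proof (rule complex_vector.subspaceI)
  show "0 \<in> D ` M" using assms complex_vector.subspace_0 bounded_op_zero by (metis image_eqI)
  show "x + y \<in> D ` M" if "x \<in> D ` M" "y \<in> D ` M" for x y
    using that complex_vector.subspace_add[OF assms(1)] bounded_op_add[OF assms(2), symmetric] by auto
  show "c *\<^sub>C x \<in> D ` M" if "x \<in> D ` M" for c x
    using that complex_vector.subspace_scale[OF assms(1)] bounded_op_scaleC[OF assms(2), symmetric] by auto
qed

lemma closed_image_bounded_below: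
  fixes L :: "'a::chilbert_space set"
  assumes L: "closed_csubspace L" and D: "bounded_op D"
    and c: "c > 0" and below: "\<And>x. x \<in> L \<Longrightarrow> c * norm x \<le> norm (D x)"
  shows "closed_csubspace (D ` L)"
proof -
  have "complete (D ` L)"
    using complete_isometric_image[OF c csubspace_imp_subspace bounded_op_bounded_linear[OF D]]
      L below by (auto simp: closed_csubspaceD complete_eq_closed)
  then show ?thesis
    using linear_image_csubspace[OF _ D] L by (simp add: closed_csubspace_def complete_eq_closed)
qed

text \<open>By injectivity \<open>D v\<close> has positive distance \<open>norm w\<close> from the
  image of \<open>L\<close>, which is closed because \<open>D\<close> is bounded below on
  \<open>L\<close>. Hence \<open>D x\<close> controls the coefficient of \<open>v\<close> in
  \<open>x\<close>, and then also the part of \<open>x\<close> in \<open>L\<close>.\<close>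

lemma bounded_below_span_insert:
  fixes L :: "'a::chilbert_space set"
  assumes L: "closed_csubspace L" and D: "bounded_op D"
    and c: "c > 0" and below: "\<And>x. x \<in> L \<Longrightarrow> c * norm x \<le> norm (D x)"
    and inj: "\<And>x. x \<in> cspan (insert v L) \<Longrightarrow> D x = 0 \<Longrightarrow> x = 0"
  shows "\<exists>c>0. \<forall>x\<in>cspan (insert v L). c * norm x \<le> norm (D x)"
proof (cases "v \<in> L")
  case True
  have "cspan L = L" using L closed_csubspaceD complex_vector.span_eq_iff by blast
  then have "cspan (insert v L) = L" using True by (simp only: insert_absorb)
  then show ?thesis using c below by metis
next
  case False
  have subL: "csubspace L" using L closed_csubspaceD by blast
  have spanL: "cspan L = L" using subL complex_vector.span_eq_iff by blast
  have DL: "closed_csubspace (D ` L)" by (rule closed_image_bounded_below[OF L D c below])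
  define w where "w = D v - proj (D ` L) (D v)"
  have w: "w \<in> orth (D ` L)" unfolding w_def by (rule proj_orth[OF DL])
  have "w \<noteq> 0"
  proof
    assume "w = 0"
    then obtain l where l: "l \<in> L" "D v = D l" using proj_in[OF DL, of "D v"] by (auto simp: w_def)
    have "v - l \<in> cspan (insert v L)"
      by (rule complex_vector.span_diff; rule complex_vector.span_base) (use l in auto)
    moreover have "D (v - l) = 0" using l D by (simp add: bounded_op_diff)
    ultimately have "v - l = 0" using inj by blast
    then show False using False l by simp
  qed
  then have d: "norm w > 0" by simp
  \<comment> \<open>The first summand bounds the part of \<open>x\<close> in \<open>L\<close>, the
    second the multiple of \<open>v\<close>, both per unit of \<open>norm (D x)\<close>.\<close>
  define K where "K = (1 + norm (D v) / norm w) / c + norm v / norm w"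
  have K: "K > 0" unfolding K_def using c d
    by (intro add_pos_nonneg divide_pos_pos) auto
  have "(1 / K) * norm x \<le> norm (D x)" if x: "x \<in> cspan (insert v L)" for x
  proof -
    obtain k where k: "x - k *\<^sub>C v \<in> L" using x by (auto simp: complex_vector.span_insert spanL)
    define l where "l = x - k *\<^sub>C v"
    have l: "l \<in> L" and xe: "x = l + k *\<^sub>C v" using k by (auto simp: l_def)
    have Dx: "D x = (D l + k *\<^sub>C proj (D ` L) (D v)) + k *\<^sub>C w"
      by (simp add: xe w_def bounded_op_add[OF D] bounded_op_scaleC[OF D] complex_vector.scale_right_diff_distrib)
    have "D l + k *\<^sub>C proj (D ` L) (D v) \<in> D ` L"
      using l proj_in[OF DL] closed_csubspaceD(1)[OF DL]
      by (auto intro!: complex_vector.subspace_add complex_vector.subspace_scale)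
    then have "cinner (D l + k *\<^sub>C proj (D ` L) (D v)) (k *\<^sub>C w) = 0"
      using orthD2[OF w] by (simp add: cinner_scaleC_right)
    from norm_add_sq_orth[OF this] Dx have "(norm (k *\<^sub>C w))\<^sup>2 \<le> (norm (D x))\<^sup>2" by simp
    then have "cmod k * norm w \<le> norm (D x)" by (simp add: norm_scaleC power2_le_iff_abs_le)
    then have k1: "cmod k \<le> norm (D x) / norm w" using d by (simp add: field_simps)
    have "D l = D x - k *\<^sub>C D v" by (simp add: l_def bounded_op_diff[OF D] bounded_op_scaleC[OF D])
    then have "norm (D l) \<le> norm (D x) + cmod k * norm (D v)"
      using norm_triangle_ineq4[of "D x" "k *\<^sub>C D v"] by (simp add: norm_scaleC)
    also have "\<dots> \<le> norm (D x) + norm (D x) / norm w * norm (D v)"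
      using k1 by (intro add_left_mono mult_right_mono) auto
    finally have "c * norm l \<le> norm (D x) + norm (D x) / norm w * norm (D v)"
      using below[OF l] by linarith
    then have "norm l \<le> (norm (D x) + norm (D x) / norm w * norm (D v)) / c"
      using c by (simp add: field_simps)
    moreover have "norm x \<le> norm l + cmod k * norm v"
      unfolding xe using norm_triangle_ineq[of l "k *\<^sub>C v"] by (simp add: norm_scaleC)
    moreover have "cmod k * norm v \<le> norm (D x) / norm w * norm v"
      using k1 by (intro mult_right_mono) auto
    ultimately have "norm x \<le> (norm (D x) + norm (D x) / norm w * norm (D v)) / c + norm (D x) / norm w * norm v"
      by linarith
    also have "\<dots> = K * norm (D x)" using c d by (simp add: K_def field_simps)
    finally show ?thesis using K by (simp add: field_simps)
  qed
  then show ?thesis using K by (intro exI[of _ "1 / K"]) auto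
qed

lemma bounded_below_span_Un:
  fixes L :: "'a::chilbert_space set"
  assumes L: "closed_csubspace L" and D: "bounded_op D"
    and c: "c > 0" and below: "\<And>x. x \<in> L \<Longrightarrow> c * norm x \<le> norm (D x)"
    and F: "finite F"
    and inj: "\<And>x. x \<in> cspan (F \<union> L) \<Longrightarrow> D x = 0 \<Longrightarrow> x = 0"
  shows "\<exists>c>0. \<forall>x\<in>cspan (F \<union> L). c * norm x \<le> norm (D x)"
  using F inj
proof (induction F rule: finite_induct)
  case empty
  have "cspan L = L" using L closed_csubspaceD complex_vector.span_eq_iff by blast
  then have "cspan ({} \<union> L) = L" by (simp only: Un_empty_left)
  then show ?case using c below by metis
next
  case (insert v F)
  have eq: "cspan (insert v F \<union> L) = cspan (insert v (cspan (F \<union> L)))"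
    by (simp add: cspan_insert_span)
  have sub: "cspan (F \<union> L) \<subseteq> cspan (insert v F \<union> L)" by (intro complex_vector.span_mono) auto
  obtain c' where c': "c' > 0" "\<And>x. x \<in> cspan (F \<union> L) \<Longrightarrow> c' * norm x \<le> norm (D x)"
    using insert.IH insert.prems sub by blast
  show ?case unfolding eq
    using bounded_below_span_insert[OF closed_csubspace_span_Un[OF L insert.hyps(1)] D c'] insert.prems
    unfolding eq by blast
qed

text \<open>A vector of \<open>M\<close> has the same inner product with \<open>f\<close> as with
  \<open>proj M f\<close>. So finitely many constraints cut out a subspace of finite codimension
  inside \<open>M\<close>, with complement spanned by projections of \<open>F\<close>.\<close>

lemma csubspace_eq_span_Un_orth:
  fixes M :: "'a::chilbert_space set"
  assumes M: "closed_csubspace M" and F: "finite F"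
  shows "M = cspan (proj M ` F \<union> (M \<inter> orth F))"
proof
  have subM: "csubspace M" using M closed_csubspaceD by blast
  show "cspan (proj M ` F \<union> (M \<inter> orth F)) \<subseteq> M"
    using proj_in[OF M] subM by (intro complex_vector.span_minimal) auto
  show "M \<subseteq> cspan (proj M ` F \<union> (M \<inter> orth F))"
  proof
    fix x assume x: "x \<in> M"
    define S where "S = cspan (proj M ` F)"
    have S: "closed_csubspace S" unfolding S_def using F by (intro closed_csubspace_span_finite) auto
    have SM: "S \<subseteq> M" unfolding S_def using proj_in[OF M] subM by (intro complex_vector.span_minimal) auto
    have m: "x - proj S x \<in> M" using x proj_in[OF S, of x] SM subM complex_vector.subspace_diff by blast
    have "cinner (x - proj S x) f = 0" if f: "f \<in> F" for f
    proof -
      have "cinner (x - proj S x) (proj M f) = 0"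
        using proj_orth[OF S, of x] f by (auto simp: S_def orth_cspan intro: orthD)
      moreover have "cinner (x - proj S x) (f - proj M f) = 0"
        using orthD2[OF proj_orth[OF M] m] .
      ultimately show ?thesis by (simp add: cinner_diff_right)
    qed
    then have "x - proj S x \<in> M \<inter> orth F" using m by (auto intro: orthI)
    then have "x - proj S x \<in> cspan (proj M ` F \<union> (M \<inter> orth F))"
      by (intro complex_vector.span_base) auto
    moreover have "proj S x \<in> cspan (proj M ` F \<union> (M \<inter> orth F))"
      using proj_in[OF S, of x] complex_vector.span_mono[of "proj M ` F" "proj M ` F \<union> (M \<inter> orth F)"]
      unfolding S_def by auto
    ultimately have "(x - proj S x) + proj S x \<in> cspan (proj M ` F \<union> (M \<inter> orth F))"
      by (rule complex_vector.span_add)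
    then show "x \<in> cspan (proj M ` F \<union> (M \<inter> orth F))" by simp
  qed
qed

lemma finite_cdim_if_orth_trivial:
  fixes M :: "'a::chilbert_space set"
  assumes M: "closed_csubspace M" and F: "finite F" and triv: "M \<inter> orth F \<subseteq> {0}"
  shows "finite_cdim M"
proof -
  have "M \<inter> orth F = {0}"
    using triv M closed_csubspace_orth complex_vector.subspace_0 closed_csubspaceD(1) by blast
  then have "M = cspan (proj M ` F)"
    using csubspace_eq_span_Un_orth[OF M F] by (simp add: complex_vector.span_insert_0)
  then show ?thesis using F unfolding finite_cdim_def by (metis finite_imageI)
qed

text \<open>This is the shape in which infinite dimension enters: finitely many linear constraints
  always leave a unit vector.\<close>

lemma orth_finite_nonzero:
  assumes "\<not> finite_cdim (UNIV :: 'a::chilbert_space set)" and "finite (F :: 'a set)"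
  shows "\<exists>x\<in>orth F. norm x = 1"
proof -
  obtain x where x: "x \<in> orth F" "x \<noteq> 0"
    using finite_cdim_if_orth_trivial[OF closed_csubspace_UNIV assms(2)] assms(1) by auto
  then have "(1 / norm x) *\<^sub>R x \<in> orth F" by (intro csubspace_scaleR csubspace_orth)
  then show ?thesis using x by (intro bexI[of _ "(1 / norm x) *\<^sub>R x"]) auto
qed

section \<open>Compact symmetric operators\<close>

text \<open>For bounded operators on a Hilbert space this is equivalent to compactness.\<close>

definition compact_op :: "('a::complex_inner \<Rightarrow> 'a) \<Rightarrow> bool" where
  "compact_op C \<longleftrightarrow> (\<forall>e>0. \<exists>F. finite F \<and> (\<forall>x\<in>orth F. norm (C x) \<le> e * norm x))"

text \<open>Off a finite set \<open>C\<close> is at most half as large as the scalar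
  \<open>\<mu>\<close>, so the scalar dominates the difference.\<close>

lemma compact_op_bounded_below_orth:
  assumes "compact_op C" "\<mu> \<noteq> 0"
  obtains F where "finite F" "\<And>x. x \<in> orth F \<Longrightarrow> cmod \<mu> / 2 * norm x \<le> norm (C x - \<mu> *\<^sub>C x)"
proof -
  obtain F where F: "finite F" "\<And>x. x \<in> orth F \<Longrightarrow> norm (C x) \<le> cmod \<mu> / 2 * norm x"
    using assms unfolding compact_op_def by (meson half_gt_zero zero_less_norm_iff)
  have "cmod \<mu> / 2 * norm x \<le> norm (C x - \<mu> *\<^sub>C x)" if "x \<in> orth F" for x
    using F(2)[OF that] norm_triangle_ineq2[of "\<mu> *\<^sub>C x" "C x"] by (simp add: norm_scaleC norm_minus_commute)
  then show ?thesis using that F by blast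
qed

text \<open>Off a finite set of directions the scalar dominates; injectivity lets the lower bound
  survive when these directions are put back.\<close>

lemma compact_op_bounded_below:
  fixes C :: "'a::chilbert_space \<Rightarrow> 'a"
  assumes C: "bounded_op C" "compact_op C" and mu: "\<mu> \<noteq> 0" and M: "closed_csubspace M"
    and inj: "\<And>x. x \<in> M \<Longrightarrow> C x = \<mu> *\<^sub>C x \<Longrightarrow> x = 0"
  shows "\<exists>c>0. \<forall>x\<in>M. c * norm x \<le> norm (C x - \<mu> *\<^sub>C x)"
proof -
  obtain F where F: "finite F" "\<And>x. x \<in> orth F \<Longrightarrow> cmod \<mu> / 2 * norm x \<le> norm (C x - \<mu> *\<^sub>C x)"
    using compact_op_bounded_below_orth[OF C(2) mu] by blast
  have eq: "M = cspan (proj M ` F \<union> (M \<inter> orth F))" by (rule csubspace_eq_span_Un_orth[OF M F(1)])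
  have "\<exists>c>0. \<forall>x\<in>cspan (proj M ` F \<union> (M \<inter> orth F)). c * norm x \<le> norm (C x - \<mu> *\<^sub>C x)"
  proof (rule bounded_below_span_Un)
    show "closed_csubspace (M \<inter> orth F)" by (intro closed_csubspace_Int M closed_csubspace_orth)
    show "bounded_op (\<lambda>x. C x - \<mu> *\<^sub>C x)" by (rule bounded_op_minus_scaleC[OF C(1)])
    show "0 < cmod \<mu> / 2" using mu by simp
    show "finite (proj M ` F)" using F by simp
    show "x = 0" if "x \<in> cspan (proj M ` F \<union> (M \<inter> orth F))" "C x - \<mu> *\<^sub>C x = 0" for x
      using that inj eq by auto
  qed (use F in auto)
  then show ?thesis using eq by simp
qed

text \<open>The image of \<open>orth F\<close> is closed because the operator is bounded below
  there, and the whole range exceeds it by the span of finitely many vectors.\<close>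

lemma compact_op_closed_range:
  fixes C :: "'a::chilbert_space \<Rightarrow> 'a"
  assumes C: "bounded_op C" "compact_op C" and mu: "\<mu> \<noteq> 0"
  shows "closed_csubspace (range (\<lambda>x. C x - \<mu> *\<^sub>C x))"
proof -
  define D where "D = (\<lambda>x. C x - \<mu> *\<^sub>C x)"
  have D: "bounded_op D" unfolding D_def by (rule bounded_op_minus_scaleC[OF C(1)])
  obtain F where F: "finite F" "\<And>x. x \<in> orth F \<Longrightarrow> cmod \<mu> / 2 * norm x \<le> norm (D x)"
    using compact_op_bounded_below_orth[OF C(2) mu] unfolding D_def by blast
  have DF: "closed_csubspace (D ` orth F)"
    using closed_image_bounded_below[OF closed_csubspace_orth D _ F(2)] mu by simp
  have S: "closed_csubspace (cspan F)" by (rule closed_csubspace_span_finite[OF F(1)])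
  have "range D = cspan (D ` F \<union> D ` orth F)"
  proof
    have "csubspace (range D)" by (rule linear_image_csubspace[OF complex_vector.subspace_UNIV D])
    then show "cspan (D ` F \<union> D ` orth F) \<subseteq> range D" by (intro complex_vector.span_minimal) auto
    show "range D \<subseteq> cspan (D ` F \<union> D ` orth F)"
    proof clarify
      fix x
      have "x - proj (cspan F) x \<in> orth F" using proj_orth[OF S, of x] by (simp add: orth_cspan)
      then have 1: "D (x - proj (cspan F) x) \<in> cspan (D ` F \<union> D ` orth F)"
        by (intro complex_vector.span_base) auto
      have "cspan F \<subseteq> D -` cspan (D ` F \<union> D ` orth F)"
      proof (rule complex_vector.span_minimal)
        show "F \<subseteq> D -` cspan (D ` F \<union> D ` orth F)" by (auto intro: complex_vector.span_base)
        show "csubspace (D -` cspan (D ` F \<union> D ` orth F))"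
          by (rule complex_vector.subspaceI)
            (auto simp: bounded_op_add[OF D] bounded_op_scaleC[OF D] bounded_op_zero[OF D]
              complex_vector.span_zero intro: complex_vector.span_add complex_vector.span_scale)
      qed
      then have 2: "D (proj (cspan F) x) \<in> cspan (D ` F \<union> D ` orth F)" using proj_in[OF S] by blast
      from complex_vector.span_add[OF 1 2] show "D x \<in> cspan (D ` F \<union> D ` orth F)"
        by (simp flip: bounded_op_add[OF D])
    qed
  qed
  then show ?thesis
    using closed_csubspace_span_Un[OF DF, of "D ` F"] F by (simp add: D_def)
qed

lemma compact_op_finite_on:
  fixes M :: "'a::chilbert_space set"
  assumes C: "compact_op C" and M: "closed_csubspace M" and d: "d > 0"
    and below: "\<And>x. x \<in> M \<Longrightarrow> d * norm x \<le> norm (C x)"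
  shows "finite_cdim M"
proof -
  obtain F where F: "finite F" "\<And>x. x \<in> orth F \<Longrightarrow> norm (C x) \<le> d / 2 * norm x"
    using C d unfolding compact_op_def by (meson half_gt_zero)
  have "x = 0" if "x \<in> M" "x \<in> orth F" for x
  proof -
    have "d * norm x \<le> d / 2 * norm x" using F(2) below that by force
    then show ?thesis using d by simp
  qed
  then show ?thesis using finite_cdim_if_orth_trivial[OF M F(1)] by blast
qed

lemma compact_op_finite_eigenspace:
  fixes C :: "'a::chilbert_space \<Rightarrow> 'a"
  assumes C: "bounded_op C" "compact_op C" and mu: "\<mu> \<noteq> 0"
  shows "finite_cdim {x. C x = \<mu> *\<^sub>C x}"
proof (rule compact_op_finite_on[OF C(2)])
  show "closed_csubspace {x. C x = \<mu> *\<^sub>C x}"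
    using null_closed_csubspace[OF bounded_op_minus_scaleC[OF C(1), of \<mu>]] by simp
  show "cmod \<mu> > 0" using mu by simp
qed (auto simp: norm_scaleC)

lemma independent_subset_finite_cdim:
  assumes "finite_cdim M" "B \<subseteq> M" "\<not> complex_vector.dependent B"
  shows "finite B"
  using assms complex_vector.independent_span_bound unfolding finite_cdim_def by metis

lemma orthogonal_independent:
  assumes nz: "\<And>i. i \<in> I \<Longrightarrow> e i \<noteq> (0::'a::complex_inner)"
    and orth: "\<And>i j. i \<in> I \<Longrightarrow> j \<in> I \<Longrightarrow> i \<noteq> j \<Longrightarrow> cinner (e i) (e j) = 0"
  shows "inj_on e I \<and> \<not> complex_vector.dependent (e ` I)"
proof
  have self: "cinner (e i) (e i) \<noteq> 0" if "i \<in> I" for i using nz[OF that] by (simp add: cinner_self)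
  show "inj_on e I" by (rule inj_onI) (metis orth self)
  show "\<not> complex_vector.dependent (e ` I)"
    unfolding complex_vector.dependent_def
  proof clarify
    fix i assume i: "i \<in> I" and sp: "e i \<in> cspan (e ` I - {e i})"
    have "e i \<in> orth (e ` I - {e i})" using i orth by (auto simp: orth_def)
    then have "e i \<in> orth (cspan (e ` I - {e i}))" by (simp add: orth_cspan)
    then show False using in_orth_self[OF sp] nz[OF i] by simp
  qed
qed

text \<open>The supremum of the numerical range on \<open>M\<close>, if above \<open>t\<close>, would be an eigenvalue.\<close>

lemma compact_symmetric_numerical_bound:
  fixes C :: "'a::chilbert_space \<Rightarrow> 'a"
  assumes C: "bounded_op C" "compact_op C" "symmetric_op C" and M: "closed_csubspace M"
    and inv: "\<And>x. x \<in> M \<Longrightarrow> C x \<in> M" and t: "t \<ge> 0"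
    and noeig: "\<And>\<mu> x. \<mu> > t \<Longrightarrow> x \<in> M \<Longrightarrow> C x = \<mu> *\<^sub>R x \<Longrightarrow> x = 0"
    and x: "x \<in> M"
  shows "Re (cinner (C x) x) \<le> t * (norm x)\<^sup>2"
proof (rule ccontr)
  assume nle: "\<not> Re (cinner (C x) x) \<le> t * (norm x)\<^sup>2"
  have subM: "csubspace M" using M closed_csubspaceD by blast
  have xnz: "x \<noteq> 0" using nle by auto
  define S where "S = {y \<in> M. norm y = 1}"
  define u where "u = (1 / norm x) *\<^sub>R x"
  have uS: "u \<in> S" using xnz x subM by (simp add: S_def u_def csubspace_scaleR)
  have "Re (cinner (C u) u) = Re (cinner (C x) x) / (norm x)\<^sup>2"
    by (simp add: u_def bounded_op_scaleR[OF C(1)] cinner_simps power2_eq_square)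
  then have ut: "t < Re (cinner (C u) u)" using nle xnz by (simp add: less_divide_eq)
  define s where "s = (SUP y\<in>S. Re (cinner (C y) y))"
  have bdd: "bdd_above ((\<lambda>y. Re (cinner (C y) y)) ` S)"
  proof (rule bdd_aboveI)
    fix r assume "r \<in> (\<lambda>y. Re (cinner (C y) y)) ` S"
    then obtain y where y: "norm y = 1" "r = Re (cinner (C y) y)" by (auto simp: S_def)
    have "r \<le> norm (C y) * norm y" using Re_Cauchy_Schwarz[of "C y" y] y by simp
    then show "r \<le> onorm C" using bounded_op_le[OF C(1), of y] y by simp
  qed
  have s: "t < s" using ut cSUP_upper[OF uS bdd] by (simp add: s_def)
  have le_s: "Re (cinner (C y) y) \<le> s * (norm y)\<^sup>2" if y: "y \<in> M" for y
  proof (cases "y = 0")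
    case False
    have "(1 / norm y) *\<^sub>R y \<in> S" using False y subM by (simp add: S_def csubspace_scaleR)
    from cSUP_upper[OF this bdd] have "Re (cinner (C y) y) / (norm y)\<^sup>2 \<le> s"
      by (simp add: s_def bounded_op_scaleR[OF C(1)] cinner_simps power2_eq_square)
    then show ?thesis using False by (simp add: field_simps)
  qed simp
  \<comment> \<open>\<open>s - C\<close> is positive semidefinite on \<open>M\<close>, and bounded
    below in norm there, since \<open>s > t\<close> cannot be an eigenvalue.\<close>
  define Q where "Q y = s *\<^sub>R y - C y" for y
  have Q: "symmetric_op Q"
    using C(3) by (simp add: symmetric_op_def Q_def cinner_simps)
  have Qnorm: "norm (Q y) = norm (C y - complex_of_real s *\<^sub>C y)" for y
    by (simp add: Q_def scaleC_of_real norm_minus_commute)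
  have s0: "s > 0" using s t by simp
  obtain c where c: "c > 0" and below: "\<And>y. y \<in> M \<Longrightarrow> c * norm y \<le> norm (Q y)"
    using compact_op_bounded_below[OF C(1,2) _ M, of "complex_of_real s"] noeig[OF s] s0
    unfolding Qnorm by (auto simp: scaleC_of_real)
  define K where "K = s + onorm C"
  have QK: "norm (Q y) \<le> K * norm y" for y
    using norm_triangle_ineq4[of "s *\<^sub>R y" "C y"] bounded_op_le[OF C(1), of y] s0
    by (simp add: Q_def K_def algebra_simps)
  have K: "K > 0"
    using s0 onorm_pos_le[OF bounded_op_bounded_linear[OF C(1)]] by (simp add: K_def)
  \<comment> \<open>Cauchy-Schwarz for the form of \<open>Q\<close>, at \<open>y\<close> and
    \<open>Q y\<close>, turns the lower bound on \<open>norm (Q y)\<close> into a uniform distance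
    between the values of the form of \<open>C\<close> on \<open>S\<close> and their supremum
    \<open>s\<close>.\<close>
  have gap: "c\<^sup>2 / K \<le> s - Re (cinner (C y) y)" if y: "y \<in> S" for y
  proof -
    have yM: "y \<in> M" and ny: "norm y = 1" using y by (auto simp: S_def)
    have QM: "Q y \<in> M" using yM inv subM by (simp add: Q_def complex_vector.subspace_diff csubspace_scaleR)
    have q: "Re (cinner (Q z) z) = s * (norm z)\<^sup>2 - Re (cinner (C z) z)" for z
      by (simp add: Q_def cinner_simps cinner_self)
    have Qpos: "norm (Q y) > 0" using below[OF yM] c ny by auto
    have "(cmod (cinner (Q y) (Q y)))\<^sup>2 \<le> Re (cinner (Q y) y) * Re (cinner (Q (Q y)) (Q y))"
      by (rule semidefinite_Cauchy_Schwarz[OF Q subM _ yM QM]) (use q le_s in auto)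
    also have "\<dots> \<le> Re (cinner (Q y) y) * (K * (norm (Q y))\<^sup>2)"
    proof (rule mult_left_mono)
      show "0 \<le> Re (cinner (Q y) y)" using q[of y] le_s[OF yM] by simp
      have "Re (cinner (Q (Q y)) (Q y)) \<le> norm (Q (Q y)) * norm (Q y)"
        using Re_Cauchy_Schwarz abs_le_D1 by blast
      also have "\<dots> \<le> K * norm (Q y) * norm (Q y)" by (intro mult_right_mono QK) auto
      finally show "Re (cinner (Q (Q y)) (Q y)) \<le> K * (norm (Q y))\<^sup>2" by (simp add: power2_eq_square)
    qed
    also have "(cmod (cinner (Q y) (Q y)))\<^sup>2 = (norm (Q y))\<^sup>2 * (norm (Q y))\<^sup>2"
      by (simp add: cinner_self norm_mult power2_eq_square)
    finally have "(norm (Q y))\<^sup>2 * (norm (Q y))\<^sup>2 \<le> (Re (cinner (Q y) y) * K) * (norm (Q y))\<^sup>2"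
      by (simp only: mult.assoc)
    then have "(norm (Q y))\<^sup>2 \<le> Re (cinner (Q y) y) * K"
      by (rule mult_right_le_imp_le) (use Qpos in simp)
    moreover have "c\<^sup>2 \<le> (norm (Q y))\<^sup>2" using below[OF yM] c ny by (intro power_mono) auto
    ultimately have "c\<^sup>2 \<le> (s - Re (cinner (C y) y)) * K" using q[of y] ny by simp
    then show ?thesis using K by (simp add: field_simps)
  qed
  have "s \<le> s - c\<^sup>2 / K" unfolding s_def
    by (rule cSUP_least) (use uS gap in \<open>auto simp: s_def algebra_simps\<close>)
  then show False using c K by (simp add: field_simps)
qed

section \<open>Square roots of positive operators\<close>

instance chilbert_space \<subseteq> banach ..

lemma bounded_bilinear_cinner: "bounded_bilinear (cinner :: 'a::complex_inner \<Rightarrow> 'a \<Rightarrow> complex)"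
proof
  show "\<exists>K. \<forall>a b. cmod (cinner a (b::'a)) \<le> norm a * norm b * K"
    by (rule exI[of _ 1]) (simp add: Cauchy_Schwarz)
qed (auto simp: cinner_simps scaleR_conv_of_real)

lemmas tendsto_cinner = bounded_bilinear.tendsto[OF bounded_bilinear_cinner]

lemma positive_onD: "positive_on M S \<Longrightarrow> x \<in> M \<Longrightarrow> 0 \<le> Re (cinner (S x) x)"
  by (auto simp: positive_on_def nonneg_Reals_def)

lemma symmetric_positive_onI:
  assumes S: "symmetric_op S" and pos: "\<And>x. x \<in> M \<Longrightarrow> 0 \<le> Re (cinner (S x) x)"
  shows "positive_on M S"
  unfolding positive_on_def
proof
  fix x assume "x \<in> M"
  then show "cinner (S x) x \<in> \<real>\<^sub>\<ge>\<^sub>0"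
    using symmetric_op_Im[OF S, of x] pos[of x] nonneg_Reals_of_real_iff by metis
qed

text \<open>Polarization: the form is real at \<open>x + y\<close> and at
  \<open>x + \<i> *\<^sub>C y\<close>, which fixes the imaginary and the real part of the symmetry
  relation respectively.\<close>

lemma positive_symmetric:
  fixes S :: "'a::complex_inner \<Rightarrow> 'a"
  assumes S: "bounded_op S" and pos: "positive_on UNIV S"
  shows "symmetric_op S"
  unfolding symmetric_op_def
proof (intro allI)
  fix x y
  have real: "Im (cinner (S z) z) = 0" for z
    using pos by (simp add: positive_on_def complex_nonneg_Reals_iff)
  have add: "S (u + v) = S u + S v" and sc: "S (c *\<^sub>C u) = c *\<^sub>C S u" for u v c
    using S by (auto simp: bounded_op_add bounded_op_scaleC)
  have "Im (cinner (S x) y) + Im (cinner (S y) x) = 0"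
    using real[of "x + y"] real[of x] real[of y] by (simp add: add cinner_simps)
  moreover have "Re (cinner (S y) x) = Re (cinner (S x) y)"
    using real[of "x + \<i> *\<^sub>C y"] real[of x] real[of y] by (simp add: add sc cinner_simps)
  ultimately have "cinner (S x) y = cnj (cinner (S y) x)" by (simp add: complex_eq_iff)
  then show "cinner (S x) y = cinner x (S y)" by (simp flip: cinner_commute)
qed

text \<open>An approximate eigenvector \<open>x\<close> of \<open>D = S - T\<close> for \<open>\<plusminus>\<parallel>D\<parallel>\<close> nearly attains the norm of
  \<open>S\<^sup>2 - T\<^sup>2 = S D + D T\<close>, since \<open>\<langle>(S + T) x, x\<rangle> \<ge> \<bar>\<langle>D x, x\<rangle>\<bar>\<close>.\<close>

lemma positive_square_diff_bound:
  fixes S T :: "'a::chilbert_space \<Rightarrow> 'a"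
  assumes S: "bounded_op S" "positive_on UNIV S" and T: "bounded_op T" "positive_on UNIV T"
    and K: "K \<ge> 0" and sq: "\<And>x. norm (S (S x) - T (T x)) \<le> K * norm x"
  shows "norm (S x - T x) \<le> sqrt K * norm x"
proof -
  have symS: "symmetric_op S" and symT: "symmetric_op T" using S T positive_symmetric by auto
  define D where "D x = S x - T x" for x
  have symD: "symmetric_op D"
    using symS symT by (simp add: symmetric_op_def D_def cinner_diff_left cinner_diff_right)
  have blD: "bounded_linear D"
    unfolding D_def using S T by (intro bounded_linear_sub bounded_op_bounded_linear)
  define d where "d = onorm D"
  define L where "L = onorm S + onorm T"
  have L: "L \<ge> 0" unfolding L_def using S T by (simp add: onorm_pos_le bounded_op_bounded_linear)
  have d0: "d \<ge> 0" unfolding d_def by (rule onorm_pos_le[OF blD])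
  \<comment> \<open>\<open>h\<close> is the slack by which the unit vector \<open>x\<close> below
    misses the norm \<open>d\<close> of \<open>D\<close>; the square root bounds the residual
    \<open>w\<close> of \<open>x\<close> as an approximate eigenvector. Letting \<open>h\<close>
    tend to 0 leaves \<open>d\<^sup>2 \<le> K\<close>.\<close>
  have est: "d * (d - h) \<le> K + sqrt (2 * d * h) * L" if h: "0 < h" "h < d" for h
  proof -
    have "\<exists>x. \<not> \<bar>Re (cinner (D x) x)\<bar> \<le> (d - h) * (norm x)\<^sup>2"
    proof (rule ccontr)
      assume "\<not> ?thesis"
      then have "norm (D x) \<le> (d - h) * norm x" for x
        using symmetric_op_numerical_bound[OF symD complex_vector.subspace_UNIV] by blast
      then have "onorm D \<le> d - h" using h by (intro onorm_bound) auto
      then show False using h by (simp add: d_def)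
    qed
    then obtain x0 where x0: "\<bar>Re (cinner (D x0) x0)\<bar> > (d - h) * (norm x0)\<^sup>2"
      unfolding not_le by blast
    then have nz: "x0 \<noteq> 0" by auto
    define x where "x = (1 / norm x0) *\<^sub>R x0"
    have nx: "norm x = 1" using nz by (simp add: x_def)
    have "Re (cinner (D x) x) = Re (cinner (D x0) x0) / (norm x0)\<^sup>2"
      by (simp add: x_def symmetric_op_scaleR[OF symD] cinner_simps power2_eq_square)
    then have big: "\<bar>Re (cinner (D x) x)\<bar> > d - h" using x0 nz by (simp add: less_divide_eq)
    define \<sigma> :: real where "\<sigma> = (if Re (cinner (D x) x) \<ge> 0 then 1 else -1)"
    have sg: "\<sigma> * Re (cinner (D x) x) > d - h" "\<sigma> * \<sigma> = 1" "\<bar>\<sigma>\<bar> = 1" using big by (auto simp: \<sigma>_def)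
    have Dx: "norm (D x) \<le> d" using onorm[OF blD, of x] nx by (simp add: d_def)
    define w where "w = D x - (\<sigma> * d) *\<^sub>R x"
    have "(norm w)\<^sup>2 = (norm (D x))\<^sup>2 - 2 * d * (\<sigma> * Re (cinner (D x) x)) + d\<^sup>2"
      using sg(2) unfolding w_def norm_diff_sq
      by (simp add: nx cinner_simps power2_eq_square algebra_simps)
    also have "\<dots> \<le> d\<^sup>2 - 2 * d * (d - h) + d\<^sup>2"
      using sg(1) d0 Dx by (intro add_mono diff_mono power_mono mult_left_mono) auto
    also have "\<dots> = 2 * d * h" by (simp add: power2_eq_square algebra_simps)
    finally have w: "norm w \<le> sqrt (2 * d * h)" by (rule real_le_rsqrt)
    have e1: "S (S x) - T (T x) = S (D x) + D (T x)" by (simp add: D_def bounded_op_diff S)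
    have "Re (cinner (S (S x) - T (T x)) x) = Re (cinner (D x) (S x + T x))"
      unfolding e1 using Re_cinner_commute[of "T x" "D x"]
      by (simp add: cinner_simps symmetric_opD[OF symS, of "D x"] symmetric_opD[OF symD, of "T x"])
    also have "D x = w + (\<sigma> * d) *\<^sub>R x" by (simp add: w_def)
    also have "Re (cinner (w + (\<sigma> * d) *\<^sub>R x) (S x + T x))
        = \<sigma> * d * (Re (cinner (S x) x) + Re (cinner (T x) x)) + Re (cinner w (S x + T x))"
      using Re_cinner_commute[of x "S x"] Re_cinner_commute[of x "T x"] by (simp add: cinner_simps algebra_simps)
    finally have "d * (Re (cinner (S x) x) + Re (cinner (T x) x))
        = \<sigma> * Re (cinner (S (S x) - T (T x)) x) - \<sigma> * Re (cinner w (S x + T x))"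
      using sg(2) by (simp add: algebra_simps flip: mult.assoc)
    moreover have "\<sigma> * Re (cinner (S (S x) - T (T x)) x) \<le> K"
    proof -
      have "\<sigma> * Re (cinner (S (S x) - T (T x)) x) \<le> \<bar>\<sigma> * Re (cinner (S (S x) - T (T x)) x)\<bar>" by simp
      also have "\<dots> \<le> norm (S (S x) - T (T x)) * norm x"
        using Re_Cauchy_Schwarz[of "S (S x) - T (T x)" x] sg(3) by (simp add: abs_mult)
      finally show ?thesis using sq[of x] nx by simp
    qed
    moreover have "- \<sigma> * Re (cinner w (S x + T x)) \<le> sqrt (2 * d * h) * L"
    proof -
      have "- \<sigma> * Re (cinner w (S x + T x)) \<le> \<bar>\<sigma> * Re (cinner w (S x + T x))\<bar>" by simp
      also have "\<dots> \<le> norm w * norm (S x + T x)"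
        using Re_Cauchy_Schwarz[of w "S x + T x"] sg(3) by (simp add: abs_mult)
      also have "\<dots> \<le> sqrt (2 * d * h) * L"
      proof (rule mult_mono[OF w])
        show "norm (S x + T x) \<le> L"
          using norm_triangle_ineq[of "S x" "T x"] bounded_op_le[OF S(1), of x] bounded_op_le[OF T(1), of x] nx
          by (simp add: L_def)
      qed (use d0 h in auto)
      finally show ?thesis .
    qed
    moreover have "d * (d - h) \<le> d * (Re (cinner (S x) x) + Re (cinner (T x) x))"
    proof (rule mult_left_mono[OF _ d0])
      have "Re (cinner (D x) x) = Re (cinner (S x) x) - Re (cinner (T x) x)" by (simp add: D_def cinner_diff_left)
      then show "d - h \<le> Re (cinner (S x) x) + Re (cinner (T x) x)"
        using big positive_onD[OF S(2), of x] positive_onD[OF T(2), of x] by simp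
    qed
    ultimately show ?thesis by simp
  qed
  have "d\<^sup>2 \<le> K"
  proof (cases "d = 0")
    case False
    then have dpos: "d > 0" using d0 by simp
    have "((\<lambda>h. d * (d - h)) \<longlongrightarrow> d * (d - 0)) (at_right 0)" by (intro tendsto_intros)
    moreover have "((\<lambda>h. K + sqrt (2 * d * h) * L) \<longlongrightarrow> K + sqrt (2 * d * 0) * L) (at_right 0)"
      by (intro tendsto_intros)
    moreover have "eventually (\<lambda>h. d * (d - h) \<le> K + sqrt (2 * d * h) * L) (at_right 0)"
      using est dpos by (auto simp: eventually_at_right_field)
    ultimately have "d * (d - 0) \<le> K + sqrt (2 * d * 0) * L"
      by (intro tendsto_le[of "at_right (0::real)"]) auto
    then show ?thesis by (simp add: power2_eq_square)
  qed (use K in simp)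
  then have "d \<le> sqrt K" by (rule real_le_rsqrt)
  moreover have "norm (D x) \<le> d * norm x" unfolding d_def by (rule onorm[OF blD])
  ultimately have "norm (D x) \<le> sqrt K * norm x" by (meson mult_right_mono norm_ge_zero order_trans)
  then show ?thesis by (simp add: D_def)
qed

text \<open>Makes the set of symmetric operators in a ball complete, so that the fixed point
  produced by a contraction is again symmetric.\<close>

lemma closed_symmetric_blinfun:
  "closed {Y :: 'a::complex_inner \<Rightarrow>\<^sub>L 'a. symmetric_op (blinfun_apply Y)}"
  unfolding closed_sequential_limits
proof (intro allI impI, elim conjE)
  fix f and l :: "'a \<Rightarrow>\<^sub>L 'a"
  assume sym: "\<forall>n. f n \<in> {Y. symmetric_op (blinfun_apply Y)}" and lim: "f \<longlonglongrightarrow> l"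
  have "cinner (l x) y = cinner x (l y)" for x y
  proof (rule LIMSEQ_unique)
    show "(\<lambda>n. cinner (f n x) y) \<longlonglongrightarrow> cinner (l x) y"
      by (intro tendsto_cinner tendsto_intros lim)
    have "(\<lambda>n. cinner x (f n y)) \<longlonglongrightarrow> cinner x (l y)"
      by (intro tendsto_cinner tendsto_intros lim)
    then show "(\<lambda>n. cinner (f n x) y) \<longlonglongrightarrow> cinner x (l y)" using sym by (simp add: symmetric_opD)
  qed
  then show "l \<in> {Y. symmetric_op (blinfun_apply Y)}" by (simp add: symmetric_op_def)
qed

text \<open>If \<open>Y = (X + Y\<^sup>2) / 2\<close> then \<open>(1 - Y)\<^sup>2 = 1 - X\<close>.\<close>

lemma symmetric_fixed_point:
  fixes X :: "'a::chilbert_space \<Rightarrow> 'a"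
  assumes X: "symmetric_op X" and q: "0 \<le> q" "q < 1" and Xq: "\<And>x. norm (X x) \<le> q * norm x"
  shows "\<exists>Y. symmetric_op Y \<and> (\<forall>x. norm (Y x) \<le> q * norm x) \<and> (\<forall>x. Y x = (1/2) *\<^sub>R (X x + Y (Y x)))"
proof -
  have blX: "bounded_linear X"
    using symmetric_bounded_op[OF X Xq] by (rule bounded_op_bounded_linear)
  define Z where "Z = Blinfun X"
  have Z: "blinfun_apply Z = X" by (simp add: Z_def bounded_linear_Blinfun_apply blX)
  have nZ: "norm Z \<le> q" using q Xq by (intro norm_blinfun_bound) (auto simp: Z)
  define s where "s = {Y :: 'a \<Rightarrow>\<^sub>L 'a. norm Y \<le> q \<and> symmetric_op (blinfun_apply Y)}"
  define f where "f Y = (1/2) *\<^sub>R (Z + (Y o\<^sub>L Y))" for Y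
  have "s = cball 0 q \<inter> {Y. symmetric_op (blinfun_apply Y)}" by (auto simp: s_def)
  then have "complete s" by (simp add: complete_eq_closed closed_Int closed_symmetric_blinfun)
  moreover have "s \<noteq> {}"
  proof -
    have "0 \<in> s" using q by (simp add: s_def symmetric_op_def)
    then show ?thesis by auto
  qed
  moreover have "f ` s \<subseteq> s"
  proof clarify
    fix Y assume Y: "Y \<in> s"
    then have nY: "norm Y \<le> q" and sY: "symmetric_op (blinfun_apply Y)" by (auto simp: s_def)
    have "norm (Y o\<^sub>L Y) \<le> q * q"
      using norm_blinfun_compose[of Y Y] mult_mono[OF nY nY] q by simp
    also have "\<dots> \<le> q" using q by (simp add: mult_left_le_one_le)
    finally have "norm (f Y) \<le> q"
      using norm_triangle_ineq[of Z "Y o\<^sub>L Y"] nZ by (simp add: f_def)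
    moreover have "symmetric_op (blinfun_apply (f Y))"
      using X sY by (simp add: f_def symmetric_op_def Z blinfun.bilinear_simps cinner_simps)
    ultimately show "f Y \<in> s" by (simp add: s_def)
  qed
  moreover have "dist (f Y) (f W) \<le> q * dist Y W" if "Y \<in> s" "W \<in> s" for Y W
  proof -
    have n: "norm Y \<le> q" "norm W \<le> q" using that by (auto simp: s_def)
    \<comment> \<open>This splitting of the difference of squares holds without commutativity; since
      \<open>Y\<close> and \<open>W\<close> have norm at most \<open>q\<close>, it gives contraction
      factor \<open>q\<close>.\<close>
    have "f Y - f W = (1/2) *\<^sub>R ((Y o\<^sub>L (Y - W)) + ((Y - W) o\<^sub>L W))"
      by (rule blinfun_eqI) (simp add: f_def blinfun.bilinear_simps algebra_simps)
    then have "norm (f Y - f W) = (1/2) * norm ((Y o\<^sub>L (Y - W)) + ((Y - W) o\<^sub>L W))" by simp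
    also have "\<dots> \<le> (1/2) * (norm Y * norm (Y - W) + norm (Y - W) * norm W)"
      using norm_triangle_le[OF add_mono[OF norm_blinfun_compose norm_blinfun_compose]]
      by (intro mult_left_mono) auto
    also have "\<dots> \<le> (1/2) * (q * norm (Y - W) + norm (Y - W) * q)"
      using n by (intro mult_left_mono add_mono mult_mono) (auto simp: q)
    finally show ?thesis by (simp add: dist_norm)
  qed
  ultimately have "\<exists>!Y\<in>s. f Y = Y" using q by (intro Banach_fix) auto
  then obtain Y where Y: "Y \<in> s" "f Y = Y" by blast
  have "blinfun_apply Y x = (1/2) *\<^sub>R (X x + Y (Y x))" for x
    by (subst Y(2)[symmetric]) (simp add: f_def blinfun.bilinear_simps Z)
  moreover have "norm (blinfun_apply Y x) \<le> q * norm x" for x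
    using norm_blinfun[of Y x] Y(1) mult_right_mono[of "norm Y" q "norm x"] by (auto simp: s_def)
  ultimately show ?thesis using Y(1) by (intro exI[of _ "blinfun_apply Y"]) (auto simp: s_def)
qed

text \<open>Dividing by \<open>K\<close>, which exceeds the norm of \<open>P\<close> by
  \<open>c\<close>, makes \<open>X = 1 - P / K\<close> a strict contraction with factor
  \<open>1 - c / K\<close>. With \<open>Y\<close> the fixed point for \<open>X\<close>, the square
  of \<open>1 - Y\<close> is \<open>P / K\<close>, and \<open>sqrt K\<close> undoes the
  scaling.\<close>

lemma strictly_positive_sqrt:
  fixes P :: "'a::chilbert_space \<Rightarrow> 'a"
  assumes P: "bounded_op P" "symmetric_op P" and c: "c > 0"
    and low: "\<And>x. c * (norm x)\<^sup>2 \<le> Re (cinner (P x) x)"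
  shows "\<exists>S. bounded_op S \<and> positive_on UNIV S \<and> (\<forall>x. S (S x) = P x)"
proof -
  define K where "K = onorm P + c"
  have K: "K > 0" "c \<le> K"
    using c onorm_pos_le[OF bounded_op_bounded_linear[OF P(1)]] by (auto simp: K_def)
  define q where "q = 1 - c / K"
  have q: "0 \<le> q" "q < 1" using K c by (auto simp: q_def field_simps)
  define X where "X x = x - (1 / K) *\<^sub>R P x" for x
  have symX: "symmetric_op X" using P(2) by (simp add: symmetric_op_def X_def cinner_simps)
  have "norm (X x) \<le> q * norm x" for x
  proof (rule symmetric_op_numerical_bound[OF symX complex_vector.subspace_UNIV])
    fix x :: 'a
    have "Re (cinner (P x) x) \<le> norm (P x) * norm x" using Re_Cauchy_Schwarz abs_le_D1 by blast
    also have "\<dots> \<le> onorm P * norm x * norm x" by (intro mult_right_mono bounded_op_le P) auto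
    also have "\<dots> \<le> K * (norm x)\<^sup>2" using c by (simp add: K_def power2_eq_square algebra_simps)
    finally have "Re (cinner (P x) x) / K \<le> (norm x)\<^sup>2" using K by (simp add: field_simps)
    moreover have "c / K * (norm x)\<^sup>2 \<le> Re (cinner (P x) x) / K"
      using low[of x] K by (simp add: divide_right_mono)
    moreover have "Re (cinner (X x) x) = (norm x)\<^sup>2 - Re (cinner (P x) x) / K"
      by (simp add: X_def cinner_simps cinner_self)
    ultimately show "\<bar>Re (cinner (X x) x)\<bar> \<le> q * (norm x)\<^sup>2" by (simp add: q_def algebra_simps)
  qed auto
  then obtain Y where Y: "symmetric_op Y" "\<And>x. norm (Y x) \<le> q * norm x"
      "\<And>x. Y x = (1/2) *\<^sub>R (X x + Y (Y x))"
    using symmetric_fixed_point[OF symX q] by blast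
  define S where "S x = sqrt K *\<^sub>R (x - Y x)" for x
  have symS: "symmetric_op S" using Y(1) by (simp add: symmetric_op_def S_def cinner_simps)
  have "norm (S x) \<le> sqrt K * (1 + q) * norm x" for x
  proof -
    have "norm (x - Y x) \<le> (1 + q) * norm x"
      using norm_triangle_ineq4[of x "Y x"] Y(2)[of x] by (simp add: algebra_simps)
    then show ?thesis using K by (simp add: S_def mult_left_mono mult.assoc)
  qed
  with symS have "bounded_op S" by (rule symmetric_bounded_op)
  moreover have "positive_on UNIV S"
  proof (rule symmetric_positive_onI[OF symS])
    fix x
    have "Re (cinner (Y x) x) \<le> norm (Y x) * norm x" using Re_Cauchy_Schwarz abs_le_D1 by blast
    also have "\<dots> \<le> q * norm x * norm x" by (intro mult_right_mono Y) auto
    also have "\<dots> \<le> (norm x)\<^sup>2"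
      using q by (simp add: power2_eq_square mult_left_le_one_le mult.assoc)
    finally show "0 \<le> Re (cinner (S x) x)" using K by (simp add: S_def cinner_simps cinner_self)
  qed
  moreover have "S (S x) = P x" for x
  proof -
    have "S (S x) = (sqrt K * sqrt K) *\<^sub>R (x - 2 *\<^sub>R Y x + Y (Y x))"
      by (simp add: S_def symmetric_op_scaleR[OF Y(1)] symmetric_op_diff[OF Y(1)] scaleR_2
          scaleR_diff_right scaleR_add_right)
    also have "2 *\<^sub>R Y x = X x + Y (Y x)" by (subst Y(3)) simp
    also have "x - (X x + Y (Y x)) + Y (Y x) = (1 / K) *\<^sub>R P x" by (simp add: X_def)
    finally show ?thesis using K by simp
  qed
  ultimately show ?thesis by blast
qed

text \<open>Adding \<open>h n\<close> times the identity makes \<open>P\<close> strictly positive.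
  The stability bound \<open>positive_square_diff_bound\<close> shows that the roots of these
  perturbations form a Cauchy sequence as \<open>h n\<close> tends to 0.\<close>

lemma positive_sqrt_exists:
  fixes P :: "'a::chilbert_space \<Rightarrow> 'a"
  assumes P: "bounded_op P" "positive_on UNIV P"
  shows "\<exists>S. bounded_op S \<and> positive_on UNIV S \<and> (\<forall>x. S (S x) = P x)"
proof -
  have symP: "symmetric_op P" by (rule positive_symmetric[OF P])
  define h where "h n = 1 / real (Suc n)" for n
  define Q where "Q n x = P x + h n *\<^sub>R x" for n x
  have "\<exists>S. bounded_op S \<and> positive_on UNIV S \<and> (\<forall>x. S (S x) = Q n x)" for n
  proof (rule strictly_positive_sqrt)
    show "symmetric_op (Q n)" using symP by (simp add: symmetric_op_def Q_def cinner_simps)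
    show "bounded_op (Q n)"
      using bounded_op_minus_scaleC[OF P(1), of "- complex_of_real (h n)"]
      by (simp add: Q_def[abs_def] complex_vector.scale_minus_left scaleC_of_real)
    show "h n > 0" by (simp add: h_def)
    show "h n * (norm x)\<^sup>2 \<le> Re (cinner (Q n x) x)" for x
      using positive_onD[OF P(2), of x] by (simp add: Q_def cinner_simps cinner_self)
  qed
  then obtain S where S: "\<And>n. bounded_op (S n)" "\<And>n. positive_on UNIV (S n)" "\<And>n x. S n (S n x) = Q n x"
    by metis
  have symS: "symmetric_op (S n)" for n using S positive_symmetric by blast
  have h0: "h \<longlonglongrightarrow> 0" unfolding h_def using LIMSEQ_Suc[OF lim_1_over_n] by simp
  have diff: "norm (S m x - S n x) \<le> sqrt \<bar>h m - h n\<bar> * norm x" for m n x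
    by (rule positive_square_diff_bound[OF S(1,2) S(1,2)])
      (auto simp: S(3) Q_def simp flip: scaleR_diff_left)
  have "Cauchy (\<lambda>n. S n x)" for x
  proof (cases "x = 0")
    case True
    have "S n 0 = 0" for n using bounded_op_zero[OF S(1)] by simp
    then show ?thesis using True by (simp add: convergent_Cauchy convergent_const)
  next
    case False
    show ?thesis
    proof (rule metric_CauchyI)
      fix e :: real assume e: "0 < e"
      have "Cauchy h" using h0 LIMSEQ_imp_Cauchy by blast
      then obtain N where N: "\<And>m n. m \<ge> N \<Longrightarrow> n \<ge> N \<Longrightarrow> dist (h m) (h n) < (e / norm x)\<^sup>2"
        using metric_CauchyD[of h "(e / norm x)\<^sup>2"] e False by auto
      show "\<exists>M. \<forall>m\<ge>M. \<forall>n\<ge>M. dist (S m x) (S n x) < e"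
      proof (intro exI allI impI)
        fix m n assume "N \<le> m" "N \<le> n"
        then have "sqrt \<bar>h m - h n\<bar> < e / norm x"
          using N[of m n] e by (intro real_less_lsqrt) (auto simp: dist_real_def)
        then have "sqrt \<bar>h m - h n\<bar> * norm x < e" using False by (simp add: field_simps)
        then show "dist (S m x) (S n x) < e" using diff[of m x n] by (simp add: dist_norm)
      qed
    qed
  qed
  then have "\<forall>x. \<exists>l. (\<lambda>n. S n x) \<longlonglongrightarrow> l"
    using Cauchy_convergent convergent_def by blast
  from choice[OF this] obtain R where R: "\<And>x. (\<lambda>n. S n x) \<longlonglongrightarrow> R x"
    by blast
  have symR: "symmetric_op R" unfolding symmetric_op_def
  proof (intro allI)
    fix x y
    have "(\<lambda>n. cinner (S n x) y) \<longlonglongrightarrow> cinner (R x) y" "(\<lambda>n. cinner x (S n y)) \<longlonglongrightarrow> cinner x (R y)"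
      by (intro tendsto_cinner tendsto_const R)+
    then show "cinner (R x) y = cinner x (R y)"
      using symS by (simp add: symmetric_opD LIMSEQ_unique)
  qed
  \<comment> \<open>Pointwise convergence is enough: moving one factor \<open>S n\<close> across the
    inner product leaves a pairing of two convergent sequences of vectors.\<close>
  have RR: "R (R x) = P x" for x
  proof (rule cinner_eqI)
    fix u
    have "(\<lambda>n. cinner (S n u) (S n x)) \<longlonglongrightarrow> cinner (R u) (R x)" by (intro tendsto_cinner R)
    moreover have "(\<lambda>n. cinner u (P x + h n *\<^sub>R x)) \<longlonglongrightarrow> cinner u (P x + 0 *\<^sub>R x)"
      by (intro tendsto_cinner tendsto_intros h0)
    moreover have "cinner (S n u) (S n x) = cinner u (P x + h n *\<^sub>R x)" for n
      using symmetric_opD[OF symS, of n u] S(3)[of n x] by (simp add: Q_def)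
    ultimately have "cinner (R u) (R x) = cinner u (P x)" by (simp add: LIMSEQ_unique)
    then show "cinner u (R (R x)) = cinner u (P x)" using symmetric_opD[OF symR, of u "R x"] by simp
  qed
  have "norm (R x) \<le> sqrt (onorm P) * norm x" for x
  proof -
    have "(norm (R x))\<^sup>2 = Re (cinner (P x) x)"
      using symmetric_opD[OF symR, of "R x" x] by (simp add: RR flip: Re_cinner_self)
    also have "\<dots> \<le> norm (P x) * norm x" using Re_Cauchy_Schwarz abs_le_D1 by blast
    also have "\<dots> \<le> onorm P * norm x * norm x" by (intro mult_right_mono bounded_op_le P) auto
    finally show ?thesis
      using real_le_rsqrt[of "norm (R x)" "onorm P * (norm x)\<^sup>2"]
      by (simp add: real_sqrt_mult power2_eq_square mult.assoc)
  qed
  with symR have "bounded_op R" by (rule symmetric_bounded_op)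
  moreover have "positive_on UNIV R"
  proof (rule symmetric_positive_onI[OF symR])
    fix x
    have "(\<lambda>n. Re (cinner (S n x) x)) \<longlonglongrightarrow> Re (cinner (R x) x)"
      by (intro tendsto_intros tendsto_cinner R)
    then show "0 \<le> Re (cinner (R x) x)"
      by (rule LIMSEQ_le_const) (use positive_onD[OF S(2)] in auto)
  qed
  ultimately show ?thesis using RR by blast
qed

lemma op_sqrt:
  fixes P :: "'a::chilbert_space \<Rightarrow> 'a"
  assumes P: "bounded_op P" "positive_on UNIV P"
  shows "bounded_op (op_sqrt P) \<and> positive_on UNIV (op_sqrt P) \<and> op_sqrt P \<circ> op_sqrt P = P"
proof -
  obtain S where S: "bounded_op S" "positive_on UNIV S" "S \<circ> S = P"
    using positive_sqrt_exists[OF P] by (auto simp: fun_eq_iff)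
  have "\<exists>!S. bounded_op S \<and> positive_on UNIV S \<and> S \<circ> S = P"
  proof (rule ex1I[of _ S])
    fix R assume R: "bounded_op R \<and> positive_on UNIV R \<and> R \<circ> R = P"
    have "S (S x) = R (R x)" for x using S(3) R by (metis comp_apply)
    \<comment> \<open>The stability bound with \<open>K = 0\<close> is the uniqueness of the
      positive square root.\<close>
    then have "norm (R x - S x) \<le> sqrt 0 * norm x" for x
      using R S by (intro positive_square_diff_bound) auto
    then show "R = S" by (auto simp: fun_eq_iff)
  qed (use S in blast)
  from theI'[OF this] show ?thesis unfolding op_sqrt_def .
qed

context
  fixes T :: "'a::chilbert_space \<Rightarrow> 'a"
  assumes T: "bounded_op T"
begin

lemma abs_op: "bounded_op (abs_op T) \<and> positive_on UNIV (abs_op T) \<and> abs_op T \<circ> abs_op T = adj T \<circ> T"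
  unfolding abs_op_def
proof (rule op_sqrt)
  show "bounded_op (adj T \<circ> T)"
    using bounded_op_comp[OF bounded_op_adj[OF T] T] by (simp add: comp_def)
  have "symmetric_op (adj T \<circ> T)" using symmetric_adj_comp[OF T] by (simp add: comp_def)
  then show "positive_on UNIV (adj T \<circ> T)"
    by (rule symmetric_positive_onI) (simp add: cinner_adj_left[OF T] cinner_self)
qed

lemma bounded_op_abs: "bounded_op (abs_op T)" using abs_op by blast

lemma symmetric_abs: "symmetric_op (abs_op T)" using abs_op positive_symmetric by blast

lemma abs_op_nonneg: "0 \<le> Re (cinner (abs_op T x) x)" using abs_op positive_onD by blast

lemma abs_op_abs_op: "abs_op T (abs_op T x) = adj T (T x)" using abs_op by (metis comp_apply)

lemma norm_abs_op: "norm (abs_op T x) = norm (T x)"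
proof -
  have "cinner (abs_op T x) (abs_op T x) = cinner (T x) (T x)"
    using symmetric_opD[OF symmetric_abs, of "abs_op T x" x]
    by (simp add: abs_op_abs_op cinner_adj_left[OF T])
  then show ?thesis by (simp add: cinner_self flip: of_real_power)
qed

end

section \<open>The essential modulus of a limit of absolutely norm attaining operators\<close>

lemma AN_bounded_op: "S \<in> AN \<Longrightarrow> bounded_op S"
  by (simp add: AN_def)

lemma onorm_on_upper:
  assumes S: "bounded_op S" and y: "y \<in> M"
  shows "norm (S y) \<le> onorm_on M S * norm y"
proof (cases "y = 0")
  case True
  then show ?thesis by (simp add: bounded_op_zero[OF S])
next
  case False
  have "bdd_above ((\<lambda>x. norm (S x) / norm x) ` M)"
  proof (rule bdd_aboveI)
    fix r assume "r \<in> (\<lambda>x. norm (S x) / norm x) ` M"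
    then obtain x where "r = norm (S x) / norm x" by blast
    then show "r \<le> onorm S"
      using bounded_op_le[OF S, of x] onorm_pos_le[OF bounded_op_bounded_linear[OF S]]
      \<comment> \<open>At \<open>x = 0\<close> the quotient is \<open>0 / 0 = 0\<close>, so it
        stays below \<open>onorm S\<close> as well.\<close>
      by (cases "x = 0") (auto simp: divide_le_eq)
  qed
  then have "norm (S y) / norm y \<le> onorm_on M S"
    unfolding onorm_on_def using y by (intro cSUP_upper)
  then show ?thesis using False by (simp add: field_simps)
qed

text \<open>Intermediate value theorem along the segment from \<open>f\<close> to \<open>e\<close>,
  comparing \<open>norm (S p)\<close> with \<open>v * norm p\<close> so that \<open>p\<close> need
  not be normalized beforehand. The crossing point is nonzero: a segment between unit vectors meets
  0 only if \<open>f = - e\<close>, but then \<open>S f\<close> and \<open>S e\<close> would have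
  equal norm.\<close>

lemma intermediate_modulus:
  fixes S :: "'a::complex_inner \<Rightarrow> 'a"
  assumes S: "bounded_op S" and M: "csubspace M" and e: "e \<in> M" "norm e = 1" "v \<le> norm (S e)"
    and f: "f \<in> M" "norm f = 1" "norm (S f) < v"
  shows "\<exists>g\<in>M. norm g = 1 \<and> norm (S g) = v"
proof -
  have v0: "v \<ge> 0" using f norm_ge_zero[of "S f"] by linarith
  define p where "p t = f + t *\<^sub>R (e - f)" for t :: real
  define h where "h t = norm (S (p t)) - v * norm (p t)" for t
  have "continuous_on {0..1} p" unfolding p_def by (intro continuous_intros)
  moreover from this have "continuous_on {0..1} (\<lambda>t. S (p t))"
    by (rule bounded_linear.continuous_on[OF bounded_op_bounded_linear[OF S]])
  ultimately have cont: "continuous_on {0..1} h"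
    unfolding h_def by (intro continuous_on_diff continuous_on_mult continuous_on_const continuous_on_norm)
  have "h 0 < 0" "0 \<le> h 1" using e f by (auto simp: h_def p_def)
  then obtain t where t: "0 \<le> t" "t \<le> 1" "h t = 0"
    using IVT'[of h 0 0 1] cont by auto
  have nz: "p t \<noteq> 0"
  proof
    assume p0: "p t = 0"
    then have eq: "(1 - t) *\<^sub>R f = - t *\<^sub>R e" by (simp add: p_def algebra_simps)
    then have "norm ((1 - t) *\<^sub>R f) = norm (- t *\<^sub>R e)" by metis
    then have "1 - t = t" using t e f by simp
    then have t2: "t = 1/2" by simp
    have "(1/2) *\<^sub>R f = (1/2) *\<^sub>R (- e)" using eq unfolding t2 by simp
    then have "f = - e" by (simp only: scaleR_cancel_left) simp
    then have "S f = - S e" using bounded_op_diff[OF S, of 0 e] by (simp add: bounded_op_zero[OF S])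
    then show False using e f by simp
  qed
  define g where "g = (1 / norm (p t)) *\<^sub>R p t"
  have "p t \<in> M" unfolding p_def using M e f
    by (intro complex_vector.subspace_add csubspace_scaleR complex_vector.subspace_diff)
  then have "g \<in> M" unfolding g_def using M by (rule csubspace_scaleR[rotated])
  moreover have "norm g = 1" using nz by (simp add: g_def)
  moreover have "norm (S g) = v"
    using t(3) nz by (simp add: g_def bounded_op_scaleR[OF S] h_def)
  ultimately show ?thesis by blast
qed

text \<open>If the essential upper and lower moduli of \<open>S\<close> differ, there are orthonormal \<open>g\<^sub>n\<close> with
  \<open>S g\<^sub>n\<close> orthogonal and \<open>\<parallel>S g\<^sub>n\<parallel>\<close> strictly increasing; \<open>S\<close> does not attain its norm on their
  closed span.\<close>

lemma AN_no_essential_gap: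
  fixes S :: "'a::chilbert_space \<Rightarrow> 'a"
  assumes S: "S \<in> AN"
    and up: "\<And>F. finite F \<Longrightarrow> \<exists>x\<in>orth F. norm x = 1 \<and> d < norm (S x)"
    and dn: "\<And>F. finite F \<Longrightarrow> \<exists>x\<in>orth F. norm x = 1 \<and> norm (S x) < c"
  shows "d \<le> c"
proof (rule ccontr)
  assume "\<not> d \<le> c"
  then have cd: "c < d" by simp
  have bS: "bounded_op S" using S by (rule AN_bounded_op)
  define P where "P x = adj S (S x)" for x
  have symP: "symmetric_op P" unfolding P_def by (rule symmetric_adj_comp[OF bS])
  have PS: "cinner (P x) x = complex_of_real ((norm (S x))\<^sup>2)" for x
    by (simp add: P_def cinner_adj_left[OF bS] cinner_self)
  \<comment> \<open>The levels start at \<open>v 0 = c\<close> and increase strictly towards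
    \<open>d\<close> without reaching it.\<close>
  define v where "v n = d - (d - c) / real (Suc n)" for n
  have vlt: "v n < d" "c \<le> v n" and vmono: "v n < v (Suc n)" for n
  proof -
    show "v n < d" using cd by (simp add: v_def)
    have "(d - c) / real (Suc n) \<le> d - c" using cd by (intro divide_left_mono[of 1, simplified]) auto
    then show "c \<le> v n" by (simp add: v_def)
    show "v n < v (Suc n)" unfolding v_def
      using cd by (intro diff_strict_left_mono divide_strict_left_mono) auto
  qed
  have step: "\<exists>g. g \<in> orth F \<and> norm g = 1 \<and> norm (S g) = v n" if F: "finite F" for F n
  proof -
    obtain e f where e: "e \<in> orth F" "norm e = 1" "d < norm (S e)"
      and f: "f \<in> orth F" "norm f = 1" "norm (S f) < c"
      using up[OF F] dn[OF F] by blast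
    have "v n \<le> norm (S e)" "norm (S f) < v n" using vlt[of n] e f by linarith+
    then show ?thesis
      using intermediate_modulus[OF bS csubspace_orth e(1,2) _ f(1,2)] by blast
  qed
  \<comment> \<open>Each new vector is also orthogonal to the earlier \<open>P (g k)\<close>. As
    \<open>cinner (S x) (S y) = cinner x (P y)\<close>, this makes the images \<open>S (g n)\<close>
    orthogonal too.\<close>
  have "\<exists>g. \<forall>n. g n \<in> orth (g ` {..<n} \<union> P ` g ` {..<n}) \<and> norm (g n) = 1 \<and> norm (S (g n)) = v n"
  proof (rule dependent_wellorder_choice)
    show "(r \<in> orth (f ` {..<n} \<union> P ` f ` {..<n}) \<and> norm r = 1 \<and> norm (S r) = v n) =
      (r \<in> orth (g ` {..<n} \<union> P ` g ` {..<n}) \<and> norm r = 1 \<and> norm (S r) = v n)"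
      if "\<And>y. y < n \<Longrightarrow> f y = g y" for r f g and n :: nat
    proof -
      have "f ` {..<n} = g ` {..<n}" using that by (intro image_cong) auto
      then show ?thesis by simp
    qed
  qed (rule step, simp)
  then obtain g where g: "\<And>n. g n \<in> orth (g ` {..<n} \<union> P ` g ` {..<n})"
    "\<And>n. norm (g n) = 1" "\<And>n. norm (S (g n)) = v n" by blast
  have orth1: "cinner (g m) (g n) = 0" "cinner (g m) (P (g n)) = 0" if "n < m" for m n
    using g(1)[of m] that by (auto intro!: orthD[OF g(1)[of m]])
  have gg: "cinner (g m) (g n) = 0" if "m \<noteq> n" for m n
    using orth1(1)[of m n] orth1(1)[of n m] that cinner_eq_0_commute[of "g m"] by (meson linorder_neqE_nat)
  have gP: "cinner (g m) (P (g n)) = 0" if "m \<noteq> n" for m n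
  proof (cases "n < m")
    case False
    then have "cinner (g n) (P (g m)) = 0" using that by (intro orth1) auto
    then show ?thesis
      using symmetric_opD[OF symP, of "g m" "g n"] cinner_eq_0_commute by metis
  qed (rule orth1(2))
  define M where "M = closure (cspan (range g))"
  have M: "closed_csubspace M" unfolding M_def by (rule closed_csubspace_closure_span)
  have gM: "g n \<in> M" for n
    unfolding M_def by (intro closure_subset[THEN subsetD] complex_vector.span_base) auto
  have "g 0 \<noteq> 0" using g(2)[of 0] by auto
  then have "M \<noteq> {0}" using gM[of 0] by auto
  then obtain x where x: "x \<in> M" "norm x = 1" "norm (S x) = onorm_on M S"
    using S M unfolding AN_def norm_attaining_on_def by blast
  define s where "s = onorm_on M S"
  have sv: "v n < s" for n
    using onorm_on_upper[OF bS gM[of "Suc n"]] g(2,3)[of "Suc n"] vmono[of n] by (simp add: s_def)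
  have v0: "0 \<le> v n" for n using g(3)[of n] norm_ge_zero[of "S (g n)"] by simp
  \<comment> \<open>The form of \<open>Q\<close> is nonnegative on \<open>M\<close> and vanishes at
    the maximizer \<open>x\<close>, so Cauchy-Schwarz makes \<open>Q x\<close> orthogonal to every
    \<open>g n\<close>.\<close>
  define Q where "Q y = (s\<^sup>2) *\<^sub>R y - P y" for y
  have symQ: "symmetric_op Q" using symP by (simp add: symmetric_op_def Q_def cinner_simps)
  have Qq: "Re (cinner (Q y) y) = s\<^sup>2 * (norm y)\<^sup>2 - (norm (S y))\<^sup>2" for y
    by (simp add: Q_def cinner_diff_left cinner_scaleR_left cinner_self PS)
  have Qpos: "0 \<le> Re (cinner (Q y) y)" if "y \<in> M" for y
    using power_mono[OF onorm_on_upper[OF bS that] norm_ge_zero, of 2]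
    by (simp add: Qq s_def power_mult_distrib)
  have "cinner x (g n) = 0" for n
  proof -
    have "(cmod (cinner (Q x) (g n)))\<^sup>2 \<le> Re (cinner (Q x) x) * Re (cinner (Q (g n)) (g n))"
      by (rule semidefinite_Cauchy_Schwarz[OF symQ closed_csubspaceD(1)[OF M] Qpos x(1) gM])
    moreover have "Re (cinner (Q x) x) = 0" using x by (simp add: Qq s_def)
    ultimately have "cinner (Q x) (g n) = 0" by simp
    then have 1: "complex_of_real (s\<^sup>2) * cinner x (g n) = cinner x (P (g n))"
      using symmetric_opD[OF symP, of x "g n"] by (simp add: Q_def cinner_simps)
    \<comment> \<open>Compressed to \<open>M\<close>, \<open>P\<close> is diagonal:
      \<open>g n\<close> is an eigenvector with value \<open>(v n)\<^sup>2\<close>, strictly below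
      \<open>s\<^sup>2\<close>. A maximizer in \<open>M\<close> is therefore orthogonal to every
      \<open>g n\<close>.\<close>
    have "P (g n) - ((v n)\<^sup>2) *\<^sub>R g n \<in> orth (range g)"
    proof (rule orthI, clarify)
      fix m
      show "cinner (P (g n) - ((v n)\<^sup>2) *\<^sub>R g n) (g m) = 0"
      proof (cases "m = n")
        case True
        then show ?thesis using g(2,3)[of n] by (simp add: cinner_simps PS cinner_self)
      next
        case False
        then have "cinner (P (g n)) (g m) = 0" using gP[of m n] cinner_eq_0_commute by metis
        then show ?thesis using gg[of n m] False by (simp add: cinner_simps)
      qed
    qed
    then have "P (g n) - ((v n)\<^sup>2) *\<^sub>R g n \<in> orth M" by (simp add: M_def orth_closure_span)
    then have "cinner x (P (g n) - ((v n)\<^sup>2) *\<^sub>R g n) = 0" using x(1) by (rule orthD2)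
    with 1 have "complex_of_real (s\<^sup>2 - (v n)\<^sup>2) * cinner x (g n) = 0"
      by (simp add: cinner_simps algebra_simps)
    moreover have "(v n)\<^sup>2 < s\<^sup>2" using sv v0 by (intro power_strict_mono) auto
    ultimately show ?thesis by (simp del: of_real_diff of_real_power)
  qed
  then have "x \<in> orth (range g)" by (auto intro: orthI)
  then have "x \<in> orth M" by (simp add: M_def orth_closure_span)
  with x(1) have "x = 0" by (rule in_orth_self)
  then show False using x(2) by simp
qed

text \<open>An approximant within a third of the gap shifts each of its two ends by less than a
  third, so the approximant would still have a positive gap.\<close>

lemma norm_closure_AN_no_essential_gap:
  fixes T :: "'a::chilbert_space \<Rightarrow> 'a"
  assumes T: "T \<in> norm_closure AN"
    and up: "\<And>F. finite F \<Longrightarrow> \<exists>x\<in>orth F. norm x = 1 \<and> d < norm (T x)"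
    and dn: "\<And>F. finite F \<Longrightarrow> \<exists>x\<in>orth F. norm x = 1 \<and> norm (T x) < c"
  shows "d \<le> c"
proof (rule ccontr)
  assume "\<not> d \<le> c"
  then have e: "(d - c) / 3 > 0" by simp
  then obtain S where S: "S \<in> AN" "onorm (\<lambda>x. T x - S x) < (d - c) / 3"
    using T unfolding norm_closure_def by blast
  have "bounded_op T" using T by (simp add: norm_closure_def)
  then have bl: "bounded_linear (\<lambda>x. T x - S x)"
    using AN_bounded_op[OF S(1)] by (intro bounded_linear_sub bounded_op_bounded_linear)
  have close: "norm (T x - S x) < (d - c) / 3" if "norm x = 1" for x
    using onorm[OF bl, of x] S(2) that by simp
  have "d - (d - c) / 3 \<le> c + (d - c) / 3"
  proof (rule AN_no_essential_gap[OF S(1)])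
    fix F :: "'a set" assume F: "finite F"
    obtain x where x: "x \<in> orth F" "norm x = 1" "d < norm (T x)" using up[OF F] by blast
    have "norm (T x) - norm (S x) \<le> norm (T x - S x)" by (rule norm_triangle_ineq2)
    then have "d - (d - c) / 3 < norm (S x)" using x(3) close[OF x(2)] by linarith
    then show "\<exists>x\<in>orth F. norm x = 1 \<and> d - (d - c) / 3 < norm (S x)" using x by blast
    obtain y where y: "y \<in> orth F" "norm y = 1" "norm (T y) < c" using dn[OF F] by blast
    have "norm (S y) - norm (T y) \<le> norm (T y - S y)" by (metis norm_triangle_ineq2 norm_minus_commute)
    then have "norm (S y) < c + (d - c) / 3" using y(3) close[OF y(2)] by linarith
    then show "\<exists>x\<in>orth F. norm x = 1 \<and> norm (S x) < c + (d - c) / 3" using y by blast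
  qed
  moreover have "d - c = 3 * ((d - c) / 3)" by simp
  ultimately show False using e by linarith
qed

section \<open>The essential modulus and compactness of |T| minus a scalar\<close>

lemma exists_unit_below:
  assumes T: "bounded_op T" and M: "csubspace M"
    and x: "x \<in> M" "\<not> r * norm x \<le> norm (T x)"
  shows "\<exists>y\<in>M. norm y = 1 \<and> norm (T y) < r"
proof -
  have "x \<noteq> 0" using x by (auto simp: bounded_op_zero[OF T])
  then show ?thesis using x csubspace_scaleR[OF M x(1), of "1 / norm x"]
    by (intro bexI[of _ "(1 / norm x) *\<^sub>R x"]) (auto simp: bounded_op_scaleR[OF T] field_simps)
qed

lemma exists_unit_above:
  assumes T: "bounded_op T" and M: "csubspace M"
    and x: "x \<in> M" "\<not> norm (T x) \<le> r * norm x"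
  shows "\<exists>y\<in>M. norm y = 1 \<and> r < norm (T y)"
proof -
  have "x \<noteq> 0" using x by (auto simp: bounded_op_zero[OF T])
  then show ?thesis using x csubspace_scaleR[OF M x(1), of "1 / norm x"]
    by (intro bexI[of _ "(1 / norm x) *\<^sub>R x"]) (auto simp: bounded_op_scaleR[OF T] field_simps)
qed

text \<open>\<open>\<alpha>\<close> is the infimum of the upper bounds of \<open>T\<close> on
  complements of finite sets, so upper estimates are built in. A lower estimate that failed on every
  such complement would be an essential gap.\<close>

lemma essential_modulus_exists:
  fixes T :: "'a::chilbert_space \<Rightarrow> 'a"
  assumes inf: "\<not> finite_cdim (UNIV :: 'a set)" and T: "T \<in> norm_closure AN"
  shows "\<exists>\<alpha>\<ge>0. \<forall>e>0. \<exists>F. finite F \<and> (\<forall>x\<in>orth F. \<bar>norm (T x) - \<alpha> * norm x\<bar> \<le> e * norm x)"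
proof -
  have bT: "bounded_op T" using T by (simp add: norm_closure_def)
  define U where "U = {r. \<exists>F. finite F \<and> (\<forall>x\<in>orth F. norm (T x) \<le> r * norm x)}"
  have "onorm T \<in> U" unfolding U_def using bounded_op_le[OF bT] by blast
  then have ne: "U \<noteq> {}" by auto
  have low: "0 \<le> r" if r: "r \<in> U" for r
  proof -
    obtain F where F: "finite F" "\<forall>x\<in>orth F. norm (T x) \<le> r * norm x" using r by (auto simp: U_def)
    obtain x where "x \<in> orth F" "norm x = 1" using orth_finite_nonzero[OF inf F(1)] by blast
    then show ?thesis using F(2) norm_ge_zero order_trans by (metis mult.right_neutral)
  qed
  have bdd: "bdd_below U" using low by (intro bdd_belowI[of U 0]) auto
  define \<alpha> where "\<alpha> = Inf U"
  have a0: "\<alpha> \<ge> 0" unfolding \<alpha>_def using ne low by (intro cInf_greatest) auto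
  have "\<exists>F. finite F \<and> (\<forall>x\<in>orth F. \<bar>norm (T x) - \<alpha> * norm x\<bar> \<le> e * norm x)" if e: "e > 0" for e
  proof -
    obtain r where r: "r \<in> U" "r < \<alpha> + e"
      using cInf_lessD[OF ne, of "\<alpha> + e"] e by (auto simp: \<alpha>_def)
    obtain F1 where F1: "finite F1" "\<And>x. x \<in> orth F1 \<Longrightarrow> norm (T x) \<le> r * norm x"
      using r(1) by (auto simp: U_def)
    have "\<exists>F. finite F \<and> (\<forall>x\<in>orth F. (\<alpha> - e) * norm x \<le> norm (T x))"
    proof (rule ccontr)
      assume no: "\<not> ?thesis"
      \<comment> \<open>Half of \<open>e\<close> separates the two levels: values above
        \<open>\<alpha> - e / 2\<close> and values below \<open>\<alpha> - e\<close> would both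
        occur on every complement of a finite set.\<close>
      have "\<alpha> - e / 2 \<notin> U"
      proof
        assume "\<alpha> - e / 2 \<in> U"
        from cInf_lower[OF this bdd] show False using e by (simp add: \<alpha>_def)
      qed
      then have "\<exists>x\<in>orth F. norm x = 1 \<and> \<alpha> - e / 2 < norm (T x)" if "finite F" for F
        using that exists_unit_above[OF bT csubspace_orth] unfolding U_def by blast
      moreover have "\<exists>x\<in>orth F. norm x = 1 \<and> norm (T x) < \<alpha> - e" if "finite F" for F
        using that no exists_unit_below[OF bT csubspace_orth] by blast
      ultimately have "\<alpha> - e / 2 \<le> \<alpha> - e" by (rule norm_closure_AN_no_essential_gap[OF T])
      then show False using e by simp
    qed
    then obtain F2 where F2: "finite F2" "\<And>x. x \<in> orth F2 \<Longrightarrow> (\<alpha> - e) * norm x \<le> norm (T x)" by blast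
    have "\<bar>norm (T x) - \<alpha> * norm x\<bar> \<le> e * norm x" if x: "x \<in> orth (F1 \<union> F2)" for x
    proof -
      have "norm (T x) \<le> r * norm x" "(\<alpha> - e) * norm x \<le> norm (T x)"
        using F1(2) F2(2) x by (auto simp: orth_Un)
      moreover have "r * norm x \<le> (\<alpha> + e) * norm x" using r(2) by (intro mult_right_mono) auto
      ultimately show ?thesis by (simp add: algebra_simps abs_le_iff)
    qed
    then show ?thesis using F1(1) F2(1) by (intro exI[of _ "F1 \<union> F2"]) auto
  qed
  then show ?thesis using a0 by blast
qed

text \<open>The form of the square of |T| minus \<open>\<alpha>\<^sup>2\<close> is a difference of
  squared norms, which the modulus estimate controls directly. To come down from squares, divide by
  |T| plus \<open>\<alpha>\<close>, which is at least \<open>\<alpha>\<close> when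
  \<open>\<alpha> > 0\<close>; for \<open>\<alpha> = 0\<close> the form of the square is itself the
  squared norm of |T|.\<close>

lemma compact_abs_op_minus:
  fixes T :: "'a::chilbert_space \<Rightarrow> 'a"
  assumes T: "bounded_op T" and a0: "\<alpha> \<ge> 0"
    and mod: "\<And>e. e > 0 \<Longrightarrow> \<exists>F. finite F \<and> (\<forall>x\<in>orth F. \<bar>norm (T x) - \<alpha> * norm x\<bar> \<le> e * norm x)"
  shows "compact_op (\<lambda>x. abs_op T x - \<alpha> *\<^sub>R x)"
proof -
  define R where "R = abs_op T"
  have bR: "bounded_op R" and symR: "symmetric_op R" and posR: "\<And>x. 0 \<le> Re (cinner (R x) x)"
    and nR: "\<And>x. norm (R x) = norm (T x)"
    unfolding R_def using T by (auto simp: bounded_op_abs symmetric_abs abs_op_nonneg norm_abs_op)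
  define Q where "Q x = R (R x) - (\<alpha>\<^sup>2) *\<^sub>R x" for x
  have symQ: "symmetric_op Q" using symR by (simp add: symmetric_op_def Q_def cinner_simps)
  have cQ: "\<exists>F. finite F \<and> (\<forall>x\<in>orth F. norm (Q x) \<le> e * norm x)" if e: "e > 0" for e
  proof -
    \<comment> \<open>\<open>K\<close> bounds the factor
      \<open>norm (T x) + \<alpha> * norm x\<close> for unit \<open>x\<close>; the added 1 keeps it
      positive for the division \<open>e / K\<close>.\<close>
    define K where "K = onorm T + \<alpha> + 1"
    have K: "K > 0" using a0 onorm_pos_le[OF bounded_op_bounded_linear[OF T]] by (simp add: K_def)
    obtain F where F: "finite F" "\<And>x. x \<in> orth F \<Longrightarrow> \<bar>norm (T x) - \<alpha> * norm x\<bar> \<le> e / K * norm x"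
      using mod[of "e / K"] e K by auto
    have q: "\<bar>Re (cinner (Q x) x)\<bar> \<le> e * (norm x)\<^sup>2" if x: "x \<in> orth F" for x
    proof -
      have "Re (cinner (Q x) x) = (norm (T x))\<^sup>2 - (\<alpha> * norm x)\<^sup>2"
        using symmetric_opD[OF symR, of "R x" x]
        by (simp add: Q_def cinner_diff_left cinner_scaleR_left cinner_self nR power_mult_distrib)
      also have "\<dots> = (norm (T x) - \<alpha> * norm x) * (norm (T x) + \<alpha> * norm x)"
        by (simp add: power2_eq_square algebra_simps)
      finally have "\<bar>Re (cinner (Q x) x)\<bar> = \<bar>norm (T x) - \<alpha> * norm x\<bar> * (norm (T x) + \<alpha> * norm x)"
        using a0 by (simp add: abs_mult)
      also have "\<dots> \<le> (e / K * norm x) * (K * norm x)"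
      proof (rule mult_mono[OF F(2)[OF x]])
        show "norm (T x) + \<alpha> * norm x \<le> K * norm x"
          using bounded_op_le[OF T, of x] norm_ge_zero[of x] by (simp only: K_def distrib_right)
      qed (use a0 e K in auto)
      also have "\<dots> = e * (norm x)\<^sup>2" using K by (simp add: power2_eq_square)
      finally show ?thesis .
    qed
    \<comment> \<open>Enlarging \<open>F\<close> by its images under \<open>Q\<close> puts
      \<open>Q x\<close> into \<open>orth F\<close>, as \<open>symmetric_op_numerical_bound\<close>
      demands.\<close>
    have "norm (Q x) \<le> e * norm x" if x: "x \<in> orth (F \<union> Q ` F)" for x
    proof (rule symmetric_op_numerical_bound[OF symQ csubspace_orth q])
      show "x \<in> orth F" using x by (simp add: orth_Un)
      show "Q x \<in> orth F"
        using x by (auto intro!: orthI simp: symmetric_opD[OF symQ] orth_def)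
    qed
    then show ?thesis using F(1) by (intro exI[of _ "F \<union> Q ` F"]) auto
  qed
  show ?thesis unfolding compact_op_def R_def[symmetric]
  proof (intro allI impI)
    fix e :: real assume e: "e > 0"
    show "\<exists>F. finite F \<and> (\<forall>x\<in>orth F. norm (R x - \<alpha> *\<^sub>R x) \<le> e * norm x)"
    proof (cases "\<alpha> = 0")
      case True
      obtain F where F: "finite F" "\<And>x. x \<in> orth F \<Longrightarrow> norm (Q x) \<le> e\<^sup>2 * norm x"
        using cQ[of "e\<^sup>2"] e by auto
      have "norm (R x) \<le> e * norm x" if x: "x \<in> orth F" for x
      proof -
        have "(norm (R x))\<^sup>2 = Re (cinner (Q x) x)"
          using True symmetric_opD[OF symR, of "R x" x] by (simp add: Q_def cinner_self)
        also have "\<dots> \<le> norm (Q x) * norm x" using Re_Cauchy_Schwarz abs_le_D1 by blast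
        also have "\<dots> \<le> e\<^sup>2 * norm x * norm x" by (intro mult_right_mono F x) auto
        also have "\<dots> = (e * norm x)\<^sup>2" by (simp add: power2_eq_square)
        finally show ?thesis using e by (simp add: power2_le_iff_abs_le)
      qed
      then show ?thesis using F(1) True by auto
    next
      case False
      then have a: "\<alpha> > 0" using a0 by simp
      obtain F where F: "finite F" "\<And>x. x \<in> orth F \<Longrightarrow> norm (Q x) \<le> (e * \<alpha>) * norm x"
        using cQ[of "e * \<alpha>"] e a by auto
      have "norm (R x - \<alpha> *\<^sub>R x) \<le> e * norm x" if x: "x \<in> orth F" for x
      proof -
        define y where "y = R x - \<alpha> *\<^sub>R x"
        have Qy: "Q x = R y + \<alpha> *\<^sub>R y"
          by (simp add: Q_def y_def bounded_op_diff[OF bR] bounded_op_scaleR[OF bR] scaleR_diff_right power2_eq_square)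
        have "\<alpha> * (norm y)\<^sup>2 \<le> Re (cinner (Q x) y)"
          using posR[of y] by (simp add: Qy cinner_simps cinner_self)
        also have "\<dots> \<le> norm (Q x) * norm y" using Re_Cauchy_Schwarz abs_le_D1 by blast
        also have "\<dots> \<le> e * \<alpha> * norm x * norm y" by (intro mult_right_mono F x) auto
        finally have "\<alpha> * norm y * norm y \<le> \<alpha> * (e * norm x) * norm y"
          by (simp add: power2_eq_square algebra_simps)
        then have "norm y \<le> e * norm x" using a e by (cases "y = 0") auto
        then show ?thesis by (simp add: y_def)
      qed
      then show ?thesis using F(1) by blast
    qed
  qed
qed

section \<open>Spectral structure of compact perturbations of scalars\<close>

lemma norm_sq_orthogonal_sum:
  assumes "finite A" and "\<And>i j. i \<in> A \<Longrightarrow> j \<in> A \<Longrightarrow> i \<noteq> j \<Longrightarrow> cinner (f i) (f j) = 0"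
  shows "(norm (sum f A))\<^sup>2 = (\<Sum>i\<in>A. (norm (f i :: 'a::complex_inner))\<^sup>2)"
  using assms
proof (induction A rule: finite_induct)
  case (insert i A)
  have "cinner (f i) (sum f A) = 0"
    unfolding cinner_sum_right using insert.hyps insert.prems by (intro sum.neutral) auto
  then have "(norm (f i + sum f A))\<^sup>2 = (norm (f i))\<^sup>2 + (norm (sum f A))\<^sup>2" by (rule norm_add_sq_orth)
  then show ?case using insert by auto
qed simp

lemma scaleC_scaleR_commute: "c *\<^sub>C r *\<^sub>R x = r *\<^sub>R c *\<^sub>C x"
  by (simp add: scaleC_scaleC mult.commute flip: scaleC_of_real)

text \<open>\<open>R\<close> stands for |T|. Isolating it from \<open>T\<close> gives the
  diagonalization of a symmetric operator that is a scalar plus a compact one.\<close>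

locale compact_perturbation =
  fixes R :: "'a::chilbert_space \<Rightarrow> 'a" and \<alpha> :: real
  assumes bounded_R: "bounded_op R" and symmetric_R: "symmetric_op R"
    and compact: "compact_op (\<lambda>x. R x - \<alpha> *\<^sub>R x)"
begin

definition eig :: "real \<Rightarrow> 'a set" where
  "eig r = {x. R x = r *\<^sub>R x}"

abbreviation "C x \<equiv> R x - \<alpha> *\<^sub>R x"

lemma eig_eq: "null_space (shift_op R (complex_of_real r)) = eig r"
  by (simp add: null_space_def shift_op_def eig_def scaleC_of_real)

lemma bounded_C: "bounded_op (\<lambda>x. C x)"
  using bounded_op_minus_scaleC[OF bounded_R, of "complex_of_real \<alpha>"] by (simp add: scaleC_of_real)

lemma symmetric_C: "symmetric_op (\<lambda>x. C x)"
  using symmetric_R by (simp add: symmetric_op_def cinner_simps)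

lemma shift_eq: "shift_op R c = (\<lambda>x. C x - (c - complex_of_real \<alpha>) *\<^sub>C x)"
  by (simp add: shift_op_def fun_eq_iff complex_vector.scale_left_diff_distrib scaleC_of_real)

lemma closed_csubspace_eig: "closed_csubspace (eig r)"
  unfolding eig_eq[symmetric] null_space_def shift_op_def
  by (rule null_closed_csubspace[OF bounded_op_minus_scaleC[OF bounded_R]])

lemma eig_orthogonal:
  assumes "x \<in> eig r" "y \<in> eig s" "r \<noteq> s"
  shows "cinner x y = 0"
proof -
  have "complex_of_real r * cinner x y = complex_of_real s * cinner x y"
    using assms symmetric_opD[OF symmetric_R, of x y] by (simp add: eig_def cinner_simps)
  then show ?thesis using assms(3) by simp
qed

lemma fredholm_shift:
  assumes c: "c \<noteq> complex_of_real \<alpha>"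
  shows "fredholm (shift_op R c)"
  unfolding fredholm_def
proof (intro conjI)
  have fin: "finite_cdim (null_space (shift_op R d))" if "d \<noteq> complex_of_real \<alpha>" for d
    using compact_op_finite_eigenspace[OF bounded_C compact, of "d - complex_of_real \<alpha>"] that
    by (simp add: null_space_def shift_eq)
  show "finite_cdim (null_space (shift_op R c))" by (rule fin[OF c])
  have "adj (shift_op R c) y = shift_op R (cnj c) y" for y
    by (rule adj_on_eqI) (auto simp: shift_op_def cinner_simps symmetric_opD[OF symmetric_R])
  then have "adj (shift_op R c) = shift_op R (cnj c)" by blast
  moreover have "cnj c \<noteq> complex_of_real \<alpha>" using c by (metis complex_cnj_cnj complex_cnj_complex_of_real)
  ultimately show "finite_cdim (null_space (adj (shift_op R c)))" using fin by simp
  show "closed (range (shift_op R c))"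
    using compact_op_closed_range[OF bounded_C compact, of "c - complex_of_real \<alpha>"] c
    by (simp add: shift_eq closed_csubspaceD)
qed

text \<open>Fredholm alternative: away from \<open>\<alpha>\<close> the shifted operator has closed
  range, and since it is symmetric, a vector orthogonal to the range lies in the kernel. A trivial
  kernel thus gives a bijection, whose inverse is bounded because the operator is bounded
  below.\<close>

lemma spectrum_iff_eigenvalue:
  assumes r: "r \<noteq> \<alpha>"
  shows "complex_of_real r \<in> spectrum R \<longleftrightarrow> eig r \<noteq> {0}"
proof
  define D where "D = shift_op R (complex_of_real r)"
  have D_eq: "D = (\<lambda>x. C x - (complex_of_real (r - \<alpha>)) *\<^sub>C x)" by (simp add: D_def shift_eq)
  have bD: "bounded_op D" unfolding D_eq by (rule bounded_op_minus_scaleC[OF bounded_C])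
  have symD: "symmetric_op D"
    using symmetric_R by (simp add: symmetric_op_def D_def shift_op_def cinner_simps)
  have ker: "D x = 0 \<longleftrightarrow> x \<in> eig r" for x
    by (simp add: D_def flip: eig_eq) (simp add: null_space_def)
  have mu: "complex_of_real (r - \<alpha>) \<noteq> 0" using r by simp
  show "eig r \<noteq> {0}" if sp: "complex_of_real r \<in> spectrum R"
  proof
    assume triv: "eig r = {0}"
    have closedD: "closed_csubspace (range D)"
      unfolding D_eq by (rule compact_op_closed_range[OF bounded_C compact mu])
    have "x = 0" if x: "x \<in> orth (range D)" for x
    proof -
      have "cinner (D x) (D x) = cinner x (D (D x))" by (rule symmetric_opD[OF symD])
      also have "\<dots> = 0" using orthD[OF x] by blast
      finally show ?thesis using ker[of x] triv by (simp add: cinner_self)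
    qed
    then have "orth (range D) = {0}"
      using complex_vector.subspace_0[OF csubspace_orth] by blast
    then have surj: "range D = UNIV" using orth_orth[OF closedD] by (auto simp: orth_def)
    have inj: "inj D"
      by (rule injI) (metis bounded_op_diff[OF bD] eq_iff_diff_eq_0 ker triv singletonD)
    obtain c where c: "c > 0" "\<And>x. c * norm x \<le> norm (D x)"
      using compact_op_bounded_below[OF bounded_C compact mu closed_csubspace_UNIV] ker triv
      unfolding D_eq by auto
    define S where "S = inv D"
    have SD: "S (D x) = x" and DS: "D (S x) = x" for x
      by (auto simp: S_def inj surj surj_f_inv_f)
    have symS: "symmetric_op S" unfolding symmetric_op_def
      by (metis DS symD symmetric_op_def)
    have "norm (S x) \<le> (1 / c) * norm x" for x
      using c(2)[of "S x"] c(1) by (simp add: DS field_simps)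
    with symS have "bounded_op S" by (rule symmetric_bounded_op)
    then show False using sp SD DS unfolding spectrum_def D_def by (auto simp: fun_eq_iff)
  qed
  show "complex_of_real r \<in> spectrum R" if nt: "eig r \<noteq> {0}"
  proof -
    have "0 \<in> eig r" using closed_csubspace_eig closed_csubspaceD(1) complex_vector.subspace_0 by blast
    then obtain x where x: "x \<in> eig r" "x \<noteq> 0" using nt by blast
    have "x = 0" if "bounded_op S" "S \<circ> D = id" for S
    proof -
      have "S (D x) = x" using that by (metis comp_apply id_apply)
      moreover have "D x = 0" using x(1) ker by blast
      ultimately show ?thesis using bounded_op_zero[OF that(1)] by simp
    qed
    then show ?thesis using x(2) unfolding spectrum_def D_def by blast
  qed
qed

lemma unit_eigenvector: "eig r \<noteq> {0} \<Longrightarrow> \<exists>x\<in>eig r. norm x = 1"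
proof -
  assume nt: "eig r \<noteq> {0}"
  have sub: "csubspace (eig r)" using closed_csubspace_eig closed_csubspaceD(1) by blast
  then obtain x where "x \<in> eig r" "x \<noteq> 0" using nt complex_vector.subspace_0 by blast
  then show ?thesis using csubspace_scaleR[OF sub, of x "1 / norm x"]
    by (intro bexI[of _ "(1 / norm x) *\<^sub>R x"]) auto
qed

text \<open>Unit eigenvectors for different eigenvalues are orthonormal, and \<open>C\<close> is
  bounded below by \<open>e\<close> on their closed span. A compact operator allows this only on a
  finite-dimensional space.\<close>

lemma finite_eigenvalues_away:
  assumes e: "e > 0"
  shows "finite {r. e \<le> \<bar>r - \<alpha>\<bar> \<and> eig r \<noteq> {0}}" (is "finite ?E")
proof -
  have "\<forall>r\<in>?E. \<exists>x. x \<in> eig r \<and> norm x = 1" using unit_eigenvector by blast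
  from bchoice[OF this] obtain v where v: "\<And>r. r \<in> ?E \<Longrightarrow> v r \<in> eig r \<and> norm (v r) = 1" by blast
  have vo: "cinner (v r) (v s) = 0" if "r \<in> ?E" "s \<in> ?E" "r \<noteq> s" for r s
    using eig_orthogonal v that by blast
  have ind: "inj_on v ?E \<and> \<not> complex_vector.dependent (v ` ?E)"
    by (rule orthogonal_independent) (use v vo in force)+
  define M where "M = closure (cspan (v ` ?E))"
  have below_span: "e * norm x \<le> norm (C x)" if x: "x \<in> cspan (v ` ?E)" for x
  proof -
    obtain t u where t: "finite t" "t \<subseteq> v ` ?E" "x = (\<Sum>a\<in>t. u a *\<^sub>C a)"
      using x unfolding complex_vector.span_explicit by blast
    then obtain E where E: "E \<subseteq> ?E" "finite E" "t = v ` E" by (meson finite_subset_image)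
    define w where "w r = u (v r) *\<^sub>C v r" for r
    have injE: "inj_on v E" using ind E(1) inj_on_subset by blast
    have x2: "x = (\<Sum>r\<in>E. w r)" using t(3) E(3) injE by (simp add: sum.reindex w_def)
    have wo: "cinner (w r) (w s) = 0" if "r \<in> E" "s \<in> E" "r \<noteq> s" for r s
    proof -
      have "cinner (v r) (v s) = 0" by (rule vo) (use that E(1) in blast)+
      then show ?thesis by (simp add: w_def cinner_scaleC_left cinner_scaleC_right)
    qed
    have "linear (\<lambda>x. C x)" using bounded_op_bounded_linear[OF bounded_C] bounded_linear.linear by blast
    then have "C x = (\<Sum>r\<in>E. C (w r))" unfolding x2 by (rule linear_sum)
    also have "\<dots> = (\<Sum>r\<in>E. (r - \<alpha>) *\<^sub>R w r)"
    proof (rule sum.cong[OF refl])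
      fix r assume "r \<in> E"
      then have "v r \<in> eig r" using v E(1) by blast
      then have "R (v r) = r *\<^sub>R v r" by (simp add: eig_def)
      then show "C (w r) = (r - \<alpha>) *\<^sub>R w r"
        by (simp add: w_def bounded_op_scaleC[OF bounded_R] scaleR_diff_left scaleC_scaleR_commute)
    qed
    finally have Cx: "C x = (\<Sum>r\<in>E. (r - \<alpha>) *\<^sub>R w r)" .
    have "(e * norm x)\<^sup>2 = (\<Sum>r\<in>E. e\<^sup>2 * (norm (w r))\<^sup>2)"
      using norm_sq_orthogonal_sum[OF E(2) wo] by (simp add: x2 power_mult_distrib sum_distrib_left)
    also have "\<dots> \<le> (\<Sum>r\<in>E. (norm ((r - \<alpha>) *\<^sub>R w r))\<^sup>2)"
    proof (rule sum_mono)
      fix r assume "r \<in> E"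
      then have "e\<^sup>2 \<le> \<bar>r - \<alpha>\<bar>\<^sup>2" using E(1) e by (intro power_mono) auto
      then show "e\<^sup>2 * (norm (w r))\<^sup>2 \<le> (norm ((r - \<alpha>) *\<^sub>R w r))\<^sup>2"
        by (simp add: power_mult_distrib mult_right_mono)
    qed
    also have "\<dots> = (norm (C x))\<^sup>2"
      unfolding Cx by (rule norm_sq_orthogonal_sum[symmetric, OF E(2)]) (use wo in \<open>auto simp: cinner_simps\<close>)
    finally show ?thesis by (rule power2_le_imp_le) simp
  qed
  have "closed {x. e * norm x \<le> norm (C x)}"
    by (intro closed_Collect_le continuous_intros
        bounded_linear.continuous_on[OF bounded_op_bounded_linear[OF bounded_R]])
  then have "M \<subseteq> {x. e * norm x \<le> norm (C x)}"
    unfolding M_def using below_span by (intro closure_minimal) auto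
  then have "finite_cdim M"
    using compact_op_finite_on[OF compact _ e] closed_csubspace_closure_span unfolding M_def by blast
  moreover have "v ` ?E \<subseteq> M"
    unfolding M_def by (meson closure_subset complex_vector.span_superset order_trans)
  ultimately have "finite (v ` ?E)" using conjunct2[OF ind] by (rule independent_subset_finite_cdim)
  then show ?thesis using conjunct1[OF ind] by (rule finite_imageD)
qed

lemma countable_eigenvalues: "countable {r. r \<noteq> \<alpha> \<and> eig r \<noteq> {0}}"
proof -
  have "{r. r \<noteq> \<alpha> \<and> eig r \<noteq> {0}} = (\<Union>n. {r. 1 / real (Suc n) \<le> \<bar>r - \<alpha>\<bar> \<and> eig r \<noteq> {0}})"
  proof (intro set_eqI iffI)
    fix r assume "r \<in> {r. r \<noteq> \<alpha> \<and> eig r \<noteq> {0}}"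
    then obtain n where "inverse (real (Suc n)) < \<bar>r - \<alpha>\<bar>" "eig r \<noteq> {0}"
      using reals_Archimedean[of "\<bar>r - \<alpha>\<bar>"] by auto
    then show "r \<in> (\<Union>n. {r. 1 / real (Suc n) \<le> \<bar>r - \<alpha>\<bar> \<and> eig r \<noteq> {0}})"
      by (auto simp: inverse_eq_divide intro!: exI[of _ n])
  next
    fix r assume "r \<in> (\<Union>n. {r. 1 / real (Suc n) \<le> \<bar>r - \<alpha>\<bar> \<and> eig r \<noteq> {0}})"
    then show "r \<in> {r. r \<noteq> \<alpha> \<and> eig r \<noteq> {0}}" by (auto simp: divide_le_0_iff)
  qed
  moreover have "finite {r. 1 / real (Suc n) \<le> \<bar>r - \<alpha>\<bar> \<and> eig r \<noteq> {0}}" for n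
    by (rule finite_eigenvalues_away) simp
  ultimately show ?thesis by (simp only: countable_UN countable_finite countableI_type)
qed

text \<open>Apply the compact case to \<open>C\<close> with bound \<open>t - \<alpha>\<close>. The
  condition \<open>\<alpha> \<le> t\<close> makes this bound nonnegative, as required because
  eigenvalues of \<open>C\<close> may accumulate at 0.\<close>

lemma numerical_upper_bound:
  assumes M: "closed_csubspace M" and inv: "\<And>x. x \<in> M \<Longrightarrow> R x \<in> M" and t: "\<alpha> \<le> t"
    and noeig: "\<And>r. t < r \<Longrightarrow> M \<inter> eig r \<subseteq> {0}" and x: "x \<in> M"
  shows "Re (cinner (R x) x) \<le> t * (norm x)\<^sup>2"
proof -
  have sub: "csubspace M" using M closed_csubspaceD by blast
  have "Re (cinner (C x) x) \<le> (t - \<alpha>) * (norm x)\<^sup>2"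
  proof (rule compact_symmetric_numerical_bound[OF bounded_C compact symmetric_C M])
    show "C x \<in> M" if "x \<in> M" for x
      using that inv sub by (intro complex_vector.subspace_diff csubspace_scaleR)
    show "x = 0" if "t - \<alpha> < \<mu>" "x \<in> M" "C x = \<mu> *\<^sub>R x" for \<mu> x
    proof -
      have "R x = (\<mu> + \<alpha>) *\<^sub>R x" using that(3) by (simp add: algebra_simps)
      then show ?thesis using noeig[of "\<mu> + \<alpha>"] that by (auto simp: eig_def)
    qed
  qed (use t x in auto)
  then show ?thesis by (simp add: cinner_simps cinner_self algebra_simps)
qed

lemma numerical_lower_bound:
  assumes M: "closed_csubspace M" and inv: "\<And>x. x \<in> M \<Longrightarrow> R x \<in> M" and t: "t \<le> \<alpha>"
    and noeig: "\<And>r. r < t \<Longrightarrow> M \<inter> eig r \<subseteq> {0}" and x: "x \<in> M"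
  shows "t * (norm x)\<^sup>2 \<le> Re (cinner (R x) x)"
proof -
  have sub: "csubspace M" using M closed_csubspaceD by blast
  have "Re (cinner (- C x) x) \<le> (\<alpha> - t) * (norm x)\<^sup>2"
  proof (rule compact_symmetric_numerical_bound[OF _ _ _ M])
    show "bounded_op (\<lambda>x. - C x)"
    proof (rule bounded_opI)
      show "bounded_linear (\<lambda>x. - C x)"
        by (rule bounded_linear_minus[OF bounded_op_bounded_linear[OF bounded_C]])
      show "- C (c *\<^sub>C x) = c *\<^sub>C (- C x)" for c x
        unfolding bounded_op_scaleC[OF bounded_C] by (rule complex_vector.scale_minus_right[symmetric])
    qed
    show "compact_op (\<lambda>x. - C x)" using compact by (simp only: compact_op_def norm_minus_cancel)
    show "symmetric_op (\<lambda>x. - C x)"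
      unfolding symmetric_op_def cinner_minus_left cinner_minus_right symmetric_opD[OF symmetric_C] by blast
    show "- C x \<in> M" if "x \<in> M" for x
      using that inv sub by (intro complex_vector.subspace_neg complex_vector.subspace_diff csubspace_scaleR)
    show "x = 0" if "\<alpha> - t < \<mu>" "x \<in> M" "- C x = \<mu> *\<^sub>R x" for \<mu> x
    proof -
      have "R x = (\<alpha> - \<mu>) *\<^sub>R x" using that(3) by (simp add: algebra_simps)
      then show ?thesis using noeig[of "\<alpha> - \<mu>"] that by (auto simp: eig_def)
    qed
  qed (use t x in auto)
  then show ?thesis by (simp add: cinner_simps cinner_self algebra_simps)
qed

lemma R_invariant_orth:
  assumes "\<And>x. x \<in> S \<Longrightarrow> R x \<in> S" "x \<in> orth S"
  shows "R x \<in> orth S"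
  using assms by (auto intro!: orthI simp: symmetric_opD[OF symmetric_R] orth_def)

lemma R_eig: "x \<in> eig r \<Longrightarrow> R x \<in> eig r"
  by (simp add: eig_def bounded_op_scaleR[OF bounded_R])

text \<open>On the complement of the other eigenspaces both numerical bounds hold with
  \<open>t = \<alpha>\<close>, so the form of \<open>C\<close> vanishes there; a symmetric operator
  with zero form on an invariant subspace is zero on it. This is the completeness of the
  eigenvectors.\<close>

lemma orth_eigenspaces: "orth (\<Union>r\<in>-{\<alpha>}. eig r) = eig \<alpha>"
proof
  show "eig \<alpha> \<subseteq> orth (\<Union>r\<in>-{\<alpha>}. eig r)" by (auto intro!: orthI dest: eig_orthogonal)
  define M where "M = orth (\<Union>r\<in>-{\<alpha>}. eig r)"
  have M: "closed_csubspace M" unfolding M_def by (rule closed_csubspace_orth)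
  have sub: "csubspace M" using M closed_csubspaceD by blast
  have inv: "R x \<in> M" if "x \<in> M" for x
    unfolding M_def by (rule R_invariant_orth) (use that R_eig in \<open>auto simp: M_def\<close>)
  have noeig: "M \<inter> eig r \<subseteq> {0}" if "r \<noteq> \<alpha>" for r
  proof
    fix x assume x: "x \<in> M \<inter> eig r"
    then have "cinner x x = 0" using that unfolding M_def by (intro orthD[of x]) auto
    then show "x \<in> {0}" by (simp add: cinner_self)
  qed
  show "M \<subseteq> eig \<alpha>"
  proof
    fix x assume x: "x \<in> M"
    have "\<bar>Re (cinner (C x) x)\<bar> \<le> 0 * (norm x)\<^sup>2" if x: "x \<in> M" for x
    proof -
      have "Re (cinner (R x) x) \<le> \<alpha> * (norm x)\<^sup>2"
        by (rule numerical_upper_bound[OF M inv order_refl noeig x]) auto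
      moreover have "\<alpha> * (norm x)\<^sup>2 \<le> Re (cinner (R x) x)"
        by (rule numerical_lower_bound[OF M inv order_refl noeig x]) auto
      ultimately
      show ?thesis by (simp add: cinner_simps cinner_self)
    qed
    then have "norm (C x) \<le> 0 * norm x"
      by (rule symmetric_op_numerical_bound[OF symmetric_C sub _ x])
        (use inv x sub in \<open>auto intro!: complex_vector.subspace_diff csubspace_scaleR\<close>)
    then show "x \<in> eig \<alpha>" by (simp add: eig_def)
  qed
qed

lemma finite_cdim_eig:
  assumes "r \<noteq> \<alpha>"
  shows "finite_cdim (eig r)"
  using fredholm_shift[of "complex_of_real r"] assms by (simp add: fredholm_def eig_eq)

text \<open>If \<open>\<alpha>\<close> has finite multiplicity then there are eigenvalues \<open>\<alpha> + \<mu>\<^sub>k\<close> with \<open>\<mu>\<^sub>k \<rightarrow> 0\<close> rapidly,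
  and \<open>\<Sum>k. \<mu>\<^sub>k e\<^sub>k\<close> lies in the closure of the range of \<open>C\<close>, but its preimage would have to be
  the divergent series \<open>\<Sum>k. e\<^sub>k\<close>.\<close>

lemma ess_spectrum_eq:
  assumes inf: "\<not> finite_cdim (UNIV :: 'a set)"
  shows "ess_spectrum R = {complex_of_real \<alpha>}"
proof -
  have "\<not> fredholm (shift_op R (complex_of_real \<alpha>))"
  proof
    assume fred: "fredholm (shift_op R (complex_of_real \<alpha>))"
    define E where "E = {r. r \<noteq> \<alpha> \<and> eig r \<noteq> {0}}"
    have shiftC: "shift_op R (complex_of_real \<alpha>) = (\<lambda>x. C x)"
      by (simp add: shift_op_def scaleC_of_real)
    have fin_a: "finite_cdim (eig \<alpha>)" using fred by (simp add: fredholm_def eig_eq)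
    have closedC: "closed (range (\<lambda>x. C x))" using fred by (simp add: fredholm_def shiftC)
    \<comment> \<open>Finitely many eigenspaces, each of finite dimension, cannot exhaust an
      infinite-dimensional space.\<close>
    have infE: "infinite E"
    proof
      assume finE: "finite E"
      have "\<forall>r. \<exists>S. finite S \<and> cspan S = eig r"
        using finite_cdim_eig fin_a unfolding finite_cdim_def by metis
      then obtain S where S: "\<And>r. finite (S r)" "\<And>r. cspan (S r) = eig r" by metis
      have "finite (\<Union>r\<in>insert \<alpha> E. S r)" using finE S by auto
      from orth_finite_nonzero[OF inf this]
      obtain x where x: "x \<in> orth (\<Union>r\<in>insert \<alpha> E. S r)" "norm x = 1" by blast
      have xo: "x \<in> orth (eig r)" if "r \<in> insert \<alpha> E" for r
      proof -
        have "S r \<subseteq> (\<Union>r\<in>insert \<alpha> E. S r)" using that by blast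
        from orth_anti[OF this] have "x \<in> orth (S r)" using x(1) by blast
        then show ?thesis by (metis S(2) orth_cspan)
      qed
      have "x \<in> orth (\<Union>r\<in>-{\<alpha>}. eig r)"
      proof (rule orthI)
        fix y assume "y \<in> (\<Union>r\<in>-{\<alpha>}. eig r)"
        then obtain r where r: "r \<noteq> \<alpha>" "y \<in> eig r" by auto
        show "cinner x y = 0"
        proof (cases "eig r = {0}")
          case False
          then have "r \<in> insert \<alpha> E" using r by (simp add: E_def)
          from orthD[OF xo[OF this] r(2)] show ?thesis .
        qed (use r in simp)
      qed
      then have "x \<in> eig \<alpha>" by (simp add: orth_eigenspaces)
      then have "x = 0" using xo by (intro in_orth_self[of x "eig \<alpha>"]) auto
      then show False using x(2) by simp
    qed
    have small: "\<exists>r\<in>E. \<bar>r - \<alpha>\<bar> < d" if "d > 0" for d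
    proof (rule ccontr)
      assume "\<not> ?thesis"
      then have "E \<subseteq> {r. d \<le> \<bar>r - \<alpha>\<bar> \<and> eig r \<noteq> {0}}" by (auto simp: E_def not_less)
      then show False using infE finite_eigenvalues_away[OF that] finite_subset by blast
    qed
    \<comment> \<open>Halving the distance to \<open>\<alpha>\<close> at each step makes the chosen
      eigenvalues distinct and their distances geometrically summable.\<close>
    obtain r where rE: "\<And>n. r n \<in> E" and rdec: "\<And>n. \<bar>r (Suc n) - \<alpha>\<bar> < \<bar>r n - \<alpha>\<bar> / 2"
    proof -
      have "\<exists>f. \<forall>n. f n \<in> E \<and> \<bar>f (Suc n) - \<alpha>\<bar> < \<bar>f n - \<alpha>\<bar> / 2"
      proof (rule dependent_nat_choice[of "\<lambda>_ r. r \<in> E" "\<lambda>_ r s. \<bar>s - \<alpha>\<bar> < \<bar>r - \<alpha>\<bar> / 2"])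
        show "\<exists>r. r \<in> E" using small[of 1] by auto
        show "\<exists>s. s \<in> E \<and> \<bar>s - \<alpha>\<bar> < \<bar>r - \<alpha>\<bar> / 2" if "r \<in> E" for r n
          using small[of "\<bar>r - \<alpha>\<bar> / 2"] that by (auto simp: E_def)
      qed
      then show ?thesis using that by blast
    qed
    define \<mu> where "\<mu> n = r n - \<alpha>" for n
    have mu0: "\<mu> n \<noteq> 0" for n using rE[of n] by (simp add: \<mu>_def E_def)
    have mudec: "\<bar>\<mu> (Suc n)\<bar> < \<bar>\<mu> n\<bar> / 2" for n using rdec by (simp add: \<mu>_def)
    have mule: "\<bar>\<mu> n\<bar> \<le> \<bar>\<mu> 0\<bar> * (1/2) ^ n" for n
    proof (induction n)
      case (Suc n)
      then show ?case using mudec[of n] by simp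
    qed simp
    have strict: "\<bar>\<mu> n\<bar> < \<bar>\<mu> m\<bar>" if "m < n" for m n
    proof (rule lift_Suc_mono_less[of "\<lambda>n. - \<bar>\<mu> n\<bar>" m n, simplified, OF _ that])
      show "\<bar>\<mu> (Suc n)\<bar> < \<bar>\<mu> n\<bar>" for n using mudec[of n] by linarith
    qed
    have rinj: "r m \<noteq> r n" if "m \<noteq> n" for m n
      using strict[of m n] strict[of n m] that by (auto simp: \<mu>_def neq_iff)
    have "\<forall>n. \<exists>x. x \<in> eig (r n) \<and> norm x = 1" using rE unit_eigenvector by (auto simp: E_def)
    then obtain e where e: "\<And>n. e n \<in> eig (r n)" "\<And>n. norm (e n) = 1" by metis
    have eo: "cinner (e m) (e n) = (if m = n then 1 else 0)" for m n
      using eig_orthogonal[OF e(1) e(1)] rinj e(2) by (auto simp: cinner_self)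
    have Ce: "C (e n) = \<mu> n *\<^sub>R e n" for n using e(1)[of n] by (simp add: eig_def \<mu>_def scaleR_diff_left)
    have "summable (\<lambda>n. \<mu> n *\<^sub>R e n)"
    proof (rule summable_comparison_test)
      show "\<exists>N. \<forall>n\<ge>N. norm (\<mu> n *\<^sub>R e n) \<le> \<bar>\<mu> 0\<bar> * (1/2) ^ n" using mule e(2) by simp
      show "summable (\<lambda>n. \<bar>\<mu> 0\<bar> * (1/2::real) ^ n)" by (intro summable_mult summable_geometric) simp
    qed
    then obtain y where y: "(\<lambda>n. \<mu> n *\<^sub>R e n) sums y" by (auto simp: summable_def)
    have partial: "(\<Sum>k<n. \<mu> k *\<^sub>R e k) \<in> range (\<lambda>x. C x)" for n
    proof -
      have "linear (\<lambda>x. C x)" using bounded_op_bounded_linear[OF bounded_C] bounded_linear.linear by blast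
      then have "C (\<Sum>k<n. e k) = (\<Sum>k<n. C (e k))" by (rule linear_sum)
      then show ?thesis by (metis (no_types, lifting) Ce rangeI sum.cong)
    qed
    have "y \<in> range (\<lambda>x. C x)"
      by (rule closed_sequentially[OF closedC partial y[unfolded sums_def]])
    then obtain x where x: "y = C x" by blast
    have xe: "cinner x (e j) = 1" for j
    proof -
      have "(\<lambda>n. cinner (\<mu> n *\<^sub>R e n) (e j)) sums cinner y (e j)"
        by (rule bounded_linear.sums[OF bounded_linear_cinner_left y])
      moreover have "(\<lambda>n. cinner (\<mu> n *\<^sub>R e n) (e j)) = (\<lambda>n. if n = j then complex_of_real (\<mu> n) else 0)"
        by (auto simp: cinner_simps eo)
      ultimately have "cinner y (e j) = complex_of_real (\<mu> j)"
        using sums_single[of j "\<lambda>n. complex_of_real (\<mu> n)"] sums_unique2 by metis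
      moreover have "cinner y (e j) = complex_of_real (\<mu> j) * cinner x (e j)"
        unfolding x symmetric_opD[OF symmetric_C] Ce by (simp add: cinner_scaleR_right)
      ultimately show ?thesis using mu0[of j] by simp
    qed
    \<comment> \<open>With \<open>z\<close> the sum of the first \<open>n\<close> vectors, both the
      squared norm of \<open>z\<close> and its pairing with \<open>x\<close> equal \<open>n\<close>;
      expand the squared norm of \<open>x - z\<close>.\<close>
    have "real n \<le> (norm x)\<^sup>2" for n
    proof -
      define z where "z = (\<Sum>k<n. e k)"
      have "(norm z)\<^sup>2 = real n" unfolding z_def
        by (subst norm_sq_orthogonal_sum) (auto simp: eo e(2))
      moreover have "cinner x z = of_nat n" by (simp add: z_def cinner_sum_right xe)
      moreover have "0 \<le> (norm (x - z))\<^sup>2" by simp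
      ultimately show ?thesis unfolding norm_diff_sq by simp
    qed
    then show False using reals_Archimedean2[of "(norm x)\<^sup>2"] by (meson not_le)
  qed
  then show ?thesis using fredholm_shift unfolding ess_spectrum_def by blast
qed

end

section \<open>Norm bounds for positive perturbations and their equality case\<close>

locale positive_compact_perturbation = compact_perturbation +
  assumes positive: "\<And>x. 0 \<le> Re (cinner (R x) x)"
begin

context
  fixes M :: "'a set" and t :: real
  assumes M: "closed_csubspace M" and inv: "\<And>x. x \<in> M \<Longrightarrow> R x \<in> M" and t: "\<alpha> \<le> t" "0 \<le> t"
    and noeig: "\<And>r. t < r \<Longrightarrow> M \<inter> eig r \<subseteq> {0}"
begin

text \<open>Cauchy-Schwarz for the form of \<open>R\<close> at \<open>x\<close> and
  \<open>R x\<close>, with the numerical bound applied at \<open>R x\<close>. In operator terms,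
  \<open>R\<^sup>2 \<le> t R\<close> on \<open>M\<close>.\<close>

lemma norm_R_sq_le:
  assumes x: "x \<in> M"
  shows "(norm (R x))\<^sup>2 \<le> Re (cinner (R x) x) * t"
proof (cases "R x = 0")
  case False
  have "(cmod (cinner (R x) (R x)))\<^sup>2 \<le> Re (cinner (R x) x) * Re (cinner (R (R x)) (R x))"
    by (rule semidefinite_Cauchy_Schwarz[OF symmetric_R complex_vector.subspace_UNIV])
      (auto intro: positive)
  also have "\<dots> \<le> Re (cinner (R x) x) * (t * (norm (R x))\<^sup>2)"
    by (intro mult_left_mono positive numerical_upper_bound[OF M inv t(1) noeig inv[OF x]])
  finally have "(norm (R x))\<^sup>2 * (norm (R x))\<^sup>2 \<le> (Re (cinner (R x) x) * t) * (norm (R x))\<^sup>2"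
    by (simp add: cinner_self norm_mult power2_eq_square mult.assoc)
  then show ?thesis by (rule mult_right_le_imp_le) (use False in simp)
qed (use positive t in simp)

lemma norm_R_le:
  assumes x: "x \<in> M"
  shows "norm (R x) \<le> t * norm x"
proof -
  have "(norm (R x))\<^sup>2 \<le> Re (cinner (R x) x) * t" by (rule norm_R_sq_le[OF x])
  also have "\<dots> \<le> (t * (norm x)\<^sup>2) * t"
    by (intro mult_right_mono numerical_upper_bound[OF M inv t(1) noeig x] t)
  also have "\<dots> = (t * norm x)\<^sup>2" by (simp add: power2_eq_square)
  finally show ?thesis by (rule power2_le_imp_le) (use t in simp)
qed

text \<open>Attaining the bound pushes \<open>cinner (R x) x\<close> up to
  \<open>t * (norm x)\<^sup>2\<close> through \<open>norm_R_sq_le\<close>, and then the expansion of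
  \<open>(norm (R x - t *\<^sub>R x))\<^sup>2\<close> cannot be positive. This converts the norm
  inequality of hyponormality into membership in an eigenspace.\<close>

lemma norm_R_eq_imp_eig:
  assumes x: "x \<in> M" and eq: "t * norm x \<le> norm (R x)" and t0: "0 < t"
  shows "x \<in> eig t"
proof -
  have "norm (R x) = t * norm x" using norm_R_le[OF x] eq by simp
  then have sq: "(norm (R x))\<^sup>2 = t\<^sup>2 * (norm x)\<^sup>2" by (simp add: power_mult_distrib)
  then have "t * (t * (norm x)\<^sup>2) \<le> t * Re (cinner (R x) x)"
    using norm_R_sq_le[OF x] by (simp add: power2_eq_square algebra_simps)
  then have ge: "t * (norm x)\<^sup>2 \<le> Re (cinner (R x) x)" using t0 by simp
  have "(norm (R x - t *\<^sub>R x))\<^sup>2 = 2 * (t * (t * (norm x)\<^sup>2)) - 2 * (t * Re (cinner (R x) x))"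
    unfolding norm_diff_sq sq by (simp add: cinner_scaleR_right power_mult_distrib) (simp add: power2_eq_square)
  also have "\<dots> \<le> 0" using ge t0 by simp
  finally show ?thesis by (simp add: eig_def)
qed

end

end

section \<open>Hyponormal operators\<close>

lemma bounded_ops_restrict:
  "bounded_op T \<Longrightarrow> (\<And>x. x \<in> M \<Longrightarrow> T x \<in> N) \<Longrightarrow> T \<in> bounded_ops M N"
  by (auto simp: bounded_ops_def)

lemma bounded_op_scaleR_comp:
  assumes "bounded_op T"
  shows "bounded_op (\<lambda>x. r *\<^sub>R T x)"
proof (rule bounded_opI)
  show "bounded_linear (\<lambda>x. r *\<^sub>R T x)"
    by (rule bounded_linear_compose[OF bounded_linear_scaleR_right bounded_op_bounded_linear[OF assms]])
qed (simp add: bounded_op_scaleC[OF assms] scaleC_scaleR_commute)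

lemma closure_span_image:
  assumes T: "bounded_op T" and L: "closed_csubspace L" and S: "\<And>x. x \<in> S \<Longrightarrow> T x \<in> L"
    and x: "x \<in> closure (cspan S)"
  shows "T x \<in> L"
proof -
  have "csubspace (T -` L)"
    using closed_csubspaceD(1)[OF L]
    by (intro complex_vector.subspaceI)
      (auto simp: bounded_op_add[OF T] bounded_op_scaleC[OF T] bounded_op_zero[OF T]
        complex_vector.subspace_0 intro: complex_vector.subspace_add complex_vector.subspace_scale)
  moreover have "S \<subseteq> T -` L" using S by auto
  ultimately have "cspan S \<subseteq> T -` L" by (rule complex_vector.span_minimal[rotated])
  moreover have "closed (T -` L)"
    using L by (intro continuous_closed_vimage)
      (auto simp: closed_csubspaceD linear_continuous_at bounded_op_bounded_linear[OF T])
  ultimately have "closure (cspan S) \<subseteq> T -` L" by (rule closure_minimal)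
  then show ?thesis using x by blast
qed

text \<open>A unit vector \<open>y\<close> of \<open>N\<close> orthogonal to \<open>T N\<close> would give the infinite orthogonal family
  \<open>T\<^sup>k y\<close>.\<close>

lemma finite_cdim_scaled_isometry_surj:
  fixes T :: "'a::chilbert_space \<Rightarrow> 'a"
  assumes T: "bounded_op T" and N: "closed_csubspace N" "finite_cdim N"
    and inv: "\<And>x. x \<in> N \<Longrightarrow> T x \<in> N" and a: "a > 0"
    and iso: "\<And>x y. x \<in> N \<Longrightarrow> y \<in> N \<Longrightarrow> cinner (T x) (T y) = complex_of_real a * cinner x y"
  shows "T ` N = N"
proof (rule ccontr)
  assume ne: "T ` N \<noteq> N"
  have sub: "csubspace N" using N closed_csubspaceD by blast
  have nT: "sqrt a * norm x = norm (T x)" if "x \<in> N" for x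
  proof -
    have "complex_of_real ((norm (T x))\<^sup>2) = complex_of_real (a * (norm x)\<^sup>2)"
      using iso[OF that that] by (simp add: cinner_self)
    then have "(norm (T x))\<^sup>2 = (sqrt a * norm x)\<^sup>2"
      using a by (simp only: of_real_eq_iff) (simp add: power_mult_distrib)
    then show ?thesis using a by (simp add: power2_eq_iff_nonneg)
  qed
  have TN: "closed_csubspace (T ` N)"
    by (rule closed_image_bounded_below[OF N(1) T, of "sqrt a"]) (use a nT in auto)
  obtain y0 where y0: "y0 \<in> N" "y0 \<notin> T ` N" using ne inv by auto
  define y where "y = y0 - proj (T ` N) y0"
  have yN: "y \<in> N" unfolding y_def
    using proj_in[OF TN, of y0] inv y0 sub by (intro complex_vector.subspace_diff) auto
  have y_orth: "y \<in> orth (T ` N)" unfolding y_def by (rule proj_orth[OF TN])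
  have y_nz: "y \<noteq> 0" using y0 proj_in[OF TN, of y0] by (auto simp: y_def)
  define e where "e k = (T ^^ k) y" for k :: nat
  have eN: "e k \<in> N" for k unfolding e_def by (induction k) (auto simp: yN inv)
  have e_nz: "e k \<noteq> 0" for k
  proof (induction k)
    case (Suc k)
    then show ?case using nT[OF eN[of k]] a by (auto simp: e_def)
  qed (simp add: e_def y_nz)
  have lt: "cinner (e i) (e (i + Suc d)) = 0" for i d
  proof (induction i)
    case 0
    then show ?case using orthD[OF y_orth, of "e (Suc d)"] eN[of d] by (simp add: e_def)
  next
    case (Suc i)
    have "cinner (e (Suc i)) (e (Suc i + Suc d)) = cinner (T (e i)) (T (e (i + Suc d)))"
      by (simp add: e_def)
    then show ?case using Suc iso[OF eN eN] by simp
  qed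
  have eo: "cinner (e i) (e j) = 0" if "i \<noteq> j" for i j
  proof (cases "i < j")
    case True
    then show ?thesis using lt[of i "j - i - 1"] by simp
  next
    case False
    then have "cinner (e j) (e i) = 0" using lt[of j "i - j - 1"] that by simp
    then show ?thesis by (simp add: cinner_eq_0_commute)
  qed
  have "inj_on e UNIV \<and> \<not> complex_vector.dependent (e ` UNIV)"
    by (rule orthogonal_independent) (use e_nz eo in auto)
  moreover have "range e \<subseteq> N" using eN by auto
  ultimately have "finite (UNIV :: nat set)"
    using independent_subset_finite_cdim[OF N(2)] finite_imageD by blast
  then show False by simp
qed

lemma hyponormal_norm_adj_le:
  fixes T :: "'a::chilbert_space \<Rightarrow> 'a"
  assumes T: "bounded_op T" and h: "hyponormal T"
  shows "norm (adj T x) \<le> norm (T x)"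
proof -
  have "0 \<le> Re (cinner (adj T (T x) - T (adj T x)) x)"
    using positive_onD[OF h[unfolded hyponormal_def]] by blast
  also have "cinner (adj T (T x) - T (adj T x)) x = cinner (T x) (T x) - cinner (adj T x) (adj T x)"
    by (simp add: cinner_diff_left cinner_adj_left[OF T] cinner_adj[OF T, of "adj T x"])
  finally have "(norm (adj T x))\<^sup>2 \<le> (norm (T x))\<^sup>2" by (simp add: cinner_self)
  then show ?thesis by (rule power2_le_imp_le) simp
qed

locale hyponormal_compact = positive_compact_perturbation +
  fixes T :: "'a \<Rightarrow> 'a"
  assumes bounded_T: "bounded_op T" and RR: "\<And>x. R (R x) = adj T (T x)"
    and hyp: "\<And>x. norm (adj T x) \<le> norm (T x)" and alpha_nonneg: "0 \<le> \<alpha>"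
begin

lemma norm_R: "norm (R x) = norm (T x)"
proof -
  have "cinner (R x) (R x) = cinner (T x) (T x)"
    using symmetric_opD[OF symmetric_R, of "R x" x] by (simp add: RR cinner_adj_left[OF bounded_T])
  then show ?thesis by (simp add: cinner_self flip: of_real_power)
qed

lemma norm_T_eig: "x \<in> eig a \<Longrightarrow> norm (T x) = \<bar>a\<bar> * norm x"
  by (simp add: eig_def flip: norm_R)

lemma adj_T_eig: "x \<in> eig a \<Longrightarrow> adj T (T x) = a\<^sup>2 *\<^sub>R x"
  by (simp add: eig_def bounded_op_scaleR[OF bounded_R] power2_eq_square flip: RR)

lemma T_invariant_orth:
  assumes "\<And>x. x \<in> S \<Longrightarrow> adj T x \<in> S" "x \<in> orth S"
  shows "T x \<in> orth S"
  using assms by (auto intro!: orthI simp: cinner_adj[OF bounded_T] orth_def)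

text \<open>If the larger eigenspaces reduce \<open>T\<close>, then \<open>a\<close> bounds \<open>T\<close> on their common orthogonal
  complement, and hyponormality forces \<open>T x\<close> to attain this bound for \<open>x \<in> eig a\<close>.\<close>

lemma T_eig_step:
  assumes a: "\<alpha> \<le> a" "0 < a" and red: "\<And>c x. a < c \<Longrightarrow> x \<in> eig c \<Longrightarrow> adj T x \<in> eig c"
    and x: "x \<in> eig a"
  shows "T x \<in> eig a"
proof -
  define S where "S = (\<Union>c\<in>{a<..}. eig c)"
  define M where "M = orth S"
  have M: "closed_csubspace M" unfolding M_def by (rule closed_csubspace_orth)
  have xM: "x \<in> M" using x by (auto simp: M_def S_def intro!: orthI dest: eig_orthogonal)
  have TM: "T x \<in> M" unfolding M_def
    by (rule T_invariant_orth) (use red xM in \<open>auto simp: M_def S_def\<close>)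
  have inv: "R y \<in> M" if "y \<in> M" for y unfolding M_def
    by (rule R_invariant_orth) (use R_eig that in \<open>auto simp: M_def S_def\<close>)
  have noeig: "M \<inter> eig c \<subseteq> {0}" if "a < c" for c
  proof
    fix z assume z: "z \<in> M \<inter> eig c"
    then have "cinner z z = 0" using that unfolding M_def S_def by (intro orthD[of z]) auto
    then show "z \<in> {0}" by (simp add: cinner_self)
  qed
  have "a * norm (T x) = norm (adj T (T x))"
    using a x by (simp add: norm_T_eig adj_T_eig power2_eq_square)
  also have "\<dots> \<le> norm (R (T x))" using hyp norm_R by simp
  finally show ?thesis
    using norm_R_eq_imp_eig[OF M inv a(1) _ noeig TM] a by simp
qed

text \<open>Only finitely many eigenvalues exceed \<open>a\<close>, and their number is the
  induction measure: the larger eigenspaces are already invariant under \<open>adj T\<close>, so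
  \<open>T_eig_step\<close> applies. Finite dimension makes \<open>T\<close> onto the eigenspace,
  and since \<open>adj T\<close> after \<open>T\<close> is the scalar \<open>a\<^sup>2\<close>
  there, \<open>adj T\<close> maps the eigenspace back into itself.\<close>

lemma eig_reducing:
  assumes a: "\<alpha> < a"
  shows "T ` eig a = eig a \<and> adj T ` eig a \<subseteq> eig a"
  using a
proof (induction "card {c. a < c \<and> eig c \<noteq> {0}}" arbitrary: a rule: less_induct)
  case less
  have a0: "0 < a" using less.prems alpha_nonneg by simp
  have fin: "finite {c. d < c \<and> eig c \<noteq> {0}}" if "\<alpha> < d" for d
    by (rule finite_subset[OF _ finite_eigenvalues_away[of "d - \<alpha>"]]) (use that in auto)
  \<comment> \<open>A value \<open>c\<close> with trivial eigenspace need not decrease the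
    cardinality, so it is kept out of the induction hypothesis.\<close>
  have red: "adj T x \<in> eig c" if c: "a < c" "x \<in> eig c" for c x
  proof (cases "eig c = {0}")
    case True
    then show ?thesis using c bounded_op_zero[OF bounded_op_adj[OF bounded_T]] by simp
  next
    case False
    have "{d. c < d \<and> eig d \<noteq> {0}} \<subset> {d. a < d \<and> eig d \<noteq> {0}}" using c(1) False by auto
    then have "card {d. c < d \<and> eig d \<noteq> {0}} < card {d. a < d \<and> eig d \<noteq> {0}}"
      by (rule psubset_card_mono[OF fin[OF less.prems]])
    then show ?thesis using less.hyps[of c] c less.prems by auto
  qed
  have Ta: "T x \<in> eig a" if "x \<in> eig a" for x
    using T_eig_step[OF _ a0 red that] less.prems by simp
  have surj: "T ` eig a = eig a"
  proof (rule finite_cdim_scaled_isometry_surj[OF bounded_T closed_csubspace_eig])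
    show "finite_cdim (eig a)" using less.prems by (intro finite_cdim_eig) auto
    show "0 < a\<^sup>2" using a0 by simp
    show "cinner (T x) (T y) = complex_of_real (a\<^sup>2) * cinner x y" if "x \<in> eig a" "y \<in> eig a" for x y
      using that by (simp add: cinner_adj[OF bounded_T, of x] adj_T_eig cinner_scaleR_right)
  qed (rule Ta)
  have "adj T y \<in> eig a" if y: "y \<in> eig a" for y
  proof -
    obtain x where x: "x \<in> eig a" "y = T x" using surj y by blast
    have "a\<^sup>2 *\<^sub>R x \<in> eig a" by (rule csubspace_scaleR[OF closed_csubspaceD(1)[OF closed_csubspace_eig] x(1)])
    then show ?thesis using adj_T_eig[OF x(1)] x(2) by simp
  qed
  then show ?case using surj by blast
qed

text \<open>All larger eigenspaces now reduce \<open>T\<close>, even if there are infinitely many,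
  so one more step reaches \<open>\<alpha>\<close>. That step requires a positive value; for
  \<open>\<alpha> = 0\<close> the eigenspace is the kernel of \<open>T\<close>.\<close>

lemma T_eig_alpha:
  assumes "x \<in> eig \<alpha>"
  shows "T x \<in> eig \<alpha>"
proof (cases "\<alpha> = 0")
  case True
  then have "T x = 0" using norm_T_eig[OF assms] by simp
  then show ?thesis by (simp add: eig_def bounded_op_zero[OF bounded_R])
next
  case False
  then show ?thesis using T_eig_step[OF order_refl _ _ assms] eig_reducing alpha_nonneg by auto
qed

lemma eig_csubspace: "csubspace (eig a)"
  by (rule closed_csubspaceD(1)[OF closed_csubspace_eig])

lemma unitary_on_eig:
  assumes a: "\<alpha> < a"
  shows "unitary_on (eig a) (\<lambda>x. (1 / a) *\<^sub>R T x)"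
proof -
  have a0: "0 < a" using a alpha_nonneg by simp
  define U where "U x = (1 / a) *\<^sub>R T x" for x
  have bU: "bounded_op U"
    unfolding U_def by (rule bounded_op_scaleR_comp[OF bounded_T])
  have UN: "U x \<in> eig a" if "x \<in> eig a" for x
    unfolding U_def using eig_reducing[OF a] that by (intro csubspace_scaleR[OF eig_csubspace]) auto
  \<comment> \<open>Because \<open>adj T\<close> preserves the eigenspace, the adjoint taken within
    it is a restriction of \<open>adj T\<close> and requires no projection.\<close>
  have adjU: "adj_on (eig a) U y = (1 / a) *\<^sub>R adj T y" if "y \<in> eig a" for y
    using eig_reducing[OF a] that
    by (intro adj_on_eqI[OF eig_csubspace] csubspace_scaleR[OF eig_csubspace])
      (auto simp: U_def cinner_simps cinner_adj[OF bounded_T])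
  have left: "adj_on (eig a) U (U x) = x" if x: "x \<in> eig a" for x
    using adjU[OF UN[OF x]] a0 x
    by (simp add: U_def bounded_op_scaleR[OF bounded_op_adj[OF bounded_T]] adj_T_eig power2_eq_square)
  have right: "U (adj_on (eig a) U y) = y" if y: "y \<in> eig a" for y
  proof -
    obtain x where x: "x \<in> eig a" "y = T x" using eig_reducing[OF a] y by blast
    have "U (a *\<^sub>R x) = y" using a0 x by (simp add: U_def bounded_op_scaleR[OF bounded_T])
    moreover have "a *\<^sub>R x \<in> eig a" using x by (intro csubspace_scaleR[OF eig_csubspace])
    ultimately show ?thesis using left by metis
  qed
  have "unitary_on (eig a) U"
    unfolding unitary_on_def using bounded_ops_restrict[OF bU UN] left right by blast
  then show ?thesis by (simp add: U_def[abs_def])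
qed

section \<open>The three spectral subspaces and how \<open>T\<close> acts on them\<close>

definition upper_eigs :: "real set" where "upper_eigs = {r. \<alpha> < r \<and> eig r \<noteq> {0}}"
definition lower_eigs :: "real set" where "lower_eigs = {r. r < \<alpha> \<and> eig r \<noteq> {0}}"

text \<open>The modulus of an eigenvalue of \<open>R\<close> is the norm of \<open>T\<close> at a
  unit eigenvector, so \<open>onorm T\<close> bounds it automatically. The dual remark with
  \<open>min_modulus T\<close>, where positivity of \<open>R\<close> removes the absolute value,
  gives \<open>lower_eigs_eq\<close>.\<close>

lemma upper_eigs_eq: "{r \<in> {\<alpha><..onorm T}. complex_of_real r \<in> spectrum R} = upper_eigs"
proof -
  have "r \<le> onorm T" if r: "eig r \<noteq> {0}" for r
  proof -
    obtain x where "x \<in> eig r" "norm x = 1" using unit_eigenvector[OF r] by blast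
    then show ?thesis using norm_T_eig[of x r] bounded_op_le[OF bounded_T, of x] by simp
  qed
  then show ?thesis using spectrum_iff_eigenvalue by (auto simp: upper_eigs_def)
qed

lemma lower_eigs_eq: "{r \<in> {min_modulus T..<\<alpha>}. complex_of_real r \<in> spectrum R} = lower_eigs"
proof -
  have "min_modulus T \<le> r" if r: "eig r \<noteq> {0}" for r
  proof -
    obtain x where x: "x \<in> eig r" "norm x = 1" using unit_eigenvector[OF r] by blast
    have "0 \<le> r" using positive[of x] x by (simp add: eig_def cinner_simps cinner_self)
    then have "norm (T x) = r" using norm_T_eig[OF x(1)] x(2) by simp
    moreover have "min_modulus T \<le> norm (T x)"
      unfolding min_modulus_def by (rule cINF_lower) (use x in \<open>auto intro: bdd_belowI[of _ 0]\<close>)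
    ultimately show ?thesis by simp
  qed
  then show ?thesis using spectrum_iff_eigenvalue by (auto simp: lower_eigs_def)
qed

definition "H0 = closure (cspan (\<Union>r\<in>upper_eigs. eig r))"
definition "H1 = eig \<alpha>"
definition "H2 = closure (cspan (\<Union>r\<in>lower_eigs. eig r))"

lemma closed_H: "closed_csubspace H0" "closed_csubspace H1" "closed_csubspace H2"
  by (simp_all add: H0_def H1_def H2_def closed_csubspace_closure_span closed_csubspace_eig)

lemma csubspace_H: "csubspace H0" "csubspace H1" "csubspace H2"
  using closed_H closed_csubspaceD by auto

lemma orth_sym: "S \<subseteq> orth S' \<Longrightarrow> S' \<subseteq> orth S"
  using orthD2 orthI by (metis subset_iff)

lemma closure_span_subset_orth:
  assumes "S \<subseteq> orth S'"
  shows "closure (cspan S) \<subseteq> orth S'"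
  by (intro closure_minimal complex_vector.span_minimal assms csubspace_orth
      closed_csubspaceD(2)[OF closed_csubspace_orth])

lemma H_orth: "H0 \<subseteq> orth H1" "H0 \<subseteq> orth H2" "H2 \<subseteq> orth H1"
proof -
  show "H0 \<subseteq> orth H1" unfolding H0_def H1_def
    by (rule closure_span_subset_orth) (auto simp: upper_eigs_def intro!: orthI dest: eig_orthogonal)
  show "H2 \<subseteq> orth H1" unfolding H2_def H1_def
    by (rule closure_span_subset_orth) (auto simp: lower_eigs_def intro!: orthI dest: eig_orthogonal)
  show "H0 \<subseteq> orth H2" unfolding H0_def H2_def orth_closure_span
    by (rule closure_span_subset_orth)
      (auto simp: upper_eigs_def lower_eigs_def intro!: orthI dest: eig_orthogonal)
qed

lemma H_orth': "H1 \<subseteq> orth H0" "H2 \<subseteq> orth H0" "H1 \<subseteq> orth H2"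
  using H_orth[THEN orth_sym] by auto

text \<open>Removing the components in \<open>H0\<close> and \<open>H2\<close> leaves a vector
  orthogonal to every eigenspace other than that of \<open>\<alpha>\<close>, and
  \<open>orth_eigenspaces\<close> applies.\<close>

lemma remainder_H1: "x - proj H0 x - proj H2 x \<in> H1"
proof -
  have "proj H2 x \<in> orth H0" using proj_in[OF closed_H(3)] H_orth' by blast
  then have "x - proj H0 x - proj H2 x \<in> orth H0"
    by (rule complex_vector.subspace_diff[OF csubspace_orth proj_orth[OF closed_H(1)]])
  moreover have "proj H0 x \<in> orth H2" using proj_in[OF closed_H(1)] H_orth by blast
  then have "(x - proj H2 x) - proj H0 x \<in> orth H2"
    by (rule complex_vector.subspace_diff[OF csubspace_orth proj_orth[OF closed_H(3)]])
  then have "x - proj H0 x - proj H2 x \<in> orth H2" by (simp add: algebra_simps)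
  ultimately have x: "x - proj H0 x - proj H2 x \<in> orth (\<Union>r\<in>upper_eigs. eig r)"
    "x - proj H0 x - proj H2 x \<in> orth (\<Union>r\<in>lower_eigs. eig r)"
    by (auto simp: H0_def H2_def orth_closure_span)
  have "x - proj H0 x - proj H2 x \<in> orth (\<Union>r\<in>-{\<alpha>}. eig r)"
  proof (rule orthI)
    fix y assume "y \<in> (\<Union>r\<in>-{\<alpha>}. eig r)"
    then obtain r where r: "r \<noteq> \<alpha>" "y \<in> eig r" by auto
    show "cinner (x - proj H0 x - proj H2 x) y = 0"
    proof (cases "y = 0")
      case False
      then have "r \<in> upper_eigs \<or> r \<in> lower_eigs" using r by (auto simp: upper_eigs_def lower_eigs_def)
      then show ?thesis using x r(2) by (auto intro: orthD)
    qed simp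
  qed
  then show ?thesis by (simp add: orth_eigenspaces H1_def)
qed

lemma dsum3: "orthogonal_dsum3 H0 H1 H2"
proof -
  have "x = proj H0 x + (x - proj H0 x - proj H2 x) + proj H2 x" for x by simp
  then have "\<exists>x0\<in>H0. \<exists>x1\<in>H1. \<exists>x2\<in>H2. x = x0 + x1 + x2" for x
    using proj_in[OF closed_H(1)] proj_in[OF closed_H(3)] remainder_H1 by metis
  moreover have "orthogonal_sets H0 H1" "orthogonal_sets H0 H2" "orthogonal_sets H1 H2"
    unfolding orthogonal_sets_def using H_orth(1,2) H_orth'(3) orthD by blast+
  ultimately show ?thesis unfolding orthogonal_dsum3_def using closed_H by blast
qed

lemma T_H0: "x \<in> H0 \<Longrightarrow> T x \<in> H0"
  and adj_T_H0: "x \<in> H0 \<Longrightarrow> adj T x \<in> H0"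
proof -
  have sub: "(\<Union>r\<in>upper_eigs. eig r) \<subseteq> H0"
    unfolding H0_def by (meson closure_subset complex_vector.span_superset order_trans)
  have "T y \<in> H0 \<and> adj T y \<in> H0" if y: "y \<in> (\<Union>r\<in>upper_eigs. eig r)" for y
  proof -
    obtain r where "r \<in> upper_eigs" "y \<in> eig r" using y by blast
    then have "T y \<in> eig r" "adj T y \<in> eig r" "r \<in> upper_eigs"
      using eig_reducing[of r] by (auto simp: upper_eigs_def)
    then show ?thesis using sub by blast
  qed
  then show "x \<in> H0 \<Longrightarrow> T x \<in> H0" "x \<in> H0 \<Longrightarrow> adj T x \<in> H0"
    using closure_span_image[OF bounded_T closed_H(1)]
      closure_span_image[OF bounded_op_adj[OF bounded_T] closed_H(1)]
    unfolding H0_def[symmetric] by (metis H0_def)+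
qed

lemma RR_H2:
  assumes "x \<in> H2"
  shows "R (R x) \<in> H2"
proof -
  have sub: "(\<Union>r\<in>lower_eigs. eig r) \<subseteq> H2"
    unfolding H2_def by (meson closure_subset complex_vector.span_superset order_trans)
  then have "R y \<in> H2" if "y \<in> (\<Union>r\<in>lower_eigs. eig r)" for y using that R_eig by blast
  then have "R y \<in> H2" if "y \<in> H2" for y
    using closure_span_image[OF bounded_R closed_H(3)] that unfolding H2_def by blast
  then show ?thesis using assms by blast
qed

text \<open>\<open>adj T\<close> preserves \<open>H0\<close>, so \<open>T x\<close> has no component
  there. This produces the zero above \<open>A\<close> in the block form.\<close>

lemma T_H2_split: "x \<in> H2 \<Longrightarrow> T x = proj H1 (T x) + proj H2 (T x)"
proof -
  assume x: "x \<in> H2"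
  have "T x \<in> orth H0" by (rule T_invariant_orth) (use adj_T_H0 x H_orth' in auto)
  then have "proj H0 (T x) = 0" by (rule proj_zero[OF closed_H(1)])
  then have d: "T x - proj H2 (T x) \<in> H1" using remainder_H1[of "T x"] by simp
  have "proj H1 (T x) = T x - proj H2 (T x)"
    by (rule proj_eqI[OF closed_H(2) d]) (use proj_in[OF closed_H(3)] H_orth(3) in auto)
  then show ?thesis by simp
qed

lemma orthogonal_dsum_eig:
  assumes "inj_on a I"
  shows "orthogonal_dsum I (\<lambda>i. eig (a i)) (closure (cspan (\<Union>r\<in>a ` I. eig r)))"
  unfolding orthogonal_dsum_def orthogonal_sets_def
proof (intro conjI ballI impI)
  show "cinner x y = 0" if "i \<in> I" "j \<in> I" "i \<noteq> j" "x \<in> eig (a i)" "y \<in> eig (a j)" for i j x y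
    using eig_orthogonal[OF that(4,5)] inj_onD[OF assms] that by blast
qed (simp_all add: closed_csubspace_eig)

text \<open>On the eigenspace of \<open>\<alpha>\<close> the operator \<open>T\<close> is
  \<open>\<alpha>\<close> times an isometry. For \<open>\<alpha> = 0\<close> it vanishes there, and
  the identity serves as the isometry.\<close>

definition "V1 x = (if \<alpha> = 0 then x else (1 / \<alpha>) *\<^sub>R T x)"

lemma V1: "isometry_on H1 V1" "x \<in> H1 \<Longrightarrow> \<alpha> *\<^sub>R V1 x = T x"
proof -
  show "x \<in> H1 \<Longrightarrow> \<alpha> *\<^sub>R V1 x = T x" using norm_T_eig[of x \<alpha>] by (auto simp: V1_def H1_def)
  have "bounded_op V1"
  proof (cases "\<alpha> = 0")
    case True
    have "V1 = (\<lambda>x. x)" unfolding V1_def[abs_def] using True by simp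
    then show ?thesis by (simp add: bounded_opI bounded_linear_ident)
  next
    case False
    then have "V1 = (\<lambda>x. (1 / \<alpha>) *\<^sub>R T x)" by (auto simp: V1_def)
    then show ?thesis using bounded_op_scaleR_comp[OF bounded_T] by simp
  qed
  moreover have "V1 x \<in> H1" if "x \<in> H1" for x
    using that T_eig_alpha by (auto simp: V1_def H1_def intro: csubspace_scaleR[OF eig_csubspace])
  moreover have "norm (V1 x) = norm x" if "x \<in> H1" for x
    using that norm_T_eig[of x \<alpha>] alpha_nonneg by (auto simp: V1_def H1_def)
  ultimately show "isometry_on H1 V1" unfolding isometry_on_def by (blast intro: bounded_ops_restrict)
qed

section \<open>The entries \<open>A\<close> and \<open>B\<close> and their relations\<close>

abbreviation "A x \<equiv> proj H1 (T x)"
abbreviation "B x \<equiv> proj H2 (T x)"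

lemma bounded_A: "(\<lambda>x. A x) \<in> bounded_ops H2 H1"
  and bounded_B: "(\<lambda>x. B x) \<in> bounded_ops H2 H2"
  by (rule bounded_ops_restrict, rule bounded_op_comp[OF bounded_op_proj bounded_T],
      simp_all add: closed_H proj_in)+

lemma adj_A: "adj_on H2 (\<lambda>x. A x) y = proj H2 (adj T (proj H1 y))"
  and adj_B: "adj_on H2 (\<lambda>x. B x) y = proj H2 (adj T (proj H2 y))"
proof -
  have *: "adj_on H2 (\<lambda>x. proj L (T x)) y = proj H2 (adj T (proj L y))" if L: "closed_csubspace L" for L
  proof (rule adj_on_eqI[OF csubspace_H(3) proj_in[OF closed_H(3)]])
    fix u assume u: "u \<in> H2"
    have "cinner (proj L (T u)) y = cinner u (adj T (proj L y))"
      by (simp add: symmetric_opD[OF symmetric_proj[OF L]] cinner_adj[OF bounded_T])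
    also have "\<dots> = cinner (proj H2 u) (adj T (proj L y))" using u by (simp add: proj_id closed_H)
    also have "\<dots> = cinner u (proj H2 (adj T (proj L y)))"
      by (rule symmetric_opD[OF symmetric_proj[OF closed_H(3)]])
    finally show "cinner (proj L (T u)) y = cinner u (proj H2 (adj T (proj L y)))" .
  qed
  show "adj_on H2 (\<lambda>x. A x) y = proj H2 (adj T (proj H1 y))"
    "adj_on H2 (\<lambda>x. B x) y = proj H2 (adj T (proj H2 y))"
    by (rule *, rule closed_H)+
qed

text \<open>For \<open>u\<close> in \<open>H1\<close> and \<open>x\<close> in \<open>H2\<close>,
  pairing \<open>T u\<close> with \<open>T x\<close> gives \<open>cinner u (R (R x))\<close>, which
  is 0 because \<open>R\<close> preserves \<open>H2\<close>. Dividing by \<open>\<alpha>\<close>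
  turns this into orthogonality of the ranges of \<open>V1\<close> and \<open>A\<close>.\<close>

lemma adj_V1_A:
  assumes x: "x \<in> H2"
  shows "adj_on H1 V1 (A x) = 0"
proof (rule adj_on_eqI[OF csubspace_H(2) complex_vector.subspace_0[OF csubspace_H(2)]])
  fix u assume u: "u \<in> H1"
  show "cinner (V1 u) (A x) = cinner u 0"
  proof (cases "\<alpha> = 0")
    \<comment> \<open>Here \<open>V1\<close> is not derived from \<open>T\<close>, but positivity of
      \<open>R\<close> excludes eigenvalues below 0, so \<open>H2\<close> is trivial.\<close>
    case True
    have "r \<notin> lower_eigs" for r
    proof
      assume r: "r \<in> lower_eigs"
      then obtain z where "z \<in> eig r" "norm z = 1" using unit_eigenvector by (auto simp: lower_eigs_def)
      then have "0 \<le> r" using positive[of z] by (simp add: eig_def cinner_simps cinner_self)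
      moreover have "r < \<alpha>" using r unfolding lower_eigs_def by blast
      ultimately show False using True by linarith
    qed
    then have "lower_eigs = {}" by blast
    then have "H2 = {0}" by (simp add: H2_def)
    then have "A x = 0" using x bounded_op_zero[OF bounded_T] proj_zero[OF closed_H(2)]
        complex_vector.subspace_0[OF csubspace_orth] by auto
    then show ?thesis by simp
  next
    case False
    have "V1 u \<in> H1" using V1(1) u unfolding isometry_on_def bounded_ops_def by blast
    then have "cinner (V1 u) (A x) = cinner (V1 u) (T x)"
      using symmetric_opD[OF symmetric_proj[OF closed_H(2)], of "V1 u" "T x"]
      by (simp add: proj_id closed_H)
    also have "\<dots> = complex_of_real (1 / \<alpha>) * cinner u (R (R x))"
      using False by (simp add: V1_def cinner_simps cinner_adj[OF bounded_T] RR)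
    also have "cinner u (R (R x)) = 0"
      using u H_orth'(3) RR_H2[OF x] by (auto intro: orthD)
    finally show ?thesis by simp
  qed
qed

text \<open>Since \<open>A x + B x = T x\<close>, the two adjoints add up to the compression of
  \<open>adj T (T x)\<close> to \<open>H2\<close>, where this vector already lies.\<close>

lemma adj_A_A_adj_B_B:
  assumes x: "x \<in> H2"
  shows "adj_on H2 (\<lambda>x. A x) (A x) + adj_on H2 (\<lambda>x. B x) (B x) = R (R x)"
proof -
  have "adj_on H2 (\<lambda>x. A x) (A x) + adj_on H2 (\<lambda>x. B x) (B x)
      = proj H2 (adj T (A x)) + proj H2 (adj T (B x))"
    unfolding adj_A adj_B by (simp add: proj_id closed_H proj_in)
  also have "\<dots> = proj H2 (adj T (A x + B x))"
    by (simp add: bounded_op_add bounded_op_proj closed_H bounded_op_adj bounded_T)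
  also have "A x + B x = T x" using T_H2_split[OF x] by simp
  also have "proj H2 (adj T (T x)) = R (R x)"
    using RR_H2[OF x] by (simp add: proj_id closed_H flip: RR)
  finally show ?thesis .
qed

text \<open>The adjoint of \<open>B\<close> is \<open>adj T\<close> followed by projection to
  \<open>H2\<close>. So its norm at \<open>x\<close> is at most \<open>norm (adj T x)\<close>, hence
  at most \<open>norm (T x) = norm (R x)\<close> by hyponormality.\<close>

lemma B_adj_B_le: "op_le_on H2 (\<lambda>x. B (adj_on H2 (\<lambda>x. B x) x)) (\<lambda>x. R (R x))"
  unfolding op_le_on_def positive_on_def
proof
  fix x assume x: "x \<in> H2"
  define z where "z = adj_on H2 (\<lambda>x. B x) x"
  have z: "z = proj H2 (adj T x)" unfolding z_def adj_B using x by (simp add: proj_id closed_H)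
  have "cinner (B z) x = cinner (T z) (proj H2 x)"
    by (rule symmetric_opD[OF symmetric_proj[OF closed_H(3)]])
  also have "\<dots> = cinner (proj H2 z) (adj T x)"
    using x by (simp add: proj_id closed_H cinner_adj[OF bounded_T] z proj_in)
  also have "\<dots> = cinner z z"
    unfolding symmetric_opD[OF symmetric_proj[OF closed_H(3)]] by (simp add: z)
  finally have "cinner (R (R x) - B z) x = cinner (R x) (R x) - cinner z z"
    by (simp add: cinner_diff_left symmetric_opD[OF symmetric_R, of "R x"])
  moreover have "norm z \<le> norm (R x)"
    using norm_proj_le[OF closed_H(3), of "adj T x"] hyp[of x] by (simp add: z norm_R)
  then have "(norm z)\<^sup>2 \<le> (norm (R x))\<^sup>2" by (intro power_mono) auto
  ultimately show "cinner (R (R x) - B z) x \<in> \<real>\<^sub>\<ge>\<^sub>0"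
    by (simp add: cinner_self complex_nonneg_Reals_iff)
qed

end

section \<open>Enumeration of the eigenvalues and assembly of the decomposition\<close>

lemma enumerate_countable:
  assumes "countable S"
  obtains n :: enat and a :: "nat \<Rightarrow> 'b" where "inj_on a {i. enat i < n}" "a ` {i. enat i < n} = S"
proof (cases "finite S")
  case True
  then obtain h where h: "bij_betw h {0..<card S} S" using ex_bij_betw_nat_finite by blast
  have "{i. enat i < enat (card S)} = {0..<card S}" by auto
  then show ?thesis using that[of h "enat (card S)"] h by (simp add: bij_betw_def)
next
  case False
  then have "bij_betw (from_nat_into S) UNIV S" using assms by (intro bij_betw_from_nat_into)
  then show ?thesis using that[of "from_nat_into S" \<infinity>] by (simp add: bij_betw_def)
qed

theorem theorem4p3:
  fixes T :: "'a::chilbert_space \<Rightarrow> 'a"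
  assumes "\<not> finite_cdim (UNIV :: 'a set)"
    and "T \<in> norm_closure AN"
    and "hyponormal T"
  shows "\<exists>(H0 :: 'a set) H1 H2 V0 V1 A B (\<alpha> :: real)
            (n :: enat) (a :: nat \<Rightarrow> real) U
            (m :: enat) (b :: nat \<Rightarrow> real) D.
      orthogonal_dsum3 H0 H1 H2
    \<and> V0 \<in> bounded_ops H0 H0 \<and> V1 \<in> bounded_ops H1 H1
    \<and> A \<in> bounded_ops H2 H1 \<and> B \<in> bounded_ops H2 H2
    \<and> (\<forall>x0\<in>H0. \<forall>x1\<in>H1. \<forall>x2\<in>H2.
         T (x0 + x1 + x2) = V0 x0 + (\<alpha> *\<^sub>R V1 x1 + A x2) + B x2)
    \<and> ess_spectrum (abs_op T) = {complex_of_real \<alpha>} \<and> \<alpha> \<ge> 0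
    \<and> inj_on a {i. enat i < n}
    \<and> {r \<in> {\<alpha><..onorm T}. complex_of_real r \<in> spectrum (abs_op T)} = a ` {i. enat i < n}
    \<and> (\<forall>i. enat i < n \<longrightarrow> unitary_on (null_space (shift_op (abs_op T) (complex_of_real (a i)))) (U i))
    \<and> is_dsum_op {i. enat i < n} (\<lambda>i. null_space (shift_op (abs_op T) (complex_of_real (a i)))) H0
        (\<lambda>i x. a i *\<^sub>R U i x) V0
    \<and> (\<alpha> = onorm T \<longrightarrow> H0 = {0})
    \<and> (H1 \<noteq> {0} \<longrightarrow> isometry_on H1 V1)
    \<and> (H1 = {0} \<longrightarrow> (\<forall>x\<in>H1. V1 x = 0))
    \<and> inj_on b {j. enat j < m}
    \<and> {r \<in> {min_modulus T..<\<alpha>}. complex_of_real r \<in> spectrum (abs_op T)} = b ` {j. enat j < m}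
    \<and> is_dsum_op {j. enat j < m} (\<lambda>j. null_space (shift_op (abs_op T) (complex_of_real (b j)))) H2
        (\<lambda>j x. (b j)\<^sup>2 *\<^sub>R x) D
    \<and> (\<forall>x\<in>H2. adj_on H1 V1 (A x) = 0)
    \<and> (\<forall>x\<in>H2. adj_on H2 A (A x) + adj_on H2 B (B x) = D x)
    \<and> op_le_on H2 (\<lambda>x. B (adj_on H2 B x)) D
    \<and> (\<alpha> = min_modulus T \<longrightarrow> H2 = {0})
    \<and> (onorm T = \<alpha> \<and> \<alpha> = min_modulus T \<longrightarrow> H1 = UNIV \<and> (\<forall>x. T x = onorm T *\<^sub>R V1 x))"
proof -
  have T: "bounded_op T" using assms(2) by (simp add: norm_closure_def)
  obtain \<alpha> where a0: "\<alpha> \<ge> 0" and mod: "\<And>e. e > 0 \<Longrightarrow>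
      \<exists>F. finite F \<and> (\<forall>x\<in>orth F. \<bar>norm (T x) - \<alpha> * norm x\<bar> \<le> e * norm x)"
    using essential_modulus_exists[OF assms(1,2)] by blast
  interpret hyponormal_compact "abs_op T" \<alpha> T
    by unfold_locales
      (use T a0 in \<open>auto simp: bounded_op_abs symmetric_abs abs_op_nonneg abs_op_abs_op
        compact_abs_op_minus[OF T a0 mod] hyponormal_norm_adj_le[OF T assms(3)]\<close>)
  have "countable upper_eigs" "countable lower_eigs"
    by (rule countable_subset[OF _ countable_eigenvalues];
        auto simp: upper_eigs_def lower_eigs_def)+
  then obtain n m and a b :: "nat \<Rightarrow> real"
    where a: "inj_on a {i. enat i < n}" "a ` {i. enat i < n} = upper_eigs"
      and b: "inj_on b {j. enat j < m}" "b ` {j. enat j < m} = lower_eigs"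
    by (metis enumerate_countable)
  have ai: "\<alpha> < a i" if "enat i < n" for i using a(2) that by (auto simp: upper_eigs_def)
  then have a_nz: "a i \<noteq> 0" if "enat i < n" for i using a0 that by force
  \<comment> \<open>With \<open>T\<close> divided by \<open>a i\<close> as the unitary part, the
    scalar cancels on each eigenspace, so \<open>V0\<close> can be \<open>T\<close> itself.\<close>
  have sumH0: "is_dsum_op {i. enat i < n} (\<lambda>i. eig (a i)) H0 (\<lambda>i x. a i *\<^sub>R (1 / a i) *\<^sub>R T x) T"
    unfolding is_dsum_op_def using orthogonal_dsum_eig[OF a(1)] a_nz
    by (auto simp: a(2) H0_def[symmetric] T_H0 intro!: bounded_ops_restrict[OF T])
  have bRR: "(\<lambda>x. abs_op T (abs_op T x)) \<in> bounded_ops H2 H2"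
    by (rule bounded_ops_restrict[OF bounded_op_comp[OF bounded_R bounded_R]]) (rule RR_H2)
  \<comment> \<open>The diagonal operator is realized as the square of |T|, which acts on the
    eigenspace of \<open>b j\<close> as \<open>(b j)\<^sup>2\<close>.\<close>
  have sumH2: "is_dsum_op {j. enat j < m} (\<lambda>j. eig (b j)) H2 (\<lambda>j x. (b j)\<^sup>2 *\<^sub>R x) (\<lambda>x. abs_op T (abs_op T x))"
    unfolding is_dsum_op_def using orthogonal_dsum_eig[OF b(1)] bRR
    by (auto simp: b(2) H2_def[symmetric] RR adj_T_eig)
  have split: "T (x0 + x1 + x2) = T x0 + (\<alpha> *\<^sub>R V1 x1 + A x2) + B x2"
    if "x0 \<in> H0" "x1 \<in> H1" "x2 \<in> H2" for x0 x1 x2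
    using that V1(2)[of x1] T_H2_split[of x2] by (simp add: bounded_op_add[OF T] add.assoc)
  have H0_0: "H0 = {0}" if "\<alpha> = onorm T"
  proof -
    have "{\<alpha><..onorm T} = {}" using that by simp
    then have "upper_eigs = {}" unfolding upper_eigs_eq[symmetric] by blast
    then show ?thesis by (simp add: H0_def)
  qed
  have H2_0: "H2 = {0}" if "\<alpha> = min_modulus T"
  proof -
    have "{min_modulus T..<\<alpha>} = {}" using that by simp
    then have "lower_eigs = {}" unfolding lower_eigs_eq[symmetric] by blast
    then show ?thesis by (simp add: H2_def)
  qed
  have full: "H1 = UNIV \<and> (\<forall>x. T x = onorm T *\<^sub>R V1 x)" if h: "onorm T = \<alpha>" "\<alpha> = min_modulus T"
  proof -
    have "x \<in> H1" for x
    proof -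
      have "proj H0 x = 0" "proj H2 x = 0"
        using H0_0 H2_0 h proj_in[OF closed_H(1), of x] proj_in[OF closed_H(3), of x] by auto
      then show ?thesis using remainder_H1[of x] by simp
    qed
    then show ?thesis using V1(2) h by auto
  qed
  have V1_0: "V1 x = 0" if "H1 = {0}" "x \<in> H1" for x
    using that V1(1) by (auto simp: isometry_on_def)
  have bV1: "V1 \<in> bounded_ops H1 H1" using V1(1) by (simp add: isometry_on_def)
  have bT0: "T \<in> bounded_ops H0 H0" by (rule bounded_ops_restrict[OF T T_H0])
  show ?thesis
    unfolding eig_eq upper_eigs_eq
    \<comment> \<open>The operators are given on the whole space; each is judged only on its own
      summand. In particular \<open>T\<close> serves as \<open>V0\<close>, and the square of |T| as
      \<open>D\<close>.\<close>
    apply (rule exI[of _ H0], rule exI[of _ H1], rule exI[of _ H2], rule exI[of _ T],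
        rule exI[of _ V1], rule exI[of _ "\<lambda>x. A x"], rule exI[of _ "\<lambda>x. B x"], rule exI[of _ \<alpha>],
        rule exI[of _ n], rule exI[of _ a], rule exI[of _ "\<lambda>i x. (1 / a i) *\<^sub>R T x"],
        rule exI[of _ m], rule exI[of _ b], rule exI[of _ "\<lambda>x. abs_op T (abs_op T x)"])
    unfolding upper_eigs_eq lower_eigs_eq
    using dsum3 bT0 bV1 bounded_A bounded_B split ess_spectrum_eq[OF assms(1)] a0 a b sumH0 sumH2
      unitary_on_eig[OF ai] H0_0 H2_0 V1(1) V1_0 adj_V1_A adj_A_A_adj_B_B B_adj_B_le full
    by (intro conjI) simp_all
qed

end
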